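(* Let $(\mathcal{C},\Sigma,\Theta)$ be an $(n+2)$-angulated category and $\mathcal{H}$ a full subcategory of $\mathcal{C}$. Denote by $\xi$ the class of $(n+2)$-angles $$X^0\xrightarrow{d_X^0}X^1\xrightarrow{d_X^1}X^2\to\cdots\to X^n\xrightarrow{d_X^n}X^{n+1}\xrightarrow{\delta}\Sigma X^0$$ in $\Theta$ such that $\mathcal{C}(d_X^0,H):\mathcal{C}(X^1,H)\to\mathcal{C}(X^0,H)$ is an epimorphism for every $H\in\mathcal{H}$. Then the following statements hold. (1) $\xi$ is an $n$-proper class in $(\mathcal{C},\Sigma,\Theta)$, which induces an $n$-exangulated category $(\mathcal{C},\mathbb{E}_\xi,\mathfrak{s}_\xi)$. (2) If $(\mathcal{C},\mathbb{E}_\xi,\mathfrak{s}_\xi)$ is an $n$-exact category, then $\xi$ is the class of split $(n+2)$-angles. (3) If $(\mathcal{C},\mathbb{E}_\xi,\mathfrak{s}_\xi)$ is an $(n+2)$-angulated category, then $\Theta=\xi$. (4) Assume that $\mathcal{H}$ is a strongly covariantly finite subcategory of $\mathcal{C}$ which is closed under direct summands. If $\{0\}\neq\mathcal{H}\subsetneqq\mathcal{C}$, then $(\mathcal{C},\mathbb{E}_\xi,\mathfrak{s}_\xi)$ is neither $n$-exact nor $(n+2)$-angulated.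
   Context: Throughout, $n\ge 1$ is an integer and $\mathcal{C}$ is an additive category. **$(n+2)$-angulated categories (Geiss–Keller–Oppermann).** A triple $(\mathcal{C},\Sigma,\Theta)$ with $\Sigma$ an automorphism of $\mathcal{C}$ and $\Theta$ a class of sequences $X^0\xrightarrow{d^0}X^1\to\cdots\to X^{n+1}\xrightarrow{d^{n+1}}\Sigma X^0$ (called $(n+2)$-angles) such that: (F1) $\Theta$ is closed under isomorphisms, direct sums and direct summands; for every $X$ the sequence $X\xrightarrow{1}X\to0\to\cdots\to0\to\Sigma X$ is in $\Theta$; every morphism of $\mathcal{C}$ is the first morphism of some member of $\Theta$; (F2) a sequence $X^0\xrightarrow{d^0}X^1\to\cdots\to X^{n+1}\xrightarrow{d^{n+1}}\Sigma X^0$ in $\mathcal{C}$ is in $\Theta$ iff its rotation $X^1\to\cdots\to X^{n+1}\xrightarrow{d^{n+1}}\Sigma X^0\xrightarrow{(-1)^n\Sigma d^0}\Sigma X^1$ is; (F3) given two members $X,Y$ of $\Theta$, every commutative square on the first morphisms, $f^1d_X^0=d_Y^0f^0$, extends to a morphism of sequences $(f^0,\dots,f^{n+1},\Sigma f^0)$; (F4) in (F3) the $f^i$ can be chosen so that the mapping cone $X^1\oplus Y^0\to X^2\oplus Y^1\to\cdots\to\Sigma X^0\oplus Y^{n+1}\to\Sigma X^1\oplus\Sigma Y^0$ with differentials $\begin{bmatrix}-d_X^{i+1}&0\\ f^{i+1}&d_Y^i\end{bmatrix}$ (with $d_X^{n+2}=\Sigma d_X^0$, $f^{n+2}=\Sigma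 f^0$) is in $\Theta$. An $(n+2)$-angle is split if its last morphism $\delta:X^{n+1}\to\Sigma X^0$ is zero. **$n$-exangulated categories (Herschend–Liu–Nakaoka).** Let $\mathbb{E}:\mathcal{C}^{\mathrm{op}}\times\mathcal{C}\to\mathrm{Ab}$ be an additive bifunctor; elements $\delta\in\mathbb{E}(C,A)$ are extensions, with $a_*\delta=\mathbb{E}(C,a)(\delta)$, $c^*\delta=\mathbb{E}(c,A)(\delta)$. A morphism of extensions $\delta\in\mathbb{E}(C,A)\to\delta'\in\mathbb{E}(C',A')$ is a pair $(a,c)$ with $a:A\to A'$, $c:C\to C'$, $a_*\delta=c^*\delta'$. $\mathbf{C}^{n+2}_{\mathcal{C}}$ is the category of complexes $X^\bullet=(X^0\to\cdots\to X^{n+1})$; $\mathbf{C}^{n+2}_{(A,C)}$ is the subcategory of those with $X^0=A$, $X^{n+1}=C$ and chain maps that are identities in degrees $0$ and $n+1$; $[X^\bullet]$ is the homotopy equivalence class in the quotient $\mathbf{K}^{n+2}_{(A,C)}$ of it by homotopy. An $n$-exangle is a pair $\langle X^\bullet,\delta\rangle$, $\delta\in\mathbb{E}(X^{n+1},X^0)$, such that $\mathcal{C}(-,X^0)\to\cdots\to\mathcal{C}(-,X^{n+1})\xrightarrow{f\mapsto f^*\delta}\mathbb{E}(-,X^0)$ and $\mathcal{C}(X^{n+1},-)\to\cdots\to\mathcal{C}(X^0,-)\xrightarrow{g\mapsto g_*\delta}\mathbb{E}(X^{n+1},-)$ are exact. A morphism $\langle X^\bullet,\delta\rangle\to\langle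 Y^\bullet,\rho\rangle$ is a chain map $f^\bullet$ with $(f^0)_*\delta=(f^{n+1})^*\rho$. An exact realization $\mathfrak{s}$ assigns to each $\delta\in\mathbb{E}(C,A)$ a class $\mathfrak{s}(\delta)=[X^\bullet]$, $X^\bullet\in\mathbf{C}^{n+2}_{(A,C)}$, such that (R0) every morphism of extensions $(a,c)$ lifts to a chain map between representatives which is $a$ in degree $0$ and $c$ in degree $n+1$; (R1) $\langle X^\bullet,\delta\rangle$ is an $n$-exangle whenever $\mathfrak{s}(\delta)=[X^\bullet]$; (R2) $0\in\mathbb{E}(0,A)$ is sent to $[A\xrightarrow{1}A\to0\to\cdots\to0]$ and $0\in\mathbb{E}(A,0)$ to $[0\to\cdots\to0\to A\xrightarrow{1}A]$. If $\mathfrak{s}(\delta)=[X^\bullet]$, $\langle X^\bullet,\delta\rangle$ is a distinguished $n$-exangle, $X^\bullet$ a conflation, $d_X^0$ an inflation, $d_X^n$ a deflation. $(\mathcal{C},\mathbb{E},\mathfrak{s})$ is $n$-exangulated if (EA1) inflations, and deflations, are closed under composition; (EA2) for $\rho\in\mathbb{E}(D,A)$, $c:C\to D$ and distinguished $\langle X^\bullet,c^*\rho\rangle$, $\langle Y^\bullet,\rho\rangle$, the pair $(1_A,c)$ has a lift $f^\bullet$ such that $\langle M_f^\bullet,(d_X^0)_*\rho\rangle$ is distinguished, where $M_f^\bullet$ is $X^1\to X^2\oplus Y^1\to\cdots\to X^{n+1}\oplus Y^n\to Y^{n+1}$ with differentials $\begin{bmatrix}-d_X^1\\ f^1\end{bmatrix}$,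 $\begin{bmatrix}-d_X^{i+1}&0\\ f^{i+1}&d_Y^i\end{bmatrix}$, $\begin{bmatrix}f^{n+1}&d_Y^n\end{bmatrix}$; (EA2$^{\mathrm{op}}$) the dual of (EA2). **The $n$-exangulated structure of $(\mathcal{C},\Sigma,\Theta)$.** $(\mathcal{C},\Sigma,\Theta)$ is regarded as an $n$-exangulated category $(\mathcal{C},\mathbb{E},\mathfrak{s})$ with $\mathbb{E}(C,A)=\mathcal{C}(C,\Sigma A)$ and $\mathfrak{s}(\delta)=[X^\bullet]$ for any $(n+2)$-angle $X^0=A\to X^1\to\cdots\to X^{n+1}=C\xrightarrow{\delta}\Sigma A$. An $n$-exangulated category is said to be an $(n+2)$-angulated category if it arises, up to natural isomorphism of the bifunctor, in this way from some $(n+2)$-angulated structure on its underlying category. **$n$-exact categories (Jasso).** An $n$-exact sequence in $\mathcal{C}$ is a complex $X^0\to\cdots\to X^{n+1}$ such that $0\to\mathcal{C}(-,X^0)\to\cdots\to\mathcal{C}(-,X^{n+1})$ and $0\to\mathcal{C}(X^{n+1},-)\to\cdots\to\mathcal{C}(X^0,-)$ are exact. An $n$-exact structure is a class $\mathcal{E}$ of $n$-exact sequences (admissible ones; their first and last morphisms are admissible monomorphisms and epimorphisms) closed under Jasso's weak isomorphisms (chain maps of $n$-exact sequences that are isomorphisms in two cyclically consecutive degrees), containing the zero sequence, with admissible monomorphisms and admissible epimorphisms each closed under composition, and such that for admissible $X^\bullet$ and $f:X^0\to Y^0$ there is a chain map $(X^0\to\cdots\to X^n)\to(Y^0\to\cdots\to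 Y^n)$ extending $f$ which is an $n$-pushout diagram (i.e. the cone $X^0\to X^1\oplus Y^0\to\cdots\to X^n\oplus Y^{n-1}\to Y^n$ becomes exact under $\mathcal{C}(-,Z)$ for all $Z$, in the form $0\to\mathcal{C}(Y^n,Z)\to\cdots\to\mathcal{C}(X^0,Z)$) with $d_Y^0$ an admissible monomorphism; and dually. An $n$-exact category is regarded as an $n$-exangulated category with $\mathbb{E}(C,A)$ the set of classes $[X^\bullet]$ of admissible $n$-exact sequences from $A$ to $C$ and $\mathfrak{s}$ the tautological realization; an $n$-exangulated category is said to be an $n$-exact category if it arises in this way, up to natural isomorphism of the bifunctor (so its conflations are the admissible $n$-exact sequences). **$n$-proper classes.** In an $n$-exangulated category $(\mathcal{C},\mathbb{E},\mathfrak{s})$, a weak isomorphism is a morphism $f^\bullet$ of distinguished $n$-exangles with $f^0$ and $f^{n+1}$ isomorphisms; a distinguished $n$-exangle $\langle X^\bullet,\delta\rangle$ is split if $\delta=0$. For a class $\xi$ of distinguished $n$-exangles, a $\xi$-inflation (resp. $\xi$-deflation) is a morphism of the form $d_X^0$ (resp. $d_X^n$) with $\langle X^\bullet,\delta\rangle\in\xi$. $\xi$ is an $n$-proper class if: (i) it contains all split distinguished $n$-exangles and is closed under weak isomorphisms and finite coproducts; (ii) it is closed under base change (for $\langle X^\bullet,\delta\rangle\in\xi$ and $c:C'\to X^{n+1}$, every distinguished $\langle Y^\bullet,c^*\delta\rangle$ is in $\xi$) and cobase change (for $a:X^0\to A'$, every distinguished $\langle Y^\bullet,a_*\delta\rangle$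 is in $\xi$); (iii) it is saturated: for every commutative square $ba=dc$ with $a:A\to B$, $b:B\to D$, $c:A\to C$, $d:C\to D$ and $a,b,d$ deflations, if $a,b$ are $\xi$-deflations then so is $d$. A class of $(n+2)$-angles is called an $n$-proper class in $(\mathcal{C},\Sigma,\Theta)$ if the class of distinguished $n$-exangles it induces is $n$-proper in the associated $n$-exangulated category. **$\mathbb{E}_\xi$, $\mathfrak{s}_\xi$.** $\mathbb{E}_\xi(C,A)$ is the set of $\delta\in\mathbb{E}(C,A)$ realized as a distinguished $n$-exangle $\langle X^\bullet,\delta\rangle$ in (the class induced by) $\xi$, with $X^0=A$, $X^{n+1}=C$; $\mathfrak{s}_\xi=\mathfrak{s}|_{\mathbb{E}_\xi}$. **Strongly covariantly finite.** A morphism $f:A\to B$ is a left $\mathcal{H}$-approximation of $A$ if $B\in\mathcal{H}$ and $\mathcal{C}(f,H):\mathcal{C}(B,H)\to\mathcal{C}(A,H)$ is an epimorphism for every $H\in\mathcal{H}$. $\mathcal{H}$ is strongly covariantly finite in $(\mathcal{C},\Sigma,\Theta)$ if for every $B\in\mathcal{C}$ there is an $(n+2)$-angle $B\xrightarrow{f}H^1\to H^2\to\cdots\to H^n\to C\to\Sigma B$ with $f$ a left $\mathcal{H}$-approximation of $B$ and $H^1,\dots,H^n\in\mathcal{H}$. The condition $\{0\}\ne\mathcal{H}\subsetneqq\mathcal{C}$ means that $\mathcal{H}$ contains a nonzero object and does not contain all objects of $\mathcal{C}$. *)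

theory Defs
  imports "HOL-Algebra.Group" "HOL-Library.FuncSet"
begin

section \<open>Additive categories\<close>

text \<open>
  Hom-sets are abelian groups in the sense of HOL-Algebra, whose notation is multiplicative:
  the sum of \<open>f\<close> and \<open>g\<close> is \<open>f \<otimes>\<^bsub>Hom C A B\<^esub> g\<close>, the zero morphism is \<open>\<one>\<^bsub>Hom C A B\<^esub>\<close> and
  \<open>- f\<close> is \<open>inv\<^bsub>Hom C A B\<^esub> f\<close>.  The same convention is used for the extension groups below.
\<close>

record ('o, 'm) cat =
  Ob :: "'o set"
  Hom :: "'o \<Rightarrow> 'o \<Rightarrow> 'm monoid"
  Id :: "'o \<Rightarrow> 'm"
  Comp :: "'m \<Rightarrow> 'm \<Rightarrow> 'm" (infixr "\<cdot>\<index>" 75)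

abbreviation mor :: "('o, 'm) cat \<Rightarrow> 'o \<Rightarrow> 'o \<Rightarrow> 'm set" where
  "mor C A B \<equiv> carrier (Hom C A B)"

abbreviation zmor :: "('o, 'm) cat \<Rightarrow> 'o \<Rightarrow> 'o \<Rightarrow> 'm" where
  "zmor C A B \<equiv> \<one>\<^bsub>Hom C A B\<^esub>"

abbreviation neg :: "('o, 'm) cat \<Rightarrow> 'o \<Rightarrow> 'o \<Rightarrow> 'm \<Rightarrow> 'm" where
  "neg C A B f \<equiv> inv\<^bsub>Hom C A B\<^esub> f"

definition is_zero :: "('o, 'm) cat \<Rightarrow> 'o \<Rightarrow> bool" where
  "is_zero C Z \<longleftrightarrow> Z \<in> Ob C \<and>
    (\<forall>A\<in>Ob C. mor C Z A = {zmor C Z A} \<and> mor C A Z = {zmor C A Z})"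

definition is_iso :: "('o, 'm) cat \<Rightarrow> 'o \<Rightarrow> 'o \<Rightarrow> 'm \<Rightarrow> bool" where
  "is_iso C A B f \<longleftrightarrow> f \<in> mor C A B \<and>
    (\<exists>g\<in>mor C B A. g \<cdot>\<^bsub>C\<^esub> f = Id C A \<and> f \<cdot>\<^bsub>C\<^esub> g = Id C B)"

definition biproduct ::
  "('o, 'm) cat \<Rightarrow> 'o \<Rightarrow> 'o \<Rightarrow> 'o \<Rightarrow> 'm \<Rightarrow> 'm \<Rightarrow> 'm \<Rightarrow> 'm \<Rightarrow> bool" where
  "biproduct C A B P i j p q \<longleftrightarrow> P \<in> Ob C \<and>
    i \<in> mor C A P \<and> j \<in> mor C B P \<and> p \<in> mor C P A \<and> q \<in> mor C P B \<and>
    p \<cdot>\<^bsub>C\<^esub> i = Id C A \<and> q \<cdot>\<^bsub>C\<^esub> j = Id C B \<and>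
    p \<cdot>\<^bsub>C\<^esub> j = zmor C B A \<and> q \<cdot>\<^bsub>C\<^esub> i = zmor C A B \<and>
    (i \<cdot>\<^bsub>C\<^esub> p) \<otimes>\<^bsub>Hom C P P\<^esub> (j \<cdot>\<^bsub>C\<^esub> q) = Id C P"

locale additive_category =
  fixes C :: "('o, 'm) cat"
  assumes hom_group: "\<lbrakk>A \<in> Ob C; B \<in> Ob C\<rbrakk> \<Longrightarrow> comm_group (Hom C A B)"
    and hom_disjoint:
      "\<lbrakk>A \<in> Ob C; B \<in> Ob C; A' \<in> Ob C; B' \<in> Ob C; f \<in> mor C A B; f \<in> mor C A' B'\<rbrakk>
        \<Longrightarrow> A = A' \<and> B = B'"
    and id_mor: "A \<in> Ob C \<Longrightarrow> Id C A \<in> mor C A A"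
    and comp_mor:
      "\<lbrakk>A \<in> Ob C; B \<in> Ob C; D \<in> Ob C; f \<in> mor C A B; g \<in> mor C B D\<rbrakk>
        \<Longrightarrow> g \<cdot>\<^bsub>C\<^esub> f \<in> mor C A D"
    and comp_assoc:
      "\<lbrakk>A \<in> Ob C; B \<in> Ob C; D \<in> Ob C; K \<in> Ob C;
        f \<in> mor C A B; g \<in> mor C B D; h \<in> mor C D K\<rbrakk>
        \<Longrightarrow> (h \<cdot>\<^bsub>C\<^esub> g) \<cdot>\<^bsub>C\<^esub> f = h \<cdot>\<^bsub>C\<^esub> (g \<cdot>\<^bsub>C\<^esub> f)"
    and id_left: "\<lbrakk>A \<in> Ob C; B \<in> Ob C; f \<in> mor C A B\<rbrakk> \<Longrightarrow> Id C B \<cdot>\<^bsub>C\<^esub> f = f"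
    and id_right: "\<lbrakk>A \<in> Ob C; B \<in> Ob C; f \<in> mor C A B\<rbrakk> \<Longrightarrow> f \<cdot>\<^bsub>C\<^esub> Id C A = f"
    and comp_add_left:
      "\<lbrakk>A \<in> Ob C; B \<in> Ob C; D \<in> Ob C; f \<in> mor C A B; g \<in> mor C B D; g' \<in> mor C B D\<rbrakk>
        \<Longrightarrow> (g \<otimes>\<^bsub>Hom C B D\<^esub> g') \<cdot>\<^bsub>C\<^esub> f = (g \<cdot>\<^bsub>C\<^esub> f) \<otimes>\<^bsub>Hom C A D\<^esub> (g' \<cdot>\<^bsub>C\<^esub> f)"
    and comp_add_right:
      "\<lbrakk>A \<in> Ob C; B \<in> Ob C; D \<in> Ob C; f \<in> mor C A B; f' \<in> mor C A B; g \<in> mor C B D\<rbrakk>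
        \<Longrightarrow> g \<cdot>\<^bsub>C\<^esub> (f \<otimes>\<^bsub>Hom C A B\<^esub> f') = (g \<cdot>\<^bsub>C\<^esub> f) \<otimes>\<^bsub>Hom C A D\<^esub> (g \<cdot>\<^bsub>C\<^esub> f')"
    and zero_exists: "\<exists>Z. is_zero C Z"
    and biproduct_exists:
      "\<lbrakk>A \<in> Ob C; B \<in> Ob C\<rbrakk> \<Longrightarrow> \<exists>P i j p q. biproduct C A B P i j p q"

text \<open>
  Biproducts are chosen once and for all; every notion below that mentions a biproduct is
  invariant under replacing it by an isomorphic one.
\<close>

definition bip :: "('o, 'm) cat \<Rightarrow> 'o \<Rightarrow> 'o \<Rightarrow> 'o \<times> 'm \<times> 'm \<times> 'm \<times> 'm" where
  "bip C A B = (SOME (P, i, j, p, q). biproduct C A B P i j p q)"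

definition bsum :: "('o, 'm) cat \<Rightarrow> 'o \<Rightarrow> 'o \<Rightarrow> 'o" where
  "bsum C A B = (case bip C A B of (P, i, j, p, q) \<Rightarrow> P)"

definition in1 :: "('o, 'm) cat \<Rightarrow> 'o \<Rightarrow> 'o \<Rightarrow> 'm" where
  "in1 C A B = (case bip C A B of (P, i, j, p, q) \<Rightarrow> i)"

definition in2 :: "('o, 'm) cat \<Rightarrow> 'o \<Rightarrow> 'o \<Rightarrow> 'm" where
  "in2 C A B = (case bip C A B of (P, i, j, p, q) \<Rightarrow> j)"

definition pr1 :: "('o, 'm) cat \<Rightarrow> 'o \<Rightarrow> 'o \<Rightarrow> 'm" where
  "pr1 C A B = (case bip C A B of (P, i, j, p, q) \<Rightarrow> p)"

definition pr2 :: "('o, 'm) cat \<Rightarrow> 'o \<Rightarrow> 'o \<Rightarrow> 'm" where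
  "pr2 C A B = (case bip C A B of (P, i, j, p, q) \<Rightarrow> q)"

text \<open>
  Matrices: \<open>mcol C A B1 B2 f g\<close> is the column \<open>A \<rightarrow> B1 \<oplus> B2\<close>, \<open>mrow C A1 A2 B f g\<close> the row
  \<open>A1 \<oplus> A2 \<rightarrow> B\<close>, and \<open>mat C A1 A2 B1 B2 f11 f12 f21 f22\<close> the matrix \<open>A1 \<oplus> A2 \<rightarrow> B1 \<oplus> B2\<close>
  with rows \<open>(f11, f12)\<close> and \<open>(f21, f22)\<close>.
\<close>

definition mcol :: "('o, 'm) cat \<Rightarrow> 'o \<Rightarrow> 'o \<Rightarrow> 'o \<Rightarrow> 'm \<Rightarrow> 'm \<Rightarrow> 'm" where
  "mcol C A B1 B2 f g =
    (in1 C B1 B2 \<cdot>\<^bsub>C\<^esub> f) \<otimes>\<^bsub>Hom C A (bsum C B1 B2)\<^esub> (in2 C B1 B2 \<cdot>\<^bsub>C\<^esub> g)"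

definition mrow :: "('o, 'm) cat \<Rightarrow> 'o \<Rightarrow> 'o \<Rightarrow> 'o \<Rightarrow> 'm \<Rightarrow> 'm \<Rightarrow> 'm" where
  "mrow C A1 A2 B f g =
    (f \<cdot>\<^bsub>C\<^esub> pr1 C A1 A2) \<otimes>\<^bsub>Hom C (bsum C A1 A2) B\<^esub> (g \<cdot>\<^bsub>C\<^esub> pr2 C A1 A2)"

definition mat ::
  "('o, 'm) cat \<Rightarrow> 'o \<Rightarrow> 'o \<Rightarrow> 'o \<Rightarrow> 'o \<Rightarrow> 'm \<Rightarrow> 'm \<Rightarrow> 'm \<Rightarrow> 'm \<Rightarrow> 'm" where
  "mat C A1 A2 B1 B2 f11 f12 f21 f22 =
    mcol C (bsum C A1 A2) B1 B2 (mrow C A1 A2 B1 f11 f12) (mrow C A1 A2 B2 f21 f22)"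


section \<open>Complexes\<close>

text \<open>
  A complex \<open>X\<^sup>0 \<rightarrow> \<dots> \<rightarrow> X\<^sup>m\<close> is given by its objects \<open>ob X i\<close> for \<open>i \<le> m\<close> and differentials
  \<open>df X i\<close> for \<open>i < m\<close>; all other values are irrelevant, and all notions below ignore them
  (classes of complexes are always closed under isomorphism).  The objects of the category of
  \<open>(n+2)\<close>-term complexes are the complexes with \<open>m = n + 1\<close>.
\<close>

record ('o, 'm) seq =
  ob :: "nat \<Rightarrow> 'o"
  df :: "nat \<Rightarrow> 'm"

definition cplx :: "('o, 'm) cat \<Rightarrow> nat \<Rightarrow> ('o, 'm) seq \<Rightarrow> bool" where
  "cplx C m X \<longleftrightarrow>
    (\<forall>i\<le>m. ob X i \<in> Ob C) \<and>
    (\<forall>i<m. df X i \<in> mor C (ob X i) (ob X (i + 1))) \<and>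
    (\<forall>i. i + 1 < m \<longrightarrow> df X (i + 1) \<cdot>\<^bsub>C\<^esub> df X i = zmor C (ob X i) (ob X (i + 2)))"

definition chain_map ::
  "('o, 'm) cat \<Rightarrow> nat \<Rightarrow> ('o, 'm) seq \<Rightarrow> ('o, 'm) seq \<Rightarrow> (nat \<Rightarrow> 'm) \<Rightarrow> bool" where
  "chain_map C m X Y f \<longleftrightarrow>
    (\<forall>i\<le>m. f i \<in> mor C (ob X i) (ob Y i)) \<and>
    (\<forall>i<m. df Y i \<cdot>\<^bsub>C\<^esub> f i = f (i + 1) \<cdot>\<^bsub>C\<^esub> df X i)"

definition homotopic ::
  "('o, 'm) cat \<Rightarrow> nat \<Rightarrow> ('o, 'm) seq \<Rightarrow> ('o, 'm) seq
    \<Rightarrow> (nat \<Rightarrow> 'm) \<Rightarrow> (nat \<Rightarrow> 'm) \<Rightarrow> bool" where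
  "homotopic C m X Y f g \<longleftrightarrow>
    (\<exists>h. (\<forall>i. 0 < i \<and> i \<le> m \<longrightarrow> h i \<in> mor C (ob X i) (ob Y (i - 1))) \<and>
      g 0 = f 0 \<otimes>\<^bsub>Hom C (ob X 0) (ob Y 0)\<^esub> (h 1 \<cdot>\<^bsub>C\<^esub> df X 0) \<and>
      (\<forall>i. 0 < i \<and> i < m \<longrightarrow>
        g i = f i \<otimes>\<^bsub>Hom C (ob X i) (ob Y i)\<^esub>
          ((df Y (i - 1) \<cdot>\<^bsub>C\<^esub> h i) \<otimes>\<^bsub>Hom C (ob X i) (ob Y i)\<^esub> (h (i + 1) \<cdot>\<^bsub>C\<^esub> df X i))) \<and>
      g m = f m \<otimes>\<^bsub>Hom C (ob X m) (ob Y m)\<^esub> (df Y (m - 1) \<cdot>\<^bsub>C\<^esub> h m))"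

definition end_fixing_map ::
  "('o, 'm) cat \<Rightarrow> nat \<Rightarrow> ('o, 'm) seq \<Rightarrow> ('o, 'm) seq \<Rightarrow> (nat \<Rightarrow> 'm) \<Rightarrow> bool" where
  "end_fixing_map C m X Y f \<longleftrightarrow> chain_map C m X Y f \<and>
    ob X 0 = ob Y 0 \<and> ob X m = ob Y m \<and> f 0 = Id C (ob X 0) \<and> f m = Id C (ob X m)"

definition homotopy_equivalent ::
  "('o, 'm) cat \<Rightarrow> nat \<Rightarrow> ('o, 'm) seq \<Rightarrow> ('o, 'm) seq \<Rightarrow> bool" where
  "homotopy_equivalent C m X Y \<longleftrightarrow>
    (\<exists>f g. end_fixing_map C m X Y f \<and> end_fixing_map C m Y X g \<and>
      homotopic C m X X (\<lambda>i. g i \<cdot>\<^bsub>C\<^esub> f i) (\<lambda>i. Id C (ob X i)) \<and>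
      homotopic C m Y Y (\<lambda>i. f i \<cdot>\<^bsub>C\<^esub> g i) (\<lambda>i. Id C (ob Y i)))"

text \<open>The class \<open>[X]\<close> of an \<open>(m+1)\<close>-term complex in the homotopy category with fixed ends.\<close>

definition hclass :: "('o, 'm) cat \<Rightarrow> nat \<Rightarrow> ('o, 'm) seq \<Rightarrow> ('o, 'm) seq set" where
  "hclass C m X = {Y. cplx C m Y \<and> homotopy_equivalent C m X Y}"

definition seq_sum :: "('o, 'm) cat \<Rightarrow> ('o, 'm) seq \<Rightarrow> ('o, 'm) seq \<Rightarrow> ('o, 'm) seq" where
  "seq_sum C X Y =
    \<lparr>ob = (\<lambda>i. bsum C (ob X i) (ob Y i)),
     df = (\<lambda>i. mat C (ob X i) (ob Y i) (ob X (i + 1)) (ob Y (i + 1))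
        (df X i) (zmor C (ob Y i) (ob X (i + 1)))
        (zmor C (ob X i) (ob Y (i + 1))) (df Y i))\<rparr>"

text \<open>\<open>X\<^sup>1 \<rightarrow> X\<^sup>2 \<rightarrow> \<dots>\<close>, re-indexed to start in degree \<open>0\<close>.\<close>

definition tail_seq :: "('o, 'm) seq \<Rightarrow> ('o, 'm) seq" where
  "tail_seq X = \<lparr>ob = (\<lambda>i. ob X (i + 1)), df = (\<lambda>i. df X (i + 1))\<rparr>"

text \<open>
  For a chain map \<open>f\<close> between complexes with degrees \<open>0, \<dots>, n\<close>, the mapping cone
  \<open>X\<^sup>0 \<rightarrow> X\<^sup>1 \<oplus> Y\<^sup>0 \<rightarrow> \<dots> \<rightarrow> X\<^sup>n \<oplus> Y\<^sup>n\<^sup>-\<^sup>1 \<rightarrow> Y\<^sup>n\<close>.  It serves both for \<open>n\<close>-pushout diagrams and, applied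
  to the degrees \<open>1, \<dots>, n + 1\<close> of a morphism with \<open>f\<^sup>0 = 1\<close>, for the complex \<open>M\<^sub>f\<close> of (EA2).
\<close>

definition mcone ::
  "('o, 'm) cat \<Rightarrow> nat \<Rightarrow> ('o, 'm) seq \<Rightarrow> ('o, 'm) seq \<Rightarrow> (nat \<Rightarrow> 'm) \<Rightarrow> ('o, 'm) seq" where
  "mcone C n X Y f =
    \<lparr>ob = (\<lambda>i. if i = 0 then ob X 0
        else if i \<le> n then bsum C (ob X i) (ob Y (i - 1)) else ob Y n),
     df = (\<lambda>i.
        if i = 0 then
          mcol C (ob X 0) (ob X 1) (ob Y 0) (neg C (ob X 0) (ob X 1) (df X 0)) (f 0)
        else if i < n then
          mat C (ob X i) (ob Y (i - 1)) (ob X (i + 1)) (ob Y i)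
            (neg C (ob X i) (ob X (i + 1)) (df X i)) (zmor C (ob Y (i - 1)) (ob X (i + 1)))
            (f i) (df Y (i - 1))
        else mrow C (ob X n) (ob Y (n - 1)) (ob Y n) (f n) (df Y (n - 1)))\<rparr>"

text \<open>
  The complex of the dual axiom, \<open>X\<^sup>0 \<rightarrow> Y\<^sup>0 \<oplus> X\<^sup>1 \<rightarrow> \<dots> \<rightarrow> Y\<^sup>n\<^sup>-\<^sup>1 \<oplus> X\<^sup>n \<rightarrow> Y\<^sup>n\<close>: it is \<open>M\<close> formed in
  the opposite category, i.e. the matrices are transposed and the minus signs fall on the
  differentials of \<open>Y\<close>.
\<close>

definition mcocone ::
  "('o, 'm) cat \<Rightarrow> nat \<Rightarrow> ('o, 'm) seq \<Rightarrow> ('o, 'm) seq \<Rightarrow> (nat \<Rightarrow> 'm) \<Rightarrow> ('o, 'm) seq" where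
  "mcocone C n X Y f =
    \<lparr>ob = (\<lambda>i. if i = 0 then ob X 0
        else if i \<le> n then bsum C (ob Y (i - 1)) (ob X i) else ob Y n),
     df = (\<lambda>i.
        if i = 0 then mcol C (ob X 0) (ob Y 0) (ob X 1) (f 0) (df X 0)
        else if i < n then
          mat C (ob Y (i - 1)) (ob X i) (ob Y i) (ob X (i + 1))
            (neg C (ob Y (i - 1)) (ob Y i) (df Y (i - 1))) (f i)
            (zmor C (ob Y (i - 1)) (ob X (i + 1))) (df X i)
        else
          mrow C (ob Y (n - 1)) (ob X n) (ob Y n)
            (neg C (ob Y (n - 1)) (ob Y n) (df Y (n - 1))) (f n))\<rparr>"

text \<open>Exactness of \<open>0 \<rightarrow> C(W, X\<^sup>0) \<rightarrow> \<dots> \<rightarrow> C(W, X\<^sup>n\<^sup>+\<^sup>1)\<close> and of \<open>0 \<rightarrow> C(X\<^sup>n\<^sup>+\<^sup>1, W) \<rightarrow> \<dots> \<rightarrow> C(X\<^sup>0, W)\<close>.\<close>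

definition left_exact :: "('o, 'm) cat \<Rightarrow> nat \<Rightarrow> ('o, 'm) seq \<Rightarrow> bool" where
  "left_exact C n X \<longleftrightarrow>
    (\<forall>W\<in>Ob C.
      (\<forall>g\<in>mor C W (ob X 0). df X 0 \<cdot>\<^bsub>C\<^esub> g = zmor C W (ob X 1) \<longrightarrow> g = zmor C W (ob X 0)) \<and>
      (\<forall>i. 1 \<le> i \<and> i \<le> n \<longrightarrow>
        (\<forall>g\<in>mor C W (ob X i). df X i \<cdot>\<^bsub>C\<^esub> g = zmor C W (ob X (i + 1)) \<longleftrightarrow>
          (\<exists>h\<in>mor C W (ob X (i - 1)). g = df X (i - 1) \<cdot>\<^bsub>C\<^esub> h))))"

definition right_exact :: "('o, 'm) cat \<Rightarrow> nat \<Rightarrow> ('o, 'm) seq \<Rightarrow> bool" where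
  "right_exact C n X \<longleftrightarrow>
    (\<forall>W\<in>Ob C.
      (\<forall>g\<in>mor C (ob X (n + 1)) W. g \<cdot>\<^bsub>C\<^esub> df X n = zmor C (ob X n) W
        \<longrightarrow> g = zmor C (ob X (n + 1)) W) \<and>
      (\<forall>i. 1 \<le> i \<and> i \<le> n \<longrightarrow>
        (\<forall>g\<in>mor C (ob X i) W. g \<cdot>\<^bsub>C\<^esub> df X (i - 1) = zmor C (ob X (i - 1)) W \<longleftrightarrow>
          (\<exists>h\<in>mor C (ob X (i + 1)) W. g = h \<cdot>\<^bsub>C\<^esub> df X i))))"


section \<open>\<open>(n+2)\<close>-angulated categories\<close>

record ('o, 'm) endo =
  on_ob :: "'o \<Rightarrow> 'o"
  on_mor :: "'m \<Rightarrow> 'm"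

definition automorphism :: "('o, 'm) cat \<Rightarrow> ('o, 'm) endo \<Rightarrow> bool" where
  "automorphism C S \<longleftrightarrow>
    bij_betw (on_ob S) (Ob C) (Ob C) \<and>
    (\<forall>A\<in>Ob C. \<forall>B\<in>Ob C. on_mor S \<in> iso (Hom C A B) (Hom C (on_ob S A) (on_ob S B))) \<and>
    (\<forall>A\<in>Ob C. on_mor S (Id C A) = Id C (on_ob S A)) \<and>
    (\<forall>A\<in>Ob C. \<forall>B\<in>Ob C. \<forall>D\<in>Ob C. \<forall>f\<in>mor C A B. \<forall>g\<in>mor C B D.
      on_mor S (g \<cdot>\<^bsub>C\<^esub> f) = on_mor S g \<cdot>\<^bsub>C\<^esub> on_mor S f)"

text \<open>
  A sequence \<open>X\<^sup>0 \<rightarrow> \<dots> \<rightarrow> X\<^sup>n\<^sup>+\<^sup>1 \<rightarrow> \<Sigma>X\<^sup>0\<close> is a pair \<open>(X, \<delta>)\<close> whose second component is the last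
  morphism, so that an \<open>(n+2)\<close>-angle and the \<open>n\<close>-exangle it induces are the same pair.
\<close>

definition sigma_seq ::
  "('o, 'm) cat \<Rightarrow> nat \<Rightarrow> ('o, 'm) endo \<Rightarrow> ('o, 'm) seq \<times> 'm \<Rightarrow> bool" where
  "sigma_seq C n S = (\<lambda>(X, \<delta>).
    (\<forall>i\<le>n + 1. ob X i \<in> Ob C) \<and>
    (\<forall>i\<le>n. df X i \<in> mor C (ob X i) (ob X (i + 1))) \<and>
    \<delta> \<in> mor C (ob X (n + 1)) (on_ob S (ob X 0)))"

definition sigma_map ::
  "('o, 'm) cat \<Rightarrow> nat \<Rightarrow> ('o, 'm) endo \<Rightarrow> ('o, 'm) seq \<times> 'm \<Rightarrow> ('o, 'm) seq \<times> 'm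
    \<Rightarrow> (nat \<Rightarrow> 'm) \<Rightarrow> bool" where
  "sigma_map C n S = (\<lambda>(X, \<delta>) (Y, \<rho>) f.
    chain_map C (n + 1) X Y f \<and> \<rho> \<cdot>\<^bsub>C\<^esub> f (n + 1) = on_mor S (f 0) \<cdot>\<^bsub>C\<^esub> \<delta>)"

definition sigma_iso ::
  "('o, 'm) cat \<Rightarrow> nat \<Rightarrow> ('o, 'm) endo \<Rightarrow> ('o, 'm) seq \<times> 'm \<Rightarrow> ('o, 'm) seq \<times> 'm \<Rightarrow> bool" where
  "sigma_iso C n S T U \<longleftrightarrow>
    (\<exists>f. sigma_map C n S T U f \<and> (\<forall>i\<le>n + 1. is_iso C (ob (fst T) i) (ob (fst U) i) (f i)))"

text \<open>
  As \<open>C\<close> need not have split idempotents, direct summands (of sequences here, of objects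
  later) are understood as retracts.
\<close>

definition sigma_summand ::
  "('o, 'm) cat \<Rightarrow> nat \<Rightarrow> ('o, 'm) endo \<Rightarrow> ('o, 'm) seq \<times> 'm \<Rightarrow> ('o, 'm) seq \<times> 'm \<Rightarrow> bool" where
  "sigma_summand C n S T U \<longleftrightarrow>
    (\<exists>f g. sigma_map C n S T U f \<and> sigma_map C n S U T g \<and>
      (\<forall>i\<le>n + 1. g i \<cdot>\<^bsub>C\<^esub> f i = Id C (ob (fst T) i)))"

text \<open>The identification of \<open>\<Sigma>A \<oplus> \<Sigma>B\<close> with \<open>\<Sigma>(A \<oplus> B)\<close>.\<close>

definition sigma_sum_iso :: "('o, 'm) cat \<Rightarrow> ('o, 'm) endo \<Rightarrow> 'o \<Rightarrow> 'o \<Rightarrow> 'm" where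
  "sigma_sum_iso C S A B =
    mrow C (on_ob S A) (on_ob S B) (on_ob S (bsum C A B))
      (on_mor S (in1 C A B)) (on_mor S (in2 C A B))"

definition sigma_sum ::
  "('o, 'm) cat \<Rightarrow> nat \<Rightarrow> ('o, 'm) endo \<Rightarrow> ('o, 'm) seq \<times> 'm \<Rightarrow> ('o, 'm) seq \<times> 'm
    \<Rightarrow> ('o, 'm) seq \<times> 'm" where
  "sigma_sum C n S = (\<lambda>(X, \<delta>) (Y, \<rho>).
    (seq_sum C X Y,
     sigma_sum_iso C S (ob X 0) (ob Y 0) \<cdot>\<^bsub>C\<^esub>
       mat C (ob X (n + 1)) (ob Y (n + 1)) (on_ob S (ob X 0)) (on_ob S (ob Y 0))
         \<delta> (zmor C (ob Y (n + 1)) (on_ob S (ob X 0)))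
         (zmor C (ob X (n + 1)) (on_ob S (ob Y 0))) \<rho>))"

definition rotation ::
  "('o, 'm) cat \<Rightarrow> nat \<Rightarrow> ('o, 'm) endo \<Rightarrow> ('o, 'm) seq \<times> 'm \<Rightarrow> ('o, 'm) seq \<times> 'm" where
  "rotation C n S = (\<lambda>(X, \<delta>).
    (\<lparr>ob = (\<lambda>i. if i \<le> n then ob X (i + 1) else on_ob S (ob X 0)),
      df = (\<lambda>i. if i < n then df X (i + 1) else \<delta>)\<rparr>,
     if even n then on_mor S (df X 0)
     else neg C (on_ob S (ob X 0)) (on_ob S (ob X 1)) (on_mor S (df X 0))))"

text \<open>
  The mapping cone of (F4).  In the auxiliary functions, \<open>X\<^sup>n\<^sup>+\<^sup>2 = \<Sigma>X\<^sup>0\<close> and \<open>d\<^sup>n\<^sup>+\<^sup>1 = \<delta>\<close>; the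
  target \<open>\<Sigma>X\<^sup>1 \<oplus> \<Sigma>Y\<^sup>0\<close> of the last morphism is identified with \<open>\<Sigma>(X\<^sup>1 \<oplus> Y\<^sup>0)\<close>.
\<close>

definition sigma_cone ::
  "('o, 'm) cat \<Rightarrow> nat \<Rightarrow> ('o, 'm) endo \<Rightarrow> ('o, 'm) seq \<times> 'm \<Rightarrow> ('o, 'm) seq \<times> 'm
    \<Rightarrow> (nat \<Rightarrow> 'm) \<Rightarrow> ('o, 'm) seq \<times> 'm" where
  "sigma_cone C n S = (\<lambda>(X, \<delta>) (Y, \<rho>) f.
    let x = (\<lambda>i. if i \<le> n + 1 then ob X i else on_ob S (ob X 0));
        d = (\<lambda>i. if i \<le> n then df X i else \<delta>)
    in
    (\<lparr>ob = (\<lambda>i. bsum C (x (i + 1)) (ob Y i)),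
      df = (\<lambda>i. mat C (x (i + 1)) (ob Y i) (x (i + 2)) (ob Y (i + 1))
        (neg C (x (i + 1)) (x (i + 2)) (d (i + 1))) (zmor C (ob Y i) (x (i + 2)))
        (f (i + 1)) (df Y i))\<rparr>,
     sigma_sum_iso C S (ob X 1) (ob Y 0) \<cdot>\<^bsub>C\<^esub>
       mat C (on_ob S (ob X 0)) (ob Y (n + 1)) (on_ob S (ob X 1)) (on_ob S (ob Y 0))
         (neg C (on_ob S (ob X 0)) (on_ob S (ob X 1)) (on_mor S (df X 0)))
         (zmor C (ob Y (n + 1)) (on_ob S (ob X 1)))
         (on_mor S (f 0)) \<rho>))"

locale angulated_category = additive_category C
  for C :: "('o, 'm) cat" +
  fixes n :: nat
    and S :: "('o, 'm) endo"
    and \<Theta> :: "(('o, 'm) seq \<times> 'm) set"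
  assumes n_ge_1: "n \<ge> 1"
    and aut: "automorphism C S"
    and angle_seq: "T \<in> \<Theta> \<Longrightarrow> sigma_seq C n S T"
    and F1_iso: "\<lbrakk>T \<in> \<Theta>; sigma_seq C n S U; sigma_iso C n S T U\<rbrakk> \<Longrightarrow> U \<in> \<Theta>"
    and F1_sum: "\<lbrakk>T \<in> \<Theta>; U \<in> \<Theta>\<rbrakk> \<Longrightarrow> sigma_sum C n S T U \<in> \<Theta>"
    and F1_summand: "\<lbrakk>T \<in> \<Theta>; sigma_seq C n S U; sigma_summand C n S U T\<rbrakk> \<Longrightarrow> U \<in> \<Theta>"
    and F1_trivial:
      "\<lbrakk>sigma_seq C n S (X, \<delta>); ob X 1 = ob X 0; df X 0 = Id C (ob X 0);
        \<And>i. 2 \<le> i \<Longrightarrow> i \<le> n + 1 \<Longrightarrow> is_zero C (ob X i)\<rbrakk> \<Longrightarrow> (X, \<delta>) \<in> \<Theta>"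
    and F1_first:
      "\<lbrakk>A \<in> Ob C; B \<in> Ob C; f \<in> mor C A B\<rbrakk>
        \<Longrightarrow> \<exists>X \<delta>. (X, \<delta>) \<in> \<Theta> \<and> ob X 0 = A \<and> ob X 1 = B \<and> df X 0 = f"
    and F2: "sigma_seq C n S T \<Longrightarrow> T \<in> \<Theta> \<longleftrightarrow> rotation C n S T \<in> \<Theta>"
    and F3:
      "\<lbrakk>(X, \<delta>) \<in> \<Theta>; (Y, \<rho>) \<in> \<Theta>; f0 \<in> mor C (ob X 0) (ob Y 0); f1 \<in> mor C (ob X 1) (ob Y 1);
        f1 \<cdot>\<^bsub>C\<^esub> df X 0 = df Y 0 \<cdot>\<^bsub>C\<^esub> f0\<rbrakk>
        \<Longrightarrow> \<exists>f. sigma_map C n S (X, \<delta>) (Y, \<rho>) f \<and> f 0 = f0 \<and> f 1 = f1"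
    and F4:
      "\<lbrakk>(X, \<delta>) \<in> \<Theta>; (Y, \<rho>) \<in> \<Theta>; f0 \<in> mor C (ob X 0) (ob Y 0); f1 \<in> mor C (ob X 1) (ob Y 1);
        f1 \<cdot>\<^bsub>C\<^esub> df X 0 = df Y 0 \<cdot>\<^bsub>C\<^esub> f0\<rbrakk>
        \<Longrightarrow> \<exists>f. sigma_map C n S (X, \<delta>) (Y, \<rho>) f \<and> f 0 = f0 \<and> f 1 = f1 \<and>
              sigma_cone C n S (X, \<delta>) (Y, \<rho>) f \<in> \<Theta>"


section \<open>\<open>n\<close>-exangulated categories\<close>

text \<open>
  \<open>Ext E D A\<close> is the group \<open>E(D, A)\<close>, contravariant in \<open>D\<close>.  For \<open>a : A \<rightarrow> A'\<close>, the map
  \<open>push E D a : E(D, A) \<rightarrow> E(D, A')\<close> is \<open>a\<^sub>*\<close>; for \<open>c : D' \<rightarrow> D\<close>, the map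
  \<open>pull E A c : E(D, A) \<rightarrow> E(D', A)\<close> is \<open>c\<^sup>*\<close>.
\<close>

record ('o, 'm, 'e) bifunctor =
  Ext :: "'o \<Rightarrow> 'o \<Rightarrow> 'e monoid"
  push :: "'o \<Rightarrow> 'm \<Rightarrow> 'e \<Rightarrow> 'e"
  pull :: "'o \<Rightarrow> 'm \<Rightarrow> 'e \<Rightarrow> 'e"

definition additive_bifunctor :: "('o, 'm) cat \<Rightarrow> ('o, 'm, 'e) bifunctor \<Rightarrow> bool" where
  "additive_bifunctor C E \<longleftrightarrow>
    (\<forall>D\<in>Ob C. \<forall>A\<in>Ob C. comm_group (Ext E D A)) \<and>
    (\<forall>D\<in>Ob C. \<forall>A\<in>Ob C. \<forall>A'\<in>Ob C. \<forall>a\<in>mor C A A'.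
      push E D a \<in> hom (Ext E D A) (Ext E D A')) \<and>
    (\<forall>A\<in>Ob C. \<forall>D\<in>Ob C. \<forall>D'\<in>Ob C. \<forall>c\<in>mor C D' D.
      pull E A c \<in> hom (Ext E D A) (Ext E D' A)) \<and>
    (\<forall>D\<in>Ob C. \<forall>A\<in>Ob C. \<forall>\<delta>\<in>carrier (Ext E D A).
      push E D (Id C A) \<delta> = \<delta> \<and> pull E A (Id C D) \<delta> = \<delta>) \<and>
    (\<forall>D\<in>Ob C. \<forall>A\<in>Ob C. \<forall>A'\<in>Ob C. \<forall>A''\<in>Ob C. \<forall>a\<in>mor C A A'. \<forall>a'\<in>mor C A' A''.
      \<forall>\<delta>\<in>carrier (Ext E D A). push E D (a' \<cdot>\<^bsub>C\<^esub> a) \<delta> = push E D a' (push E D a \<delta>)) \<and>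
    (\<forall>A\<in>Ob C. \<forall>D\<in>Ob C. \<forall>D'\<in>Ob C. \<forall>D''\<in>Ob C. \<forall>c\<in>mor C D' D. \<forall>c'\<in>mor C D'' D'.
      \<forall>\<delta>\<in>carrier (Ext E D A). pull E A (c \<cdot>\<^bsub>C\<^esub> c') \<delta> = pull E A c' (pull E A c \<delta>)) \<and>
    (\<forall>D\<in>Ob C. \<forall>D'\<in>Ob C. \<forall>A\<in>Ob C. \<forall>A'\<in>Ob C. \<forall>a\<in>mor C A A'. \<forall>c\<in>mor C D' D.
      \<forall>\<delta>\<in>carrier (Ext E D A). push E D' a (pull E A c \<delta>) = pull E A' c (push E D a \<delta>)) \<and>
    (\<forall>D\<in>Ob C. \<forall>A\<in>Ob C. \<forall>A'\<in>Ob C. \<forall>a\<in>mor C A A'. \<forall>a'\<in>mor C A A'. \<forall>\<delta>\<in>carrier (Ext E D A).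
      push E D (a \<otimes>\<^bsub>Hom C A A'\<^esub> a') \<delta> = push E D a \<delta> \<otimes>\<^bsub>Ext E D A'\<^esub> push E D a' \<delta>) \<and>
    (\<forall>A\<in>Ob C. \<forall>D\<in>Ob C. \<forall>D'\<in>Ob C. \<forall>c\<in>mor C D' D. \<forall>c'\<in>mor C D' D. \<forall>\<delta>\<in>carrier (Ext E D A).
      pull E A (c \<otimes>\<^bsub>Hom C D' D\<^esub> c') \<delta> = pull E A c \<delta> \<otimes>\<^bsub>Ext E D' A\<^esub> pull E A c' \<delta>)"

definition exangle ::
  "('o, 'm) cat \<Rightarrow> nat \<Rightarrow> ('o, 'm, 'e) bifunctor \<Rightarrow> ('o, 'm) seq \<times> 'e \<Rightarrow> bool" where
  "exangle C n E = (\<lambda>(X, \<delta>).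
    cplx C (n + 1) X \<and> \<delta> \<in> carrier (Ext E (ob X (n + 1)) (ob X 0)) \<and>
    (\<forall>W\<in>Ob C.
      (\<forall>i. 1 \<le> i \<and> i \<le> n \<longrightarrow>
        (\<forall>g\<in>mor C W (ob X i). df X i \<cdot>\<^bsub>C\<^esub> g = zmor C W (ob X (i + 1)) \<longleftrightarrow>
          (\<exists>h\<in>mor C W (ob X (i - 1)). g = df X (i - 1) \<cdot>\<^bsub>C\<^esub> h))) \<and>
      (\<forall>g\<in>mor C W (ob X (n + 1)). pull E (ob X 0) g \<delta> = \<one>\<^bsub>Ext E W (ob X 0)\<^esub> \<longleftrightarrow>
        (\<exists>h\<in>mor C W (ob X n). g = df X n \<cdot>\<^bsub>C\<^esub> h)) \<and>
      (\<forall>i. 1 \<le> i \<and> i \<le> n \<longrightarrow>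
        (\<forall>g\<in>mor C (ob X i) W. g \<cdot>\<^bsub>C\<^esub> df X (i - 1) = zmor C (ob X (i - 1)) W \<longleftrightarrow>
          (\<exists>h\<in>mor C (ob X (i + 1)) W. g = h \<cdot>\<^bsub>C\<^esub> df X i))) \<and>
      (\<forall>g\<in>mor C (ob X 0) W.
        push E (ob X (n + 1)) g \<delta> = \<one>\<^bsub>Ext E (ob X (n + 1)) W\<^esub> \<longleftrightarrow>
        (\<exists>h\<in>mor C (ob X 1) W. g = h \<cdot>\<^bsub>C\<^esub> df X 0))))"

definition exangle_map ::
  "('o, 'm) cat \<Rightarrow> nat \<Rightarrow> ('o, 'm, 'e) bifunctor \<Rightarrow> ('o, 'm) seq \<times> 'e \<Rightarrow> ('o, 'm) seq \<times> 'e
    \<Rightarrow> (nat \<Rightarrow> 'm) \<Rightarrow> bool" where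
  "exangle_map C n E = (\<lambda>(X, \<delta>) (Y, \<rho>) f.
    chain_map C (n + 1) X Y f \<and>
    push E (ob X (n + 1)) (f 0) \<delta> = pull E (ob Y 0) (f (n + 1)) \<rho>)"

type_synonym ('o, 'm, 'e) realization = "'o \<Rightarrow> 'o \<Rightarrow> 'e \<Rightarrow> ('o, 'm) seq set"

text \<open>\<open>s D A \<delta>\<close> is \<open>\<s>(\<delta>)\<close> for \<open>\<delta> \<in> E(D, A)\<close>.\<close>

definition distinguished ::
  "('o, 'm) cat \<Rightarrow> nat \<Rightarrow> ('o, 'm, 'e) bifunctor \<Rightarrow> ('o, 'm, 'e) realization
    \<Rightarrow> ('o, 'm) seq \<times> 'e \<Rightarrow> bool" where
  "distinguished C n E s = (\<lambda>(X, \<delta>).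
    cplx C (n + 1) X \<and> \<delta> \<in> carrier (Ext E (ob X (n + 1)) (ob X 0)) \<and>
    s (ob X (n + 1)) (ob X 0) \<delta> = hclass C (n + 1) X)"

definition inflation ::
  "('o, 'm) cat \<Rightarrow> nat \<Rightarrow> ('o, 'm, 'e) bifunctor \<Rightarrow> ('o, 'm, 'e) realization \<Rightarrow> 'm \<Rightarrow> bool" where
  "inflation C n E s f \<longleftrightarrow> (\<exists>X \<delta>. distinguished C n E s (X, \<delta>) \<and> f = df X 0)"

definition deflation ::
  "('o, 'm) cat \<Rightarrow> nat \<Rightarrow> ('o, 'm, 'e) bifunctor \<Rightarrow> ('o, 'm, 'e) realization \<Rightarrow> 'm \<Rightarrow> bool" where
  "deflation C n E s f \<longleftrightarrow> (\<exists>X \<delta>. distinguished C n E s (X, \<delta>) \<and> f = df X n)"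

locale n_exangulated_category = additive_category C
  for C :: "('o, 'm) cat" +
  fixes n :: nat
    and E :: "('o, 'm, 'e) bifunctor"
    and s :: "('o, 'm, 'e) realization"
  assumes n_ge_1: "n \<ge> 1"
    and bifun: "additive_bifunctor C E"
    and realized:
      "\<lbrakk>A \<in> Ob C; D \<in> Ob C; \<delta> \<in> carrier (Ext E D A)\<rbrakk>
        \<Longrightarrow> \<exists>X. cplx C (n + 1) X \<and> ob X 0 = A \<and> ob X (n + 1) = D \<and> s D A \<delta> = hclass C (n + 1) X"
    and R0:
      "\<lbrakk>distinguished C n E s (X, \<delta>); distinguished C n E s (Y, \<rho>);
        a \<in> mor C (ob X 0) (ob Y 0); c \<in> mor C (ob X (n + 1)) (ob Y (n + 1));
        push E (ob X (n + 1)) a \<delta> = pull E (ob Y 0) c \<rho>\<rbrakk>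
        \<Longrightarrow> \<exists>f. chain_map C (n + 1) X Y f \<and> f 0 = a \<and> f (n + 1) = c"
    and R1: "distinguished C n E s (X, \<delta>) \<Longrightarrow> exangle C n E (X, \<delta>)"
    and R2_left:
      "\<lbrakk>cplx C (n + 1) X; ob X 1 = ob X 0; df X 0 = Id C (ob X 0);
        \<And>i. 2 \<le> i \<Longrightarrow> i \<le> n + 1 \<Longrightarrow> is_zero C (ob X i)\<rbrakk>
        \<Longrightarrow> distinguished C n E s (X, \<one>\<^bsub>Ext E (ob X (n + 1)) (ob X 0)\<^esub>)"
    and R2_right:
      "\<lbrakk>cplx C (n + 1) X; ob X (n + 1) = ob X n; df X n = Id C (ob X n);
        \<And>i. i < n \<Longrightarrow> is_zero C (ob X i)\<rbrakk>
        \<Longrightarrow> distinguished C n E s (X, \<one>\<^bsub>Ext E (ob X (n + 1)) (ob X 0)\<^esub>)"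
    and EA1_inflation:
      "\<lbrakk>A \<in> Ob C; B \<in> Ob C; D \<in> Ob C; f \<in> mor C A B; g \<in> mor C B D;
        inflation C n E s f; inflation C n E s g\<rbrakk> \<Longrightarrow> inflation C n E s (g \<cdot>\<^bsub>C\<^esub> f)"
    and EA1_deflation:
      "\<lbrakk>A \<in> Ob C; B \<in> Ob C; D \<in> Ob C; f \<in> mor C A B; g \<in> mor C B D;
        deflation C n E s f; deflation C n E s g\<rbrakk> \<Longrightarrow> deflation C n E s (g \<cdot>\<^bsub>C\<^esub> f)"
    and EA2:
      "\<lbrakk>distinguished C n E s (Y, \<rho>); B \<in> Ob C; c \<in> mor C B (ob Y (n + 1));
        distinguished C n E s (X, pull E (ob Y 0) c \<rho>); ob X 0 = ob Y 0; ob X (n + 1) = B\<rbrakk>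
        \<Longrightarrow> \<exists>f. chain_map C (n + 1) X Y f \<and> f 0 = Id C (ob X 0) \<and> f (n + 1) = c \<and>
              distinguished C n E s
                (mcone C n (tail_seq X) (tail_seq Y) (\<lambda>i. f (i + 1)),
                 push E (ob Y (n + 1)) (df X 0) \<rho>)"
    and EA2_op:
      "\<lbrakk>distinguished C n E s (X, \<delta>); B \<in> Ob C; a \<in> mor C (ob X 0) B;
        distinguished C n E s (Y, push E (ob X (n + 1)) a \<delta>); ob Y 0 = B;
        ob Y (n + 1) = ob X (n + 1)\<rbrakk>
        \<Longrightarrow> \<exists>f. chain_map C (n + 1) X Y f \<and> f 0 = a \<and> f (n + 1) = Id C (ob X (n + 1)) \<and>
              distinguished C n E s (mcocone C n X Y f, pull E (ob X 0) (df Y n) \<delta>)"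

text \<open>
  Being of a certain form up to natural isomorphism of the bifunctor, with the realization
  transported along the isomorphism.
\<close>

definition exangulated_iso ::
  "('o, 'm) cat \<Rightarrow> ('o, 'm, 'e) bifunctor \<Rightarrow> ('o, 'm, 'e) realization
    \<Rightarrow> ('o, 'm, 'f) bifunctor \<Rightarrow> ('o, 'm, 'f) realization \<Rightarrow> bool" where
  "exangulated_iso C E s F t \<longleftrightarrow>
    (\<exists>\<phi>. (\<forall>D\<in>Ob C. \<forall>A\<in>Ob C. \<phi> D A \<in> iso (Ext E D A) (Ext F D A)) \<and>
      (\<forall>D\<in>Ob C. \<forall>A\<in>Ob C. \<forall>A'\<in>Ob C. \<forall>a\<in>mor C A A'. \<forall>\<delta>\<in>carrier (Ext E D A).
        \<phi> D A' (push E D a \<delta>) = push F D a (\<phi> D A \<delta>)) \<and>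
      (\<forall>A\<in>Ob C. \<forall>D\<in>Ob C. \<forall>D'\<in>Ob C. \<forall>c\<in>mor C D' D. \<forall>\<delta>\<in>carrier (Ext E D A).
        \<phi> D' A (pull E A c \<delta>) = pull F A c (\<phi> D A \<delta>)) \<and>
      (\<forall>D\<in>Ob C. \<forall>A\<in>Ob C. \<forall>\<delta>\<in>carrier (Ext E D A). t D A (\<phi> D A \<delta>) = s D A \<delta>))"


section \<open>The \<open>n\<close>-exangulated structure of an \<open>(n+2)\<close>-angulated category\<close>

definition angulated_bifunctor ::
  "('o, 'm) cat \<Rightarrow> ('o, 'm) endo \<Rightarrow> ('o, 'm, 'm) bifunctor" where
  "angulated_bifunctor C S =
    \<lparr>Ext = (\<lambda>D A. Hom C D (on_ob S A)),
     push = (\<lambda>D a \<delta>. on_mor S a \<cdot>\<^bsub>C\<^esub> \<delta>),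
     pull = (\<lambda>A c \<delta>. \<delta> \<cdot>\<^bsub>C\<^esub> c)\<rparr>"

text \<open>Any two \<open>(n+2)\<close>-angles with the same last morphism and end terms have the same class.\<close>

definition angulated_realization ::
  "('o, 'm) cat \<Rightarrow> nat \<Rightarrow> (('o, 'm) seq \<times> 'm) set \<Rightarrow> ('o, 'm, 'm) realization" where
  "angulated_realization C n \<Theta> = (\<lambda>D A \<delta>.
    hclass C (n + 1) (SOME X. (X, \<delta>) \<in> \<Theta> \<and> ob X 0 = A \<and> ob X (n + 1) = D))"

definition is_angulated ::
  "('o, 'm) cat \<Rightarrow> nat \<Rightarrow> ('o, 'm, 'e) bifunctor \<Rightarrow> ('o, 'm, 'e) realization \<Rightarrow> bool" where
  "is_angulated C n E s \<longleftrightarrow>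
    (\<exists>S \<Theta>. angulated_category C n S \<Theta> \<and>
      exangulated_iso C E s (angulated_bifunctor C S) (angulated_realization C n \<Theta>))"


section \<open>\<open>n\<close>-exact categories\<close>

definition n_exact_seq :: "('o, 'm) cat \<Rightarrow> nat \<Rightarrow> ('o, 'm) seq \<Rightarrow> bool" where
  "n_exact_seq C n X \<longleftrightarrow> cplx C (n + 1) X \<and> left_exact C n X \<and> right_exact C n X"

definition jasso_weak_iso ::
  "('o, 'm) cat \<Rightarrow> nat \<Rightarrow> ('o, 'm) seq \<Rightarrow> ('o, 'm) seq \<Rightarrow> (nat \<Rightarrow> 'm) \<Rightarrow> bool" where
  "jasso_weak_iso C n X Y f \<longleftrightarrow> chain_map C (n + 1) X Y f \<and>
    ((\<exists>i\<le>n. is_iso C (ob X i) (ob Y i) (f i) \<and>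
        is_iso C (ob X (i + 1)) (ob Y (i + 1)) (f (i + 1))) \<or>
     (is_iso C (ob X (n + 1)) (ob Y (n + 1)) (f (n + 1)) \<and> is_iso C (ob X 0) (ob Y 0) (f 0)))"

text \<open>
  Here \<open>X\<close> and \<open>Y\<close> have degrees \<open>0, \<dots>, n\<close>.  For pullback diagrams they stand for the degrees
  \<open>1, \<dots>, n + 1\<close>.
\<close>

definition n_pushout ::
  "('o, 'm) cat \<Rightarrow> nat \<Rightarrow> ('o, 'm) seq \<Rightarrow> ('o, 'm) seq \<Rightarrow> (nat \<Rightarrow> 'm) \<Rightarrow> bool" where
  "n_pushout C n X Y f \<longleftrightarrow> chain_map C n X Y f \<and> right_exact C n (mcone C n X Y f)"

definition n_pullback ::
  "('o, 'm) cat \<Rightarrow> nat \<Rightarrow> ('o, 'm) seq \<Rightarrow> ('o, 'm) seq \<Rightarrow> (nat \<Rightarrow> 'm) \<Rightarrow> bool" where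
  "n_pullback C n X Y f \<longleftrightarrow> chain_map C n X Y f \<and> left_exact C n (mcone C n X Y f)"

definition n_exact_structure ::
  "('o, 'm) cat \<Rightarrow> nat \<Rightarrow> ('o, 'm) seq set \<Rightarrow> bool" where
  "n_exact_structure C n \<E> \<longleftrightarrow>
    (\<forall>X\<in>\<E>. n_exact_seq C n X) \<and>
    (\<forall>X Y f. n_exact_seq C n X \<and> n_exact_seq C n Y \<and> jasso_weak_iso C n X Y f
      \<longrightarrow> (X \<in> \<E> \<longleftrightarrow> Y \<in> \<E>)) \<and>
    (\<forall>X. cplx C (n + 1) X \<and> (\<forall>i\<le>n + 1. is_zero C (ob X i)) \<longrightarrow> X \<in> \<E>) \<and>
    (\<forall>X\<in>\<E>. \<forall>Y\<in>\<E>. ob Y 0 = ob X 1 \<longrightarrow> (\<exists>Z\<in>\<E>. df Z 0 = df Y 0 \<cdot>\<^bsub>C\<^esub> df X 0)) \<and>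
    (\<forall>X\<in>\<E>. \<forall>Y\<in>\<E>. ob Y n = ob X (n + 1) \<longrightarrow> (\<exists>Z\<in>\<E>. df Z n = df Y n \<cdot>\<^bsub>C\<^esub> df X n)) \<and>
    (\<forall>X\<in>\<E>. \<forall>B\<in>Ob C. \<forall>a\<in>mor C (ob X 0) B.
      \<exists>Y p. cplx C n Y \<and> ob Y 0 = B \<and> p 0 = a \<and> n_pushout C n X Y p \<and>
        (\<exists>Z\<in>\<E>. df Z 0 = df Y 0)) \<and>
    (\<forall>X\<in>\<E>. \<forall>B\<in>Ob C. \<forall>c\<in>mor C B (ob X (n + 1)).
      \<exists>Y p. cplx C n Y \<and> ob Y n = B \<and> p n = c \<and> n_pullback C n Y (tail_seq X) p \<and>
        (\<exists>Z\<in>\<E>. df Z n = df Y (n - 1)))"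

text \<open>
  The bifunctor of an \<open>n\<close>-exact category: \<open>a\<^sub>*[X]\<close> and \<open>c\<^sup>*[X]\<close> are the classes obtained by
  \<open>n\<close>-pushout and \<open>n\<close>-pullback, addition is the Baer sum, and zero is the class of the sequences
  with split first morphism.  All these classes are independent of representatives.
\<close>

definition nex_push ::
  "('o, 'm) cat \<Rightarrow> nat \<Rightarrow> ('o, 'm) seq set \<Rightarrow> 'm \<Rightarrow> ('o, 'm) seq set \<Rightarrow> ('o, 'm) seq set" where
  "nex_push C n \<E> a K = (THE L. \<exists>X\<in>\<E> \<inter> K. \<exists>Y\<in>\<E>. \<exists>f.
    chain_map C (n + 1) X Y f \<and> f 0 = a \<and> f (n + 1) = Id C (ob X (n + 1)) \<and>
    n_pushout C n X Y f \<and> L = hclass C (n + 1) Y)"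

definition nex_pull ::
  "('o, 'm) cat \<Rightarrow> nat \<Rightarrow> ('o, 'm) seq set \<Rightarrow> 'm \<Rightarrow> ('o, 'm) seq set \<Rightarrow> ('o, 'm) seq set" where
  "nex_pull C n \<E> c K = (THE L. \<exists>X\<in>\<E> \<inter> K. \<exists>Y\<in>\<E>. \<exists>f.
    chain_map C (n + 1) Y X f \<and> f 0 = Id C (ob X 0) \<and> f (n + 1) = c \<and>
    n_pullback C n (tail_seq Y) (tail_seq X) (\<lambda>i. f (i + 1)) \<and> L = hclass C (n + 1) Y)"

definition nex_sum ::
  "('o, 'm) cat \<Rightarrow> nat \<Rightarrow> ('o, 'm) seq set
    \<Rightarrow> ('o, 'm) seq set \<Rightarrow> ('o, 'm) seq set \<Rightarrow> ('o, 'm) seq set" where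
  "nex_sum C n \<E> K L =
    (THE M. \<exists>X\<in>\<E> \<inter> K. \<exists>Y\<in>\<E> \<inter> L. M = hclass C (n + 1) (seq_sum C X Y))"

definition n_exact_bifunctor ::
  "('o, 'm) cat \<Rightarrow> nat \<Rightarrow> ('o, 'm) seq set \<Rightarrow> ('o, 'm, ('o, 'm) seq set) bifunctor" where
  "n_exact_bifunctor C n \<E> =
    \<lparr>Ext = (\<lambda>D A.
       \<lparr>carrier = {hclass C (n + 1) X |X. X \<in> \<E> \<and> ob X 0 = A \<and> ob X (n + 1) = D},
        mult = (\<lambda>K L. nex_push C n \<E> (mrow C A A A (Id C A) (Id C A))
          (nex_pull C n \<E> (mcol C D D D (Id C D) (Id C D)) (nex_sum C n \<E> K L))),
        one = (THE L. \<exists>X\<in>\<E>. ob X 0 = A \<and> ob X (n + 1) = D \<and>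
          (\<exists>r\<in>mor C (ob X 1) A. r \<cdot>\<^bsub>C\<^esub> df X 0 = Id C A) \<and> L = hclass C (n + 1) X)\<rparr>),
     push = (\<lambda>D. nex_push C n \<E>),
     pull = (\<lambda>A. nex_pull C n \<E>)\<rparr>"

definition is_n_exact ::
  "('o, 'm) cat \<Rightarrow> nat \<Rightarrow> ('o, 'm, 'e) bifunctor \<Rightarrow> ('o, 'm, 'e) realization \<Rightarrow> bool" where
  "is_n_exact C n E s \<longleftrightarrow>
    (\<exists>\<E>. n_exact_structure C n \<E> \<and>
      exangulated_iso C E s (n_exact_bifunctor C n \<E>) (\<lambda>D A K. K))"


section \<open>\<open>n\<close>-proper classes\<close>

definition exangle_weak_iso ::
  "('o, 'm) cat \<Rightarrow> nat \<Rightarrow> ('o, 'm, 'e) bifunctor \<Rightarrow> ('o, 'm) seq \<times> 'e \<Rightarrow> ('o, 'm) seq \<times> 'e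
    \<Rightarrow> (nat \<Rightarrow> 'm) \<Rightarrow> bool" where
  "exangle_weak_iso C n E = (\<lambda>(X, \<delta>) (Y, \<rho>) f.
    exangle_map C n E (X, \<delta>) (Y, \<rho>) f \<and>
    is_iso C (ob X 0) (ob Y 0) (f 0) \<and>
    is_iso C (ob X (n + 1)) (ob Y (n + 1)) (f (n + 1)))"

text \<open>The coproduct of \<open>\<langle>X, \<delta>\<rangle>\<close> and \<open>\<langle>Y, \<rho>\<rangle>\<close>, with extension \<open>i\<^sub>* p\<^sup>* \<delta> + j\<^sub>* q\<^sup>* \<rho>\<close>.\<close>

definition exangle_sum ::
  "('o, 'm) cat \<Rightarrow> nat \<Rightarrow> ('o, 'm, 'e) bifunctor \<Rightarrow> ('o, 'm) seq \<times> 'e \<Rightarrow> ('o, 'm) seq \<times> 'e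
    \<Rightarrow> ('o, 'm) seq \<times> 'e" where
  "exangle_sum C n E = (\<lambda>(X, \<delta>) (Y, \<rho>).
    let A = ob X 0; B = ob Y 0; D = ob X (n + 1); K = ob Y (n + 1) in
    (seq_sum C X Y,
     push E (bsum C D K) (in1 C A B) (pull E A (pr1 C D K) \<delta>)
       \<otimes>\<^bsub>Ext E (bsum C D K) (bsum C A B)\<^esub>
     push E (bsum C D K) (in2 C A B) (pull E B (pr2 C D K) \<rho>)))"

text \<open>The empty coproduct is a split distinguished \<open>n\<close>-exangle, so binary coproducts suffice.\<close>

definition n_proper_class ::
  "('o, 'm) cat \<Rightarrow> nat \<Rightarrow> ('o, 'm, 'e) bifunctor \<Rightarrow> ('o, 'm, 'e) realization
    \<Rightarrow> (('o, 'm) seq \<times> 'e) set \<Rightarrow> bool" where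
  "n_proper_class C n E s \<xi> \<longleftrightarrow>
    (\<forall>T\<in>\<xi>. distinguished C n E s T) \<and>
    (\<forall>X. distinguished C n E s (X, \<one>\<^bsub>Ext E (ob X (n + 1)) (ob X 0)\<^esub>)
      \<longrightarrow> (X, \<one>\<^bsub>Ext E (ob X (n + 1)) (ob X 0)\<^esub>) \<in> \<xi>) \<and>
    (\<forall>T U f. distinguished C n E s T \<and> distinguished C n E s U \<and> exangle_weak_iso C n E T U f
      \<longrightarrow> (T \<in> \<xi> \<longleftrightarrow> U \<in> \<xi>)) \<and>
    (\<forall>T\<in>\<xi>. \<forall>U\<in>\<xi>. exangle_sum C n E T U \<in> \<xi>) \<and>
    (\<forall>X \<delta> B c Y. (X, \<delta>) \<in> \<xi> \<and> B \<in> Ob C \<and> c \<in> mor C B (ob X (n + 1)) \<and>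
      ob Y 0 = ob X 0 \<and> ob Y (n + 1) = B \<and> distinguished C n E s (Y, pull E (ob X 0) c \<delta>)
      \<longrightarrow> (Y, pull E (ob X 0) c \<delta>) \<in> \<xi>) \<and>
    (\<forall>X \<delta> B a Y. (X, \<delta>) \<in> \<xi> \<and> B \<in> Ob C \<and> a \<in> mor C (ob X 0) B \<and>
      ob Y 0 = B \<and> ob Y (n + 1) = ob X (n + 1) \<and>
      distinguished C n E s (Y, push E (ob X (n + 1)) a \<delta>)
      \<longrightarrow> (Y, push E (ob X (n + 1)) a \<delta>) \<in> \<xi>) \<and>
    (\<forall>A\<in>Ob C. \<forall>B\<in>Ob C. \<forall>D\<in>Ob C. \<forall>K\<in>Ob C.
      \<forall>a\<in>mor C A B. \<forall>b\<in>mor C B D. \<forall>c\<in>mor C A K. \<forall>d\<in>mor C K D.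
        b \<cdot>\<^bsub>C\<^esub> a = d \<cdot>\<^bsub>C\<^esub> c \<and>
        deflation C n E s a \<and> deflation C n E s b \<and> deflation C n E s d \<and>
        (\<exists>(X, \<delta>)\<in>\<xi>. a = df X n) \<and> (\<exists>(X, \<delta>)\<in>\<xi>. b = df X n)
        \<longrightarrow> (\<exists>(X, \<delta>)\<in>\<xi>. d = df X n))"

definition sub_bifunctor ::
  "nat \<Rightarrow> ('o, 'm, 'e) bifunctor \<Rightarrow> ('o, 'm, 'e) realization \<Rightarrow> ('o, 'm) cat
    \<Rightarrow> (('o, 'm) seq \<times> 'e) set \<Rightarrow> ('o, 'm, 'e) bifunctor" where
  "sub_bifunctor n E s C \<xi> = E\<lparr>Ext := (\<lambda>D A. (Ext E D A)
    \<lparr>carrier := {\<delta> \<in> carrier (Ext E D A).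
      \<exists>X. distinguished C n E s (X, \<delta>) \<and> (X, \<delta>) \<in> \<xi> \<and> ob X 0 = A \<and> ob X (n + 1) = D}\<rparr>)\<rparr>"

definition sub_realization ::
  "nat \<Rightarrow> ('o, 'm, 'e) bifunctor \<Rightarrow> ('o, 'm, 'e) realization \<Rightarrow> ('o, 'm) cat
    \<Rightarrow> (('o, 'm) seq \<times> 'e) set \<Rightarrow> ('o, 'm, 'e) realization" where
  "sub_realization n E s C \<xi> =
    (\<lambda>D A. restrict (s D A) (carrier (Ext (sub_bifunctor n E s C \<xi>) D A)))"


section \<open>Subcategories\<close>

text \<open>A full subcategory is given by its set of objects.\<close>

definition hom_epi :: "('o, 'm) cat \<Rightarrow> 'o set \<Rightarrow> 'o \<Rightarrow> 'o \<Rightarrow> 'm \<Rightarrow> bool" where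
  "hom_epi C H A B f \<longleftrightarrow>
    (\<forall>K\<in>H. (\<lambda>g. g \<cdot>\<^bsub>C\<^esub> f) ` mor C B K = mor C A K)"

definition left_approximation :: "('o, 'm) cat \<Rightarrow> 'o set \<Rightarrow> 'o \<Rightarrow> 'o \<Rightarrow> 'm \<Rightarrow> bool" where
  "left_approximation C H A B f \<longleftrightarrow> f \<in> mor C A B \<and> B \<in> H \<and> hom_epi C H A B f"

definition strongly_covariantly_finite ::
  "('o, 'm) cat \<Rightarrow> nat \<Rightarrow> (('o, 'm) seq \<times> 'm) set \<Rightarrow> 'o set \<Rightarrow> bool" where
  "strongly_covariantly_finite C n \<Theta> H \<longleftrightarrow>
    (\<forall>B\<in>Ob C. \<exists>(X, \<delta>)\<in>\<Theta>. ob X 0 = B \<and> left_approximation C H B (ob X 1) (df X 0) \<and>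
      (\<forall>i. 1 \<le> i \<and> i \<le> n \<longrightarrow> ob X i \<in> H))"

definition closed_under_summands :: "('o, 'm) cat \<Rightarrow> 'o set \<Rightarrow> bool" where
  "closed_under_summands C H \<longleftrightarrow>
    (\<forall>A\<in>Ob C. \<forall>B\<in>H. (\<exists>i\<in>mor C A B. \<exists>p\<in>mor C B A. p \<cdot>\<^bsub>C\<^esub> i = Id C A) \<longrightarrow> A \<in> H)"

definition hom_epi_class ::
  "('o, 'm) cat \<Rightarrow> (('o, 'm) seq \<times> 'm) set \<Rightarrow> 'o set \<Rightarrow> (('o, 'm) seq \<times> 'm) set" where
  "hom_epi_class C \<Theta> H = {(X, \<delta>) \<in> \<Theta>. hom_epi C H (ob X 0) (ob X 1) (df X 0)}"

definition split_angles ::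
  "('o, 'm) cat \<Rightarrow> nat \<Rightarrow> ('o, 'm) endo \<Rightarrow> (('o, 'm) seq \<times> 'm) set
    \<Rightarrow> (('o, 'm) seq \<times> 'm) set" where
  "split_angles C n S \<Theta> = {(X, \<delta>) \<in> \<Theta>. \<delta> = zmor C (ob X (n + 1)) (on_ob S (ob X 0))}"

end

theory Submission
  imports Defs
begin

text \<open>
  Everything rests on a description of \<open>\<xi>\<close> in terms of extensions.  By exactness of angles, a
  morphism \<open>g : X\<^sup>0 \<rightarrow> K\<close> factors through \<open>d\<^sup>0\<close> if and only if \<open>\<Sigma>g \<delta> = 0\<close>.  Hence an angle belongs to
  \<open>\<xi>\<close> precisely when its last morphism \<open>\<delta>\<close> is a ghost, meaning that \<open>\<Sigma>g \<delta> = 0\<close> for all \<open>g\<close> into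
  objects of \<open>H\<close> (\<open>hom_epi_ghost\<close>).  Ghosts form an additive subfunctor of \<open>C(-, \<Sigma>-)\<close>, which gives the
  closure properties of a proper class at once.  Saturation, and with it the composition of
  deflations, holds because relative deflations can be cancelled in front of morphisms into
  \<open>\<Sigma>H\<close> (\<open>ghost_descends\<close>).  Relative inflations compose because they are the morphisms on which
  \<open>C(-, H)\<close> is surjective.

  What remains for the first part is that angles form an \<open>n\<close>-exangulated category and that its
  axioms restrict to ghosts.  Two points need an argument.  The first is that the distinguished
  \<open>n\<close>-exangles are exactly the angles (\<open>distinguished_iff\<close>).  Two angles with the same \<open>\<delta>\<close> are
  homotopy equivalent relative to their ends: lifts \<open>f\<close> and \<open>g\<close> of the identities give
  \<open>gf = 1 - \<phi>\<close> with \<open>\<phi>\<close> zero at both ends, \<open>\<phi>\<^sup>2\<close> is null-homotopic, and so \<open>(1 + \<phi>)g\<close> is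
  inverse to \<open>f\<close> up to homotopy.  Conversely, a complex homotopy equivalent to an angle is a direct
  summand of the sum of that angle with contractible ones.

  The second point is (EA2) and its dual (\<open>cone_angle\<close>, \<open>cocone_angle\<close>).  Rotating until the
  prescribed end components come first, (F4) provides a lift whose full mapping cone is an
  angle, and the smaller cones of the axioms are retracts of it.  The signs are
  controlled by two observations: up to isomorphism the \<open>(n+1)\<close>-fold rotation
  carries no signs, and the \<open>(n+2)\<close>-fold rotation negates every map.

  In an \<open>n\<close>-exact category inflations are monomorphisms, which forces \<open>\<delta> = 0\<close> because
  \<open>\<Sigma>d\<^sup>0 \<delta> = 0\<close>; in an angulated category every morphism is an inflation, which forces all angles
  into \<open>\<xi>\<close>.  If \<open>H\<close> is strongly covariantly finite and closed under summands, the first alternative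
  makes every object a summand of one in \<open>H\<close>, and the second makes every object of \<open>H\<close> zero.
\<close>

section \<open>Additive categories as partial algebras\<close>

context additive_category
begin

abbreviation cmp :: "'m \<Rightarrow> 'm \<Rightarrow> 'm" (infixr "\<bullet>" 75) where
  "g \<bullet> f \<equiv> g \<cdot>\<^bsub>C\<^esub> f"

text \<open>
  Hom-sets of distinct pairs of objects are disjoint, so a morphism determines its domain
  \<open>dm f\<close> and codomain \<open>cd f\<close>.  Written with these functions, the laws of the category become
  conditional rewrite rules whose left-hand sides contain no objects, and matrix identities can
  be settled by rewriting to sums of composites.
\<close>

definition arr :: "'m \<Rightarrow> bool" where
  "arr f \<longleftrightarrow> (\<exists>A\<in>Ob C. \<exists>B\<in>Ob C. f \<in> mor C A B)"

definition dm :: "'m \<Rightarrow> 'o" where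
  "dm f = (THE A. A \<in> Ob C \<and> (\<exists>B\<in>Ob C. f \<in> mor C A B))"

definition cd :: "'m \<Rightarrow> 'o" where
  "cd f = (THE B. B \<in> Ob C \<and> (\<exists>A\<in>Ob C. f \<in> mor C A B))"

definition pls :: "'m \<Rightarrow> 'm \<Rightarrow> 'm" (infixl "\<oplus>" 65) where
  "f \<oplus> g = f \<otimes>\<^bsub>Hom C (dm f) (cd f)\<^esub> g"

definition ng :: "'m \<Rightarrow> 'm" where
  "ng f = inv\<^bsub>Hom C (dm f) (cd f)\<^esub> f"

lemma morD:
  assumes "f \<in> mor C A B" "A \<in> Ob C" "B \<in> Ob C"
  shows "arr f" "dm f = A" "cd f = B"
proof -
  show "arr f" using assms by (auto simp: arr_def)
  show "dm f = A" unfolding dm_def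
    by (rule the_equality) (use assms hom_disjoint in blast)+
  show "cd f = B" unfolding cd_def
    by (rule the_equality) (use assms hom_disjoint in blast)+
qed

lemma mor_iff [simp]:
  assumes "A \<in> Ob C" "B \<in> Ob C"
  shows "f \<in> mor C A B \<longleftrightarrow> arr f \<and> dm f = A \<and> cd f = B"
  using assms morD by (metis arr_def)

lemma arrE [elim]:
  assumes "arr f"
  obtains "dm f \<in> Ob C" "cd f \<in> Ob C" "f \<in> mor C (dm f) (cd f)"
  using assms morD by (metis arr_def)

lemma dm_Ob [simp]: "arr f \<Longrightarrow> dm f \<in> Ob C"
  and cd_Ob [simp]: "arr f \<Longrightarrow> cd f \<in> Ob C"
  by (auto elim: arrE)

text \<open>
  Together with the matrix rules below, these two rules translate the indexed operations into
  the ones without objects.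
\<close>

lemma mult_pls: "\<lbrakk>arr f; dm f = A; cd f = B\<rbrakk> \<Longrightarrow> f \<otimes>\<^bsub>Hom C A B\<^esub> g = f \<oplus> g"
  by (simp add: pls_def)

lemma inv_ng: "\<lbrakk>arr f; dm f = A; cd f = B\<rbrakk> \<Longrightarrow> inv\<^bsub>Hom C A B\<^esub> f = ng f"
  by (simp add: ng_def)

lemma zmor_typ [simp]:
  assumes "A \<in> Ob C" "B \<in> Ob C"
  shows "arr (zmor C A B)" "dm (zmor C A B) = A" "cd (zmor C A B) = B"
proof -
  interpret comm_group "Hom C A B" using assms by (rule hom_group)
  have "zmor C A B \<in> mor C A B" by simp
  then show "arr (zmor C A B)" "dm (zmor C A B) = A" "cd (zmor C A B) = B"
    using assms morD by blast+
qed

lemma Id_typ [simp]: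
  assumes "A \<in> Ob C"
  shows "arr (Id C A)" "dm (Id C A) = A" "cd (Id C A) = A"
  using id_mor[OF assms] assms morD by blast+

lemma comp_typ [simp]:
  assumes "arr f" "arr g" "cd f = dm g"
  shows "arr (g \<bullet> f)" "dm (g \<bullet> f) = dm f" "cd (g \<bullet> f) = cd g"
proof -
  have "g \<bullet> f \<in> mor C (dm f) (cd g)"
    using comp_mor[of "dm f" "dm g" "cd g" f g] assms by simp
  then show "arr (g \<bullet> f)" "dm (g \<bullet> f) = dm f" "cd (g \<bullet> f) = cd g"
    using assms by (auto dest: morD)
qed

lemma pls_typ [simp]:
  assumes "arr f" "arr g" "dm f = dm g" "cd f = cd g"
  shows "arr (f \<oplus> g)" "dm (f \<oplus> g) = dm f" "cd (f \<oplus> g) = cd f"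
proof -
  interpret comm_group "Hom C (dm f) (cd f)" using assms by (simp add: hom_group)
  have "f \<oplus> g \<in> mor C (dm f) (cd f)"
    unfolding pls_def using assms by (intro m_closed) simp_all
  then show "arr (f \<oplus> g)" "dm (f \<oplus> g) = dm f" "cd (f \<oplus> g) = cd f"
    using assms by (auto dest: morD)
qed

lemma ng_typ [simp]:
  assumes "arr f"
  shows "arr (ng f)" "dm (ng f) = dm f" "cd (ng f) = cd f"
proof -
  interpret comm_group "Hom C (dm f) (cd f)" using assms by (simp add: hom_group)
  have "ng f \<in> mor C (dm f) (cd f)"
    unfolding ng_def using assms by (intro inv_closed) simp
  then show "arr (ng f)" "dm (ng f) = dm f" "cd (ng f) = cd f"
    using assms by (auto dest: morD)
qed

lemma cmp_assoc [simp]: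
  "\<lbrakk>arr f; arr g; arr h; cd f = dm g; cd g = dm h\<rbrakk> \<Longrightarrow> (h \<bullet> g) \<bullet> f = h \<bullet> (g \<bullet> f)"
  by (rule comp_assoc[of "dm f" "dm g" "dm h" "cd h"]) simp_all

lemma Id_cmp [simp]: "\<lbrakk>arr f; cd f = B\<rbrakk> \<Longrightarrow> Id C B \<bullet> f = f"
  using id_left[of "dm f" "cd f" f] by auto

lemma cmp_Id [simp]: "\<lbrakk>arr f; dm f = B\<rbrakk> \<Longrightarrow> f \<bullet> Id C B = f"
  using id_right[of "dm f" "cd f" f] by auto

lemma cmp_pls [simp]:
  "\<lbrakk>arr f; arr f'; arr g; dm f = dm f'; cd f = cd f'; cd f = dm g\<rbrakk>
    \<Longrightarrow> g \<bullet> (f \<oplus> f') = g \<bullet> f \<oplus> g \<bullet> f'"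
  using comp_add_right[of "dm f" "dm g" "cd g" f f' g] by (simp add: mult_pls)

lemma pls_cmp [simp]:
  "\<lbrakk>arr f; arr g; arr g'; dm g = dm g'; cd g = cd g'; cd f = dm g\<rbrakk>
    \<Longrightarrow> (g \<oplus> g') \<bullet> f = g \<bullet> f \<oplus> g' \<bullet> f"
  using comp_add_left[of "dm f" "dm g" "cd g" f g g'] by (simp add: mult_pls)

lemma pls_assoc [simp]:
  assumes "arr f" "arr g" "arr h" "dm f = dm g" "dm g = dm h" "cd f = cd g" "cd g = cd h"
  shows "(f \<oplus> g) \<oplus> h = f \<oplus> (g \<oplus> h)"
proof -
  interpret comm_group "Hom C (dm f) (cd f)" using assms by (simp add: hom_group)
  show ?thesis using m_assoc[of f g h] assms by (simp add: mult_pls)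
qed

lemma pls_comm:
  assumes "arr f" "arr g" "dm f = dm g" "cd f = cd g"
  shows "f \<oplus> g = g \<oplus> f"
proof -
  interpret comm_group "Hom C (dm f) (cd f)" using assms by (simp add: hom_group)
  show ?thesis using m_comm[of f g] assms by (simp add: mult_pls)
qed

lemma pls_left_comm:
  assumes "arr f" "arr g" "arr h" "dm f = dm g" "dm g = dm h" "cd f = cd g" "cd g = cd h"
  shows "f \<oplus> (g \<oplus> h) = g \<oplus> (f \<oplus> h)"
  using assms by (metis pls_assoc pls_comm)

lemmas pls_ac = pls_comm pls_left_comm

lemma pls_zmor [simp]:
  assumes "arr f" "dm f = A" "cd f = B"
  shows "f \<oplus> zmor C A B = f" "zmor C A B \<oplus> f = f"
proof -
  have AB: "A \<in> Ob C" "B \<in> Ob C" using assms by auto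
  then interpret comm_group "Hom C A B" by (rule hom_group)
  have "f \<in> mor C A B" using AB assms by simp
  then show "f \<oplus> zmor C A B = f"
    using r_one[of f] by (simp add: mult_pls[OF assms])
  then show "zmor C A B \<oplus> f = f" using pls_comm[of f "zmor C A B"] assms AB by simp
qed

lemma pls_ng [simp]:
  assumes "arr f"
  shows "f \<oplus> ng f = zmor C (dm f) (cd f)" "ng f \<oplus> f = zmor C (dm f) (cd f)"
proof -
  interpret comm_group "Hom C (dm f) (cd f)" using assms by (auto simp: hom_group)
  show "f \<oplus> ng f = zmor C (dm f) (cd f)" using r_inv[of f] assms by (auto simp: mult_pls inv_ng)
  show "ng f \<oplus> f = zmor C (dm f) (cd f)" using l_inv[of f] assms by (auto simp: mult_pls inv_ng)
qed

lemma pls_ng_left [simp]: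
  assumes "arr f" "arr g" "dm f = dm g" "cd f = cd g"
  shows "f \<oplus> (ng f \<oplus> g) = g" "ng f \<oplus> (f \<oplus> g) = g"
  using assms pls_assoc[of f "ng f" g] pls_assoc[of "ng f" f g] by simp_all

lemma pls_left_cancel:
  assumes "arr f" "arr g" "arr h" "dm f = dm g" "cd f = cd g" "dm f = dm h" "cd f = cd h"
    and "f \<oplus> g = f \<oplus> h"
  shows "g = h"
  using assms by (metis pls_ng_left(2))

text \<open>
  The form of cancellation from which additive maps are seen to preserve zero.
\<close>

lemma pls_eq_selfD:
  assumes "arr f" "arr g" "dm f = dm g" "cd f = cd g" "f \<oplus> g = f"
  shows "g = zmor C (dm f) (cd f)"
  using assms pls_left_cancel[of f g "zmor C (dm f) (cd f)"] by simp

lemma ng_unique: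
  assumes "arr f" "arr g" "dm f = dm g" "cd f = cd g" "f \<oplus> g = zmor C (dm f) (cd f)"
  shows "ng f = g"
  using assms pls_left_cancel[of f "ng f" g] by simp

lemma ng_ng [simp]: "arr f \<Longrightarrow> ng (ng f) = f"
  by (rule ng_unique) simp_all

lemma ng_zmor [simp]: "\<lbrakk>A \<in> Ob C; B \<in> Ob C\<rbrakk> \<Longrightarrow> ng (zmor C A B) = zmor C A B"
  by (rule ng_unique) simp_all

lemma ng_pls [simp]:
  "\<lbrakk>arr f; arr g; dm f = dm g; cd f = cd g\<rbrakk> \<Longrightarrow> ng (f \<oplus> g) = ng f \<oplus> ng g"
  by (rule ng_unique) (simp_all add: pls_left_comm[of g])

lemma zmor_cmp [simp]:
  assumes "arr f" "cd f = A" "B \<in> Ob C"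
  shows "zmor C A B \<bullet> f = zmor C (dm f) B"
proof -
  have A: "A \<in> Ob C" using assms by auto
  have "zmor C A B \<bullet> f \<oplus> zmor C A B \<bullet> f = zmor C A B \<bullet> f"
    using assms A pls_cmp[of f "zmor C A B" "zmor C A B"] by simp
  then show ?thesis
    using pls_eq_selfD[of "zmor C A B \<bullet> f" "zmor C A B \<bullet> f"] assms A by simp
qed

lemma cmp_zmor [simp]:
  assumes "arr f" "dm f = B" "A \<in> Ob C"
  shows "f \<bullet> zmor C A B = zmor C A (cd f)"
proof -
  have B: "B \<in> Ob C" using assms by auto
  have "f \<bullet> zmor C A B \<oplus> f \<bullet> zmor C A B = f \<bullet> zmor C A B"
    using assms B cmp_pls[of "zmor C A B" "zmor C A B" f] by simp
  then show ?thesis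
    using pls_eq_selfD[of "f \<bullet> zmor C A B" "f \<bullet> zmor C A B"] assms B by simp
qed

lemma cmp_ng [simp]: "\<lbrakk>arr f; arr g; cd f = dm g\<rbrakk> \<Longrightarrow> g \<bullet> ng f = ng (g \<bullet> f)"
  by (rule ng_unique[symmetric]) (simp_all flip: cmp_pls)

lemma ng_cmp [simp]: "\<lbrakk>arr f; arr g; cd f = dm g\<rbrakk> \<Longrightarrow> ng g \<bullet> f = ng (g \<bullet> f)"
  by (rule ng_unique[symmetric]) (simp_all flip: pls_cmp)

lemma ng_eq_iff: "\<lbrakk>arr f; arr g\<rbrakk> \<Longrightarrow> ng f = ng g \<longleftrightarrow> f = g"
  by (metis ng_ng)

lemma bip_biproduct:
  assumes "A \<in> Ob C" "B \<in> Ob C"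
  shows "biproduct C A B (bsum C A B) (in1 C A B) (in2 C A B) (pr1 C A B) (pr2 C A B)"
proof -
  obtain P i j p q where "biproduct C A B P i j p q"
    using biproduct_exists[OF assms] by blast
  then have "case bip C A B of (P, i, j, p, q) \<Rightarrow> biproduct C A B P i j p q"
    unfolding bip_def
    by (intro someI[where P = "\<lambda>(P, i, j, p, q). biproduct C A B P i j p q"
          and x = "(P, i, j, p, q)"]) simp
  then show ?thesis
    by (auto simp: bsum_def in1_def in2_def pr1_def pr2_def split: prod.splits)
qed

lemma bip_typ [simp]:
  assumes "A \<in> Ob C" "B \<in> Ob C"
  shows "bsum C A B \<in> Ob C"
    "arr (in1 C A B)" "dm (in1 C A B) = A" "cd (in1 C A B) = bsum C A B"
    "arr (in2 C A B)" "dm (in2 C A B) = B" "cd (in2 C A B) = bsum C A B"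
    "arr (pr1 C A B)" "dm (pr1 C A B) = bsum C A B" "cd (pr1 C A B) = A"
    "arr (pr2 C A B)" "dm (pr2 C A B) = bsum C A B" "cd (pr2 C A B) = B"
  using bip_biproduct[OF assms] assms unfolding biproduct_def by auto

lemma bip_eqs [simp]:
  assumes "A \<in> Ob C" "B \<in> Ob C"
  shows "pr1 C A B \<bullet> in1 C A B = Id C A" "pr2 C A B \<bullet> in2 C A B = Id C B"
    "pr1 C A B \<bullet> in2 C A B = zmor C B A" "pr2 C A B \<bullet> in1 C A B = zmor C A B"
  using bip_biproduct[OF assms] assms unfolding biproduct_def by auto

lemma bip_Id:
  assumes "A \<in> Ob C" "B \<in> Ob C"
  shows "in1 C A B \<bullet> pr1 C A B \<oplus> in2 C A B \<bullet> pr2 C A B = Id C (bsum C A B)"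
proof -
  have "(in1 C A B \<bullet> pr1 C A B) \<otimes>\<^bsub>Hom C (bsum C A B) (bsum C A B)\<^esub> (in2 C A B \<bullet> pr2 C A B)
      = Id C (bsum C A B)"
    using bip_biproduct[OF assms] unfolding biproduct_def by blast
  then show ?thesis using assms by (simp add: mult_pls)
qed

lemma bip_eqs_assoc [simp]:
  assumes "A \<in> Ob C" "B \<in> Ob C" "arr f"
  shows "cd f = A \<Longrightarrow> pr1 C A B \<bullet> (in1 C A B \<bullet> f) = f"
    "cd f = B \<Longrightarrow> pr2 C A B \<bullet> (in2 C A B \<bullet> f) = f"
    "cd f = B \<Longrightarrow> pr1 C A B \<bullet> (in2 C A B \<bullet> f) = zmor C (dm f) A"
    "cd f = A \<Longrightarrow> pr2 C A B \<bullet> (in1 C A B \<bullet> f) = zmor C (dm f) B"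
  using assms by (simp_all flip: cmp_assoc)

lemma mcol_pls:
  "\<lbrakk>arr f; arr g; dm f = A; dm g = A; cd f = B1; cd g = B2\<rbrakk>
    \<Longrightarrow> mcol C A B1 B2 f g = in1 C B1 B2 \<bullet> f \<oplus> in2 C B1 B2 \<bullet> g"
  by (auto simp: mcol_def mult_pls)

lemma mrow_pls:
  "\<lbrakk>arr f; arr g; dm f = A1; dm g = A2; cd f = B; cd g = B\<rbrakk>
    \<Longrightarrow> mrow C A1 A2 B f g = f \<bullet> pr1 C A1 A2 \<oplus> g \<bullet> pr2 C A1 A2"
  by (auto simp: mrow_def mult_pls)

lemma mat_pls:
  "\<lbrakk>arr f11; arr f12; arr f21; arr f22;
    dm f11 = A1; dm f12 = A2; cd f11 = B1; cd f12 = B1;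
    dm f21 = A1; dm f22 = A2; cd f21 = B2; cd f22 = B2\<rbrakk>
    \<Longrightarrow> mat C A1 A2 B1 B2 f11 f12 f21 f22 =
      in1 C B1 B2 \<bullet> (f11 \<bullet> pr1 C A1 A2 \<oplus> f12 \<bullet> pr2 C A1 A2) \<oplus>
      in2 C B1 B2 \<bullet> (f21 \<bullet> pr1 C A1 A2 \<oplus> f22 \<bullet> pr2 C A1 A2)"
  unfolding mat_def by (subst mcol_pls) (auto simp: mrow_pls)

lemmas mats = mcol_pls mrow_pls mat_pls

lemma is_zero_Ob [simp]: "is_zero C Z \<Longrightarrow> Z \<in> Ob C"
  by (simp add: is_zero_def)

lemma to_zero: "\<lbrakk>is_zero C Z; arr f; cd f = Z\<rbrakk> \<Longrightarrow> f = zmor C (dm f) Z"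
  unfolding is_zero_def by (metis dm_Ob mor_iff singletonD)

lemma is_zeroI:
  assumes "Z \<in> Ob C" "Id C Z = zmor C Z Z"
  shows "is_zero C Z"
proof -
  have 1: "f = zmor C Z B" if "f \<in> mor C Z B" "B \<in> Ob C" for f B
  proof -
    have "f = f \<bullet> Id C Z" using that assms(1) by simp
    also have "\<dots> = zmor C Z B" unfolding assms(2) using that assms(1) by simp
    finally show ?thesis .
  qed
  have 2: "f = zmor C B Z" if "f \<in> mor C B Z" "B \<in> Ob C" for f B
  proof -
    have "f = Id C Z \<bullet> f" using that assms(1) by simp
    also have "\<dots> = zmor C B Z" unfolding assms(2) using that assms(1) by simp
    finally show ?thesis .
  qed
  have 3: "zmor C Z B \<in> mor C Z B" "zmor C B Z \<in> mor C B Z" if "B \<in> Ob C" for B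
    using that assms(1) by simp_all
  show ?thesis unfolding is_zero_def using assms(1) 1 2 3 by blast
qed

end

context angulated_category
begin

section \<open>The suspension, signs and rotation\<close>

abbreviation S0 :: "'o \<Rightarrow> 'o" where "S0 \<equiv> on_ob S"
abbreviation S1 :: "'m \<Rightarrow> 'm" where "S1 \<equiv> on_mor S"

lemma S0_bij: "bij_betw S0 (Ob C) (Ob C)"
  using aut unfolding automorphism_def by blast

lemma S0_Ob [simp]: "A \<in> Ob C \<Longrightarrow> S0 A \<in> Ob C"
  using bij_betwE[OF S0_bij] by blast

lemma S1_iso: "\<lbrakk>A \<in> Ob C; B \<in> Ob C\<rbrakk> \<Longrightarrow> S1 \<in> iso (Hom C A B) (Hom C (S0 A) (S0 B))"
  using aut unfolding automorphism_def by blast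

lemma S1_hom:
  assumes "arr f"
  shows "S1 \<in> hom (Hom C (dm f) (cd f)) (Hom C (S0 (dm f)) (S0 (cd f)))"
  using S1_iso[of "dm f" "cd f"] assms by (simp add: iso_def)

lemma S1_typ [simp]:
  assumes "arr f"
  shows "arr (S1 f)" "dm (S1 f) = S0 (dm f)" "cd (S1 f) = S0 (cd f)"
proof -
  have "f \<in> mor C (dm f) (cd f)" using assms by simp
  from hom_in_carrier[OF S1_hom[OF assms] this]
  show "arr (S1 f)" "dm (S1 f) = S0 (dm f)" "cd (S1 f) = S0 (cd f)"
    using assms by simp_all
qed

lemma S1_cmp [simp]:
  assumes "arr f" "arr g" "cd f = dm g"
  shows "S1 (g \<bullet> f) = S1 g \<bullet> S1 f"
proof -
  have "f \<in> mor C (dm f) (dm g)" "g \<in> mor C (dm g) (cd g)" "dm f \<in> Ob C" "dm g \<in> Ob C" "cd g \<in> Ob C"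
    using assms by simp_all
  then show ?thesis using aut unfolding automorphism_def by blast
qed

lemma S1_pls [simp]:
  assumes "arr f" "arr g" "dm f = dm g" "cd f = cd g"
  shows "S1 (f \<oplus> g) = S1 f \<oplus> S1 g"
proof -
  have "f \<in> mor C (dm f) (cd f)" "g \<in> mor C (dm f) (cd f)" using assms by simp_all
  from hom_mult[OF S1_hom[OF assms(1)] this] show ?thesis
    using assms by (simp add: mult_pls)
qed

lemma S1_Id [simp]: "A \<in> Ob C \<Longrightarrow> S1 (Id C A) = Id C (S0 A)"
  using aut unfolding automorphism_def by blast

lemma S1_zmor [simp]:
  assumes "A \<in> Ob C" "B \<in> Ob C"
  shows "S1 (zmor C A B) = zmor C (S0 A) (S0 B)"
  using pls_eq_selfD[of "S1 (zmor C A B)" "S1 (zmor C A B)"] assms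
  by (simp flip: S1_pls)

lemma S1_ng [simp]: "arr f \<Longrightarrow> S1 (ng f) = ng (S1 f)"
  by (rule ng_unique[symmetric]) (simp_all flip: S1_pls)

lemma S1_inj:
  assumes "S1 f = S1 g" "arr f" "arr g" "dm f = dm g" "cd f = cd g"
  shows "f = g"
proof -
  have "inj_on S1 (mor C (dm f) (cd f))"
    using S1_iso[of "dm f" "cd f"] assms(2) by (simp add: iso_def bij_betw_def)
  moreover have "f \<in> mor C (dm f) (cd f)" "g \<in> mor C (dm f) (cd f)"
    using assms(2-) by simp_all
  ultimately show ?thesis using assms(1) by (meson inj_onD)
qed

lemma S1_surj:
  assumes "arr g" "dm g = S0 A" "cd g = S0 B" "A \<in> Ob C" "B \<in> Ob C"
  shows "\<exists>f. arr f \<and> dm f = A \<and> cd f = B \<and> S1 f = g"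
proof -
  have "S1 ` mor C A B = mor C (S0 A) (S0 B)"
    using S1_iso[OF assms(4,5)] by (simp add: iso_def bij_betw_def)
  moreover have "g \<in> mor C (S0 A) (S0 B)" using assms by simp
  ultimately have "g \<in> S1 ` mor C A B" by (simp only:)
  then obtain f where "f \<in> mor C A B" "S1 f = g" by (metis imageE)
  then show ?thesis using assms(4,5) by (intro exI[of _ f]) simp
qed

lemma is_zero_S0:
  assumes "is_zero C Z"
  shows "is_zero C (S0 Z)"
proof -
  have "Id C Z = zmor C Z Z" using to_zero[OF assms, of "Id C Z"] assms by simp
  then have "Id C (S0 Z) = zmor C (S0 Z) (S0 Z)"
    using assms S1_Id[of Z] by (simp del: S1_Id)
  then show ?thesis using assms by (intro is_zeroI) simp_all
qed

lemma S_bip [simp]: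
  assumes "A \<in> Ob C" "B \<in> Ob C"
  shows "S1 (pr1 C A B) \<bullet> S1 (in1 C A B) = Id C (S0 A)" "S1 (pr2 C A B) \<bullet> S1 (in2 C A B) = Id C (S0 B)"
    "S1 (pr1 C A B) \<bullet> S1 (in2 C A B) = zmor C (S0 B) (S0 A)"
    "S1 (pr2 C A B) \<bullet> S1 (in1 C A B) = zmor C (S0 A) (S0 B)"
  using assms by (simp_all add: S1_cmp[symmetric] del: S1_cmp)

lemma S_bip_assoc [simp]:
  assumes "A \<in> Ob C" "B \<in> Ob C" "arr f"
  shows "cd f = S0 A \<Longrightarrow> S1 (pr1 C A B) \<bullet> S1 (in1 C A B) \<bullet> f = f"
    "cd f = S0 B \<Longrightarrow> S1 (pr2 C A B) \<bullet> S1 (in2 C A B) \<bullet> f = f"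
    "cd f = S0 B \<Longrightarrow> S1 (pr1 C A B) \<bullet> S1 (in2 C A B) \<bullet> f = zmor C (dm f) (S0 A)"
    "cd f = S0 A \<Longrightarrow> S1 (pr2 C A B) \<bullet> S1 (in1 C A B) \<bullet> f = zmor C (dm f) (S0 B)"
  using assms by (simp_all add: cmp_assoc[symmetric] del: cmp_assoc)

lemma S_bip_Id:
  assumes "A \<in> Ob C" "B \<in> Ob C"
  shows "S1 (in1 C A B) \<bullet> S1 (pr1 C A B) \<oplus> S1 (in2 C A B) \<bullet> S1 (pr2 C A B) = Id C (S0 (bsum C A B))"
  using assms by (simp add: bip_Id S1_cmp[symmetric] S1_pls[symmetric] del: S1_cmp S1_pls)

lemma sigma_seq_iff:
  "sigma_seq C n S (X, \<delta>) \<longleftrightarrow>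
    (\<forall>i\<le>Suc n. ob X i \<in> Ob C) \<and>
    (\<forall>i\<le>n. arr (df X i) \<and> dm (df X i) = ob X i \<and> cd (df X i) = ob X (Suc i)) \<and>
    arr \<delta> \<and> dm \<delta> = ob X (Suc n) \<and> cd \<delta> = S0 (ob X 0)"
  by (auto simp: sigma_seq_def)

lemma sigma_seqD:
  assumes "sigma_seq C n S (X, \<delta>)"
  shows "i \<le> Suc n \<Longrightarrow> ob X i \<in> Ob C" "ob X 0 \<in> Ob C"
    "i \<le> n \<Longrightarrow> arr (df X i)" "i \<le> n \<Longrightarrow> dm (df X i) = ob X i"
    "i \<le> n \<Longrightarrow> cd (df X i) = ob X (Suc i)" "arr \<delta>" "dm \<delta> = ob X (Suc n)" "cd \<delta> = S0 (ob X 0)"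
  using assms by (simp_all add: sigma_seq_iff)

lemma angleD:
  assumes "(X, \<delta>) \<in> \<Theta>"
  shows "i \<le> Suc n \<Longrightarrow> ob X i \<in> Ob C" "ob X 0 \<in> Ob C"
    "i \<le> n \<Longrightarrow> arr (df X i)" "i \<le> n \<Longrightarrow> dm (df X i) = ob X i"
    "i \<le> n \<Longrightarrow> cd (df X i) = ob X (Suc i)" "arr \<delta>" "dm \<delta> = ob X (Suc n)" "cd \<delta> = S0 (ob X 0)"
  using sigma_seqD[OF angle_seq[OF assms]] by simp_all

lemma sigma_map_iff:
  assumes "sigma_seq C n S (X, \<delta>)" "sigma_seq C n S (Y, \<rho>)"
  shows "sigma_map C n S (X, \<delta>) (Y, \<rho>) f \<longleftrightarrow>
    (\<forall>i\<le>Suc n. arr (f i) \<and> dm (f i) = ob X i \<and> cd (f i) = ob Y i) \<and>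
    (\<forall>i\<le>n. df Y i \<bullet> f i = f (Suc i) \<bullet> df X i) \<and>
    \<rho> \<bullet> f (Suc n) = S1 (f 0) \<bullet> \<delta>"
  using sigma_seqD(1)[OF assms(1)] sigma_seqD(1)[OF assms(2)]
  by (auto simp: sigma_map_def chain_map_def less_Suc_eq_le)

definition signed :: "bool \<Rightarrow> 'm \<Rightarrow> 'm" where
  "signed b f = (if b then ng f else f)"

lemma signed_typ [simp]: "arr f \<Longrightarrow> arr (signed b f)" "arr f \<Longrightarrow> dm (signed b f) = dm f" "arr f \<Longrightarrow> cd (signed b f) = cd f"
  by (simp_all add: signed_def)

lemma signed_signed [simp]: "arr f \<Longrightarrow> signed b (signed b f) = f"
  by (simp add: signed_def)

lemma signed_False [simp]: "signed False f = f"
  by (simp add: signed_def)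

text \<open>
  Multiplying the identity of \<open>X\<^sup>i\<close> by an arbitrary sign is an isomorphism onto the sequence
  whose maps carry the quotients of neighbouring signs.  Hence signs may be moved around freely
  as long as their product over all \<open>n + 2\<close> maps is unchanged.
\<close>

lemma sign_change:
  fixes \<sigma> :: "nat \<Rightarrow> bool"
  assumes X: "(X, \<delta>) \<in> \<Theta>"
    and "\<And>i. i \<le> Suc n \<Longrightarrow> ob Y i = ob X i"
    and "\<And>i. i \<le> n \<Longrightarrow> df Y i = signed (\<sigma> i \<noteq> \<sigma> (Suc i)) (df X i)"
    and "\<rho> = signed (\<sigma> 0 \<noteq> \<sigma> (Suc n)) \<delta>"
  shows "(Y, \<rho>) \<in> \<Theta>"
proof -
  note D [simp] = angleD[OF X]
  have Y: "sigma_seq C n S (Y, \<rho>)" by (simp add: sigma_seq_iff assms)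
  have "sigma_map C n S (X, \<delta>) (Y, \<rho>) (\<lambda>i. signed (\<sigma> i) (Id C (ob X i)))"
    by (subst sigma_map_iff[OF angle_seq[OF X] Y]) (simp add: assms signed_def)
  moreover have "is_iso C (ob X i) (ob Y i) (signed (\<sigma> i) (Id C (ob X i)))" if "i \<le> n + 1" for i
    using that assms unfolding is_iso_def
    by (auto intro!: bexI[of _ "signed (\<sigma> i) (Id C (ob X i))"] simp: signed_def)
  ultimately have "sigma_iso C n S (X, \<delta>) (Y, \<rho>)"
    unfolding sigma_iso_def fst_conv by blast
  with F1_iso[OF X Y] show ?thesis .
qed

lemma sign_change_iff:
  fixes \<sigma> :: "nat \<Rightarrow> bool"
  assumes X: "sigma_seq C n S (X, \<delta>)"
    and Y: "\<And>i. i \<le> Suc n \<Longrightarrow> ob Y i = ob X i"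
    "\<And>i. i \<le> n \<Longrightarrow> df Y i = signed (\<sigma> i \<noteq> \<sigma> (Suc i)) (df X i)"
    "\<rho> = signed (\<sigma> 0 \<noteq> \<sigma> (Suc n)) \<delta>"
  shows "(Y, \<rho>) \<in> \<Theta> \<longleftrightarrow> (X, \<delta>) \<in> \<Theta>"
proof
  show "(X, \<delta>) \<in> \<Theta>" if "(Y, \<rho>) \<in> \<Theta>"
    by (rule sign_change[OF that, where \<sigma> = \<sigma>]) (simp_all add: Y sigma_seqD[OF X])
  show "(Y, \<rho>) \<in> \<Theta>" if "(X, \<delta>) \<in> \<Theta>"
    by (rule sign_change[OF that, where \<sigma> = \<sigma>]) (simp_all add: Y)
qed

text \<open>
  Objects and differentials beyond the range of a sequence do not affect membership in \<open>\<Theta>\<close>.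
\<close>

lemma angle_cong:
  assumes X: "sigma_seq C n S (X, \<delta>)"
    and Y: "\<And>i. i \<le> Suc n \<Longrightarrow> ob Y i = ob X i" "\<And>i. i \<le> n \<Longrightarrow> df Y i = df X i"
  shows "(Y, \<delta>) \<in> \<Theta> \<longleftrightarrow> (X, \<delta>) \<in> \<Theta>"
  by (rule sign_change_iff[OF X, where \<sigma> = "\<lambda>_. False"]) (simp_all add: Y)

text \<open>
  A sequence is prolonged to the right by \<open>X\<^sup>i\<^sup>+\<^sup>n\<^sup>+\<^sup>2 = \<Sigma>X\<^sup>i\<close> and
  \<open>d\<^sup>i\<^sup>+\<^sup>n\<^sup>+\<^sup>2 = (-1)\<^sup>n \<Sigma>d\<^sup>i\<close>, where \<open>d\<^sup>n\<^sup>+\<^sup>1 = \<delta>\<close>.  One period, that is, the indices up to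
  \<open>2n + 3\<close>, suffices for all rotations that occur.  The \<open>k\<close>-fold rotation is then the
  window of \<open>n + 2\<close> consecutive maps that starts at index \<open>k\<close>.
\<close>

definition ext_ob :: "('o, 'm) seq \<times> 'm \<Rightarrow> nat \<Rightarrow> 'o" where
  "ext_ob = (\<lambda>(X, \<delta>) i. if i \<le> n + 1 then ob X i else S0 (ob X (i - (n + 2))))"

definition ext_df :: "('o, 'm) seq \<times> 'm \<Rightarrow> nat \<Rightarrow> 'm" where
  "ext_df = (\<lambda>(X, \<delta>) i. if i \<le> n then df X i else if i = n + 1 then \<delta>
    else signed (odd n) (S1 (if i \<le> 2 * n + 2 then df X (i - (n + 2)) else \<delta>)))"

definition window :: "nat \<Rightarrow> ('o, 'm) seq \<times> 'm \<Rightarrow> ('o, 'm) seq \<times> 'm" where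
  "window k T = (\<lparr>ob = \<lambda>i. ext_ob T (i + k), df = \<lambda>i. ext_df T (i + k)\<rparr>, ext_df T (n + 1 + k))"

lemma ext_ob_simps:
  "i \<le> Suc n \<Longrightarrow> ext_ob (X, \<delta>) i = ob X i"
  "ext_ob (X, \<delta>) (Suc (Suc (n + j))) = S0 (ob X j)"
  by (simp_all add: ext_ob_def)

lemma ext_df_simps:
  "i \<le> n \<Longrightarrow> ext_df (X, \<delta>) i = df X i"
  "ext_df (X, \<delta>) (Suc n) = \<delta>"
  "j \<le> n \<Longrightarrow> ext_df (X, \<delta>) (Suc (Suc (n + j))) = signed (odd n) (S1 (df X j))"
  "ext_df (X, \<delta>) (Suc (Suc (n + Suc n))) = signed (odd n) (S1 \<delta>)"
  by (simp_all add: ext_df_def)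

lemma ext_typ:
  assumes T: "sigma_seq C n S T"
  shows "i \<le> 2 * n + 3 \<Longrightarrow> ext_ob T i \<in> Ob C"
    "i \<le> 2 * n + 3 \<Longrightarrow> arr (ext_df T i)" "i \<le> 2 * n + 3 \<Longrightarrow> dm (ext_df T i) = ext_ob T i"
    "i \<le> 2 * n + 2 \<Longrightarrow> cd (ext_df T i) = ext_ob T (Suc i)"
    "i \<le> n + 1 \<Longrightarrow> ext_ob T (i + n + 2) = S0 (ext_ob T i)"
    "i \<le> n + 1 \<Longrightarrow> ext_df T (i + n + 2) = signed (odd n) (S1 (ext_df T i))"
proof -
  obtain X \<delta> where TX: "T = (X, \<delta>)" by (cases T)
  note D [simp] = sigma_seqD[OF T[unfolded TX]]
  have "(i \<le> 2 * n + 3 \<longrightarrow> ext_ob T i \<in> Ob C \<and> arr (ext_df T i) \<and> dm (ext_df T i) = ext_ob T i) \<and>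
    (i \<le> 2 * n + 2 \<longrightarrow> cd (ext_df T i) = ext_ob T (Suc i))"
  proof -
    consider "i \<le> n" | "i = Suc n" | j where "j \<le> n" "i = Suc (Suc (n + j))"
      | "i = Suc (Suc (n + Suc n))" | "2 * n + 3 < i"
    proof (cases "Suc (Suc n) \<le> i")
      case True
      then obtain j where j: "i = Suc (Suc (n + j))" by (metis le_Suc_ex add_Suc)
      consider "j \<le> n" | "j = Suc n" | "Suc n < j" by linarith
      then show ?thesis
        by cases (rule that(3)[OF _ j], assumption, rule that(4), simp add: j, rule that(5), simp add: j)
    next
      case False
      then show ?thesis using that(1,2) by linarith
    qed
    then show ?thesis
    proof cases
      case 1
      then show ?thesis by (simp add: TX ext_ob_simps ext_df_simps)
    next
      case 2
      then show ?thesis using ext_ob_simps(2)[of X \<delta> 0] by (simp add: TX ext_ob_simps(1) ext_df_simps(2))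
    next
      case 3
      then show ?thesis using ext_ob_simps(2)[of X \<delta> "Suc j"] ext_ob_simps(2)[of X \<delta> j]
        by (simp add: TX ext_df_simps(3))
    next
      case 4
      then show ?thesis using ext_ob_simps(2)[of X \<delta> "Suc n"] ext_df_simps(4)[of X \<delta>]
        by (simp add: TX)
    qed simp
  qed
  then show "i \<le> 2 * n + 3 \<Longrightarrow> ext_ob T i \<in> Ob C"
    "i \<le> 2 * n + 3 \<Longrightarrow> arr (ext_df T i)" "i \<le> 2 * n + 3 \<Longrightarrow> dm (ext_df T i) = ext_ob T i"
    "i \<le> 2 * n + 2 \<Longrightarrow> cd (ext_df T i) = ext_ob T (Suc i)" by blast+
  show "i \<le> n + 1 \<Longrightarrow> ext_ob T (i + n + 2) = S0 (ext_ob T i)"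
    using ext_ob_simps(2)[of X \<delta> i] ext_ob_simps(1)[of i X \<delta>] by (simp add: TX add.commute)
  show "i \<le> n + 1 \<Longrightarrow> ext_df T (i + n + 2) = signed (odd n) (S1 (ext_df T i))"
    using ext_df_simps(3)[of i X \<delta>] ext_df_simps(1)[of i X \<delta>] ext_df_simps(2,4)[of X \<delta>]
    by (cases "i = Suc n") (simp_all add: TX add.commute)
qed

lemma window_seq:
  assumes T: "sigma_seq C n S T" and k: "k \<le> n + 2"
  shows "sigma_seq C n S (window k T)"
proof -
  have "cd (ext_df T (n + 1 + k)) = S0 (ext_ob T k)"
  proof (cases "k = n + 2")
    case True
    have "ext_df T (n + 1 + k) = signed (odd n) (S1 (ext_df T (n + 1)))"
      using ext_typ(6)[OF T, of "n + 1"] True by (simp add: add.assoc)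
    then show ?thesis using True ext_typ[OF T] ext_typ(5)[OF T, of 0] by simp
  next
    case False
    then show ?thesis using k ext_typ(4)[OF T, of "n + 1 + k"] ext_typ(5)[OF T, of k]
      by (simp add: add_ac)
  qed
  then show ?thesis using k ext_typ[OF T] by (simp add: window_def sigma_seq_iff)
qed

lemma window_angle:
  assumes T: "sigma_seq C n S T" and k: "k \<le> n + 2"
  shows "window k T \<in> \<Theta> \<longleftrightarrow> T \<in> \<Theta>"
  using k
proof (induction k)
  case 0
  obtain X \<delta> where TX: "T = (X, \<delta>)" by (cases T)
  have "window 0 T = (\<lparr>ob = ext_ob T, df = ext_df T\<rparr>, \<delta>)"
    by (simp add: window_def ext_df_def TX)
  moreover have "(\<lparr>ob = ext_ob T, df = ext_df T\<rparr>, \<delta>) \<in> \<Theta> \<longleftrightarrow> (X, \<delta>) \<in> \<Theta>"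
    by (rule angle_cong) (use T in \<open>simp_all add: TX ext_ob_def ext_df_def\<close>)
  ultimately show ?case by (simp add: TX)
next
  case (Suc k)
  have W: "sigma_seq C n S (window k T)" "sigma_seq C n S (window (Suc k) T)"
    using window_seq T Suc.prems by simp_all
  have last: "ext_df T (Suc (Suc (n + k))) = signed (odd n) (S1 (ext_df T k))"
    using ext_typ(6)[OF T, of k] Suc.prems by (simp add: add_ac)
  have "rotation C n S (window k T) \<in> \<Theta> \<longleftrightarrow> window (Suc k) T \<in> \<Theta>"
  proof -
    have *: "ext_ob T (Suc (Suc (n + k))) = S0 (ext_ob T k)"
      using ext_typ(5)[OF T, of k] Suc.prems by (simp add: add_ac)
    have **: "(if even n then S1 (ext_df T k)
       else neg C (S0 (ext_ob T k)) (S0 (ext_ob T (Suc k))) (S1 (ext_df T k))) = ext_df T (Suc (Suc (n + k)))"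
      using Suc.prems by (simp add: last signed_def ext_typ[OF T] inv_ng)
    define R where "R = \<lparr>ob = (\<lambda>i. if i \<le> n then ext_ob T (Suc (i + k)) else S0 (ext_ob T k)),
      df = (\<lambda>i. if i < n then ext_df T (Suc (i + k)) else ext_df T (Suc (n + k)))\<rparr>"
    define W where "W = \<lparr>ob = (\<lambda>i. ext_ob T (Suc (i + k))), df = (\<lambda>i. ext_df T (Suc (i + k)))\<rparr>"
    have "window (Suc k) T = (W, ext_df T (Suc (Suc (n + k))))"
      by (simp add: window_def W_def)
    moreover have "rotation C n S (window k T) = (R, ext_df T (Suc (Suc (n + k))))"
      using ** by (simp add: rotation_def window_def R_def cong: if_cong)
    moreover have "ob R i = ob W i" if "i \<le> Suc n" for i
      using that * by (cases "i = Suc n") (simp_all add: R_def W_def)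
    moreover have "df R i = df W i" if "i \<le> n" for i
      using that by (cases "i = n") (simp_all add: R_def W_def)
    ultimately show ?thesis using angle_cong[of W _ R] W(2) by simp
  qed
  then show ?case using F2[OF W(1)] Suc.IH Suc.prems by simp
qed

text \<open>
  The \<open>(n+1)\<close>-fold rotation with all signs dropped.  The two ends of an \<open>n\<close>-exangle have become
  (up to suspension) the first two objects, to which (F3) and (F4) apply.
\<close>

definition shift :: "('o, 'm) seq \<times> 'm \<Rightarrow> ('o, 'm) seq \<times> 'm" where
  "shift = (\<lambda>(X, \<delta>).
    (\<lparr>ob = (\<lambda>i. if i = 0 then ob X (n + 1) else S0 (ob X (i - 1))),
      df = (\<lambda>i. if i = 0 then \<delta> else S1 (df X (i - 1)))\<rparr>, S1 (df X n)))"

lemma shift_seq: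
  assumes "sigma_seq C n S T"
  shows "sigma_seq C n S (shift T)"
proof -
  obtain X \<delta> where T: "T = (X, \<delta>)" by (cases T)
  note D = sigma_seqD[OF assms[unfolded T]]
  show ?thesis unfolding shift_def T prod.case sigma_seq_iff
    by (auto simp: D gr0_conv_Suc)
qed

text \<open>
  Rotating \<open>n + 1\<close> times puts the sign \<open>(-1)\<^sup>n\<close> on each of the \<open>n + 1\<close> maps \<open>\<Sigma>d\<^sup>i\<close>.  Their
  product is \<open>(-1)\<close> to the even power \<open>n(n + 1)\<close>, so all of them can be removed.
\<close>

lemma shift_angle_iff:
  assumes T: "sigma_seq C n S T"
  shows "shift T \<in> \<Theta> \<longleftrightarrow> T \<in> \<Theta>"
proof -
  obtain X \<delta> where TX: "T = (X, \<delta>)" by (cases T)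
  note D [simp] = sigma_seqD[OF T[unfolded TX]]
  have k: "n + 1 \<le> n + 2" by simp
  \<comment> \<open>For odd n the signs alternate from index 1 on; index 0 and index 1 agree, so \<open>\<delta>\<close> keeps its sign.\<close>
  define \<sigma> :: "nat \<Rightarrow> bool" where "\<sigma> = (\<lambda>i. odd n \<and> even i \<and> i \<noteq> 0)"
  obtain W \<omega> where W: "window (n + 1) T = (W, \<omega>)" by (cases "window (n + 1) T")
  have W0: "ob W 0 = ob X (Suc n)" "df W 0 = \<delta>"
    using W ext_df_simps(2)[of X \<delta>] by (auto simp: window_def TX ext_ob_simps(1))
  have WS: "ob W (Suc i) = S0 (ob X i)" for i
    using W ext_ob_simps(2)[of X \<delta> i] by (auto simp: window_def TX add.commute)
  have WS': "i \<le> n \<Longrightarrow> df W (Suc i) = signed (odd n) (S1 (df X i))" for i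
    using W ext_df_simps(3)[of i X \<delta>] by (auto simp: window_def TX add.commute)
  have Wd: "\<omega> = signed (odd n) (S1 (df X n))"
    using W ext_df_simps(3)[of n X \<delta>] by (simp add: window_def TX add.commute)
  obtain Y \<rho> where Y: "shift T = (Y, \<rho>)" by (cases "shift T")
  have seq: "sigma_seq C n S (W, \<omega>)" using window_seq[OF T k] unfolding W .
  have "ob Y i = ob W i" if "i \<le> Suc n" for i
    using that Y WS W0 by (cases i) (auto simp: shift_def TX)
  moreover have "df Y i = signed (\<sigma> i \<noteq> \<sigma> (Suc i)) (df W i)" if "i \<le> n" for i
    using that Y WS' W0 by (cases i) (auto simp: shift_def TX \<sigma>_def signed_def)
  moreover have "\<rho> = signed (\<sigma> 0 \<noteq> \<sigma> (Suc n)) \<omega>"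
    using Y Wd by (auto simp: shift_def TX \<sigma>_def signed_def)
  ultimately have "(Y, \<rho>) \<in> \<Theta> \<longleftrightarrow> (W, \<omega>) \<in> \<Theta>" by (rule sign_change_iff[OF seq])
  then show ?thesis using window_angle[OF T k] unfolding W Y by simp
qed

definition susp_neg :: "('o, 'm) seq \<times> 'm \<Rightarrow> ('o, 'm) seq \<times> 'm" where
  "susp_neg = (\<lambda>(X, \<delta>).
    (\<lparr>ob = (\<lambda>i. S0 (ob X i)), df = (\<lambda>i. ng (S1 (df X i)))\<rparr>, ng (S1 \<delta>)))"

text \<open>
  Rotating \<open>n + 2\<close> times puts the sign \<open>(-1)\<^sup>n\<close> on all \<open>n + 2\<close> maps.  As \<open>n(n + 2)\<close> and
  \<open>n + 2\<close> have the same parity, the product is that of \<open>n + 2\<close> signs \<open>-1\<close>.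
\<close>

lemma susp_neg_angle_iff:
  assumes T: "sigma_seq C n S T"
  shows "susp_neg T \<in> \<Theta> \<longleftrightarrow> T \<in> \<Theta>"
proof -
  obtain X \<delta> where TX: "T = (X, \<delta>)" by (cases T)
  note D [simp] = sigma_seqD[OF T[unfolded TX]]
  have k: "n + 2 \<le> n + 2" by simp
  \<comment> \<open>For odd n all signs are already -1; for even n they alternate, and the ends 0 and n + 1 differ.\<close>
  define \<sigma> :: "nat \<Rightarrow> bool" where "\<sigma> = (\<lambda>i. even n \<and> odd i)"
  obtain W \<omega> where W: "window (n + 2) T = (W, \<omega>)" by (cases "window (n + 2) T")
  have W0: "ob W i = S0 (ob X i)" for i
    using W ext_ob_simps(2)[of X \<delta> i] by (auto simp: window_def TX add.commute)
  have W1: "i \<le> n \<Longrightarrow> df W i = signed (odd n) (S1 (df X i))" for i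
    using W ext_df_simps(3)[of i X \<delta>] by (auto simp: window_def TX add.commute)
  have Wd: "\<omega> = signed (odd n) (S1 \<delta>)"
    using W ext_df_simps(4)[of X \<delta>] by (simp add: window_def TX add.commute)
  obtain Y \<rho> where Y: "susp_neg T = (Y, \<rho>)" by (cases "susp_neg T")
  have seq: "sigma_seq C n S (W, \<omega>)" using window_seq[OF T k] unfolding W .
  have "ob Y i = ob W i" if "i \<le> Suc n" for i
    using that Y W0 by (auto simp: susp_neg_def TX)
  moreover have "df Y i = signed (\<sigma> i \<noteq> \<sigma> (Suc i)) (df W i)" if "i \<le> n" for i
    using that Y W1 by (auto simp: susp_neg_def TX \<sigma>_def signed_def)
  moreover have "\<rho> = signed (\<sigma> 0 \<noteq> \<sigma> (Suc n)) \<omega>"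
    using Y Wd by (auto simp: susp_neg_def TX \<sigma>_def signed_def)
  ultimately have "(Y, \<rho>) \<in> \<Theta> \<longleftrightarrow> (W, \<omega>) \<in> \<Theta>" by (rule sign_change_iff[OF seq])
  then show ?thesis using window_angle[OF T k] unfolding W Y by simp
qed

section \<open>Exactness of angles\<close>

text \<open>
  Rotating until the identity comes first reduces this to the trivial angles of (F1).
\<close>

lemma trivial_angle:
  assumes X: "sigma_seq C n S (X, \<delta>)"
    and j: "j \<le> n" "ob X (Suc j) = ob X j" "df X j = Id C (ob X j)"
    and z: "\<And>i. \<lbrakk>i \<le> Suc n; i \<noteq> j; i \<noteq> Suc j\<rbrakk> \<Longrightarrow> is_zero C (ob X i)"
  shows "(X, \<delta>) \<in> \<Theta>"
proof -
  have k: "j \<le> n + 2" using j by simp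
  define W where "W = \<lparr>ob = (\<lambda>i. ext_ob (X, \<delta>) (i + j)), df = (\<lambda>i. ext_df (X, \<delta>) (i + j))\<rparr>"
  have W: "window j (X, \<delta>) = (W, ext_df (X, \<delta>) (n + 1 + j))" by (simp add: window_def W_def)
  have "window j (X, \<delta>) \<in> \<Theta>"
    unfolding W
  proof (rule F1_trivial)
    show "sigma_seq C n S (W, ext_df (X, \<delta>) (n + 1 + j))"
      using window_seq[OF X k] unfolding W .
    show "ob W 1 = ob W 0" "df W 0 = Id C (ob W 0)"
      using j by (simp_all add: W_def ext_ob_simps ext_df_simps)
    show "is_zero C (ob W i)"
      if i: "2 \<le> i" "i \<le> n + 1" for i
    proof (cases "i + j \<le> Suc n")
      case True
      then show ?thesis using z[of "i + j"] i by (simp add: W_def ext_ob_simps)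
    next
      case False
      then obtain l where l: "i + j = Suc (Suc (n + l))"
        by (metis le_Suc_ex add_Suc not_less_eq_eq)
      then have "is_zero C (ob X l)" using z[of l] i j by simp
      then show ?thesis using ext_ob_simps(2)[of X \<delta> l] l is_zero_S0 by (simp add: W_def)
    qed
  qed
  then show ?thesis using window_angle[OF X k] by simp
qed

definition zero_obj :: 'o where "zero_obj = (SOME Z. is_zero C Z)"

lemma zero_obj [simp]: "is_zero C zero_obj" "zero_obj \<in> Ob C"
  using someI_ex[OF zero_exists] by (simp_all add: zero_obj_def)

text \<open>
  The complex \<open>A = A\<close> placed in degrees \<open>j\<close> and \<open>j + 1\<close>.  These test angles turn the completion
  axiom (F3) into statements about single morphisms.
\<close>

definition trivial_seq :: "nat \<Rightarrow> 'o \<Rightarrow> ('o, 'm) seq" where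
  "trivial_seq j A = \<lparr>ob = (\<lambda>i. if i = j \<or> i = Suc j then A else zero_obj),
    df = (\<lambda>i. if i = j then Id C A
      else zmor C (if i = Suc j then A else zero_obj) (if Suc i = j then A else zero_obj))\<rparr>"

definition trivial_last :: "nat \<Rightarrow> 'o \<Rightarrow> 'm" where
  "trivial_last j A = zmor C (if j = n then A else zero_obj) (S0 (if j = 0 then A else zero_obj))"

lemma trivial_seq_angle:
  assumes "A \<in> Ob C" "j \<le> n"
  shows "(trivial_seq j A, trivial_last j A) \<in> \<Theta>"
proof (rule trivial_angle[OF _ assms(2)])
  show "sigma_seq C n S (trivial_seq j A, trivial_last j A)"
    using assms n_ge_1 by (auto simp: sigma_seq_iff trivial_seq_def trivial_last_def)
qed (auto simp: trivial_seq_def)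

text \<open>
  The square formed by \<open>1\<close> and \<open>d\<^sup>0\<close> from \<open>X\<^sup>0 = X\<^sup>0 \<rightarrow> 0\<close> to \<open>X\<close> extends by (F3), which
  factors \<open>d\<^sup>1 d\<^sup>0\<close> through a zero object.
\<close>

lemma angle_zero_0: assumes X: "(X, \<delta>) \<in> \<Theta>"
  shows "df X 1 \<bullet> df X 0 = zmor C (ob X 0) (ob X 2)"
proof -
  note D [simp] = angleD[OF X]
  define A where "A = ob X 0"
  have A [simp]: "A \<in> Ob C" "ob X 0 = A" by (simp_all add: A_def)
  have t: "(trivial_seq 0 A, trivial_last 0 A) \<in> \<Theta>" using trivial_seq_angle by simp
  obtain f where f: "sigma_map C n S (trivial_seq 0 A, trivial_last 0 A) (X, \<delta>) f" "f 0 = Id C A" "f 1 = df X 0"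
    using F3[OF t X, of "Id C A" "df X 0"] by (auto simp: trivial_seq_def)
  have 1: "Suc 0 \<le> n" "Suc (Suc 0) \<le> Suc n" using n_ge_1 by simp_all
  note M = f(1)[unfolded sigma_map_iff[OF angle_seq[OF t] angle_seq[OF X]]]
  have "df X 1 \<bullet> f 1 = f 2 \<bullet> df (trivial_seq 0 A) 1" using M 1 by (simp add: numeral_2_eq_2)
  moreover have "df (trivial_seq 0 A) 1 = zmor C A zero_obj" by (simp add: trivial_seq_def)
  moreover have "arr (f 2)" "dm (f 2) = zero_obj" "cd (f 2) = ob X 2"
    using M 1 by (simp_all add: numeral_2_eq_2 trivial_seq_def)
  ultimately show ?thesis using f by simp
qed

text \<open>
  By (F3) the morphism \<open>(0, g)\<close> from \<open>X\<close> to \<open>0 \<rightarrow> W = W\<close> extends to degree \<open>2\<close>, where it is the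
  desired factorization.
\<close>

lemma right_exact_0:
  assumes X: "(X, \<delta>) \<in> \<Theta>" and g: "arr g" "dm g = ob X 1" "g \<bullet> df X 0 = zmor C (ob X 0) (cd g)"
  shows "\<exists>h. arr h \<and> dm h = ob X 2 \<and> cd h = cd g \<and> g = h \<bullet> df X 1"
proof -
  note D [simp] = angleD[OF X]
  have W [simp]: "cd g \<in> Ob C" using g by simp
  have 1: "Suc 0 \<le> n" "Suc (Suc 0) \<le> Suc n" using n_ge_1 by simp_all
  then have t: "(trivial_seq 1 (cd g), trivial_last 1 (cd g)) \<in> \<Theta>" using trivial_seq_angle by simp
  obtain f where f: "sigma_map C n S (X, \<delta>) (trivial_seq 1 (cd g), trivial_last 1 (cd g)) f" "f 1 = g"
    using F3[OF X t, of "zmor C (ob X 0) zero_obj" g] g by (auto simp: trivial_seq_def)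
  note M = f(1)[unfolded sigma_map_iff[OF angle_seq[OF X] angle_seq[OF t]]]
  have "df (trivial_seq 1 (cd g)) 1 \<bullet> f 1 = f 2 \<bullet> df X 1" using M 1 by (simp add: numeral_2_eq_2)
  moreover have "df (trivial_seq 1 (cd g)) 1 = Id C (cd g)" by (simp add: trivial_seq_def)
  moreover have "arr (f 2)" "dm (f 2) = ob X 2" "cd (f 2) = cd g"
    using M 1 by (simp_all add: numeral_2_eq_2 trivial_seq_def)
  ultimately show ?thesis using f g by auto
qed

text \<open>
  Here the known components \<open>(g, 0)\<close> of a morphism from \<open>W = W \<rightarrow> 0\<close> to \<open>X\<close> are those in degrees
  \<open>1\<close> and \<open>2\<close>, and the factorization is the component in degree \<open>0\<close>.  After one rotation
  (F3) yields its suspension.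
\<close>

lemma left_exact_0:
  assumes X: "(X, \<delta>) \<in> \<Theta>" and g: "arr g" "cd g = ob X 1" "df X 1 \<bullet> g = zmor C (dm g) (ob X 2)"
  shows "\<exists>h. arr h \<and> cd h = ob X 0 \<and> dm h = dm g \<and> g = df X 0 \<bullet> h"
proof -
  note D [simp] = angleD[OF X]
  define W where "W = dm g"
  have W [simp]: "W \<in> Ob C" "dm g = W" using g by (simp_all add: W_def)
  have 1: "Suc 0 \<le> n" "Suc (Suc 0) \<le> Suc n" "1 \<le> n + 2" using n_ge_1 by simp_all
  then have t: "(trivial_seq 0 W, trivial_last 0 W) \<in> \<Theta>" using trivial_seq_angle by simp
  note sX = angle_seq[OF X] and st = angle_seq[OF t]
  have "window 1 (X, \<delta>) \<in> \<Theta>" "window 1 (trivial_seq 0 W, trivial_last 0 W) \<in> \<Theta>"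
    using window_angle[OF sX 1(3)] window_angle[OF st 1(3)] X t by simp_all
  then obtain Y \<rho> V \<omega> where
    Y: "window 1 (X, \<delta>) = (Y, \<rho>)" "(Y, \<rho>) \<in> \<Theta>" and
    V: "window 1 (trivial_seq 0 W, trivial_last 0 W) = (V, \<omega>)" "(V, \<omega>) \<in> \<Theta>" by (metis surj_pair)
  have YV: "ob Y 0 = ob X 1" "df Y 0 = df X 1" "ob Y (Suc 0) = ob X 2" "ob V 0 = W" "df V 0 = zmor C W zero_obj"
    "ob V (Suc 0) = zero_obj" "ob Y (Suc n) = S0 (ob X 0)" "ob V (Suc n) = S0 W"
    "\<rho> = signed (odd n) (S1 (df X 0))" "\<omega> = signed (odd n) (Id C (S0 W))"
    using Y(1) V(1) 1 ext_ob_simps(2)[of X \<delta> 0] ext_ob_simps(2)[of "trivial_seq 0 W" "trivial_last 0 W" 0]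
      ext_df_simps(3)[of 0 X \<delta>] ext_df_simps(3)[of 0 "trivial_seq 0 W" "trivial_last 0 W"]
    by (auto simp: window_def ext_ob_simps(1) ext_df_simps(1) trivial_seq_def numeral_2_eq_2)
  have X2: "ob X 2 \<in> Ob C" using angleD(1)[OF X 1(2)] by (simp add: numeral_2_eq_2)
  obtain f where f: "sigma_map C n S (V, \<omega>) (Y, \<rho>) f" "f 0 = g" "f 1 = zmor C zero_obj (ob X 2)"
    using F3[OF V(2) Y(2), of g "zmor C zero_obj (ob X 2)"] g X2 by (auto simp: YV)
  note M = f(1)[unfolded sigma_map_iff[OF angle_seq[OF V(2)] angle_seq[OF Y(2)]]]
  have h: "arr (f (Suc n))" "dm (f (Suc n)) = S0 W" "cd (f (Suc n)) = S0 (ob X 0)"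
    "\<rho> \<bullet> f (Suc n) = S1 g \<bullet> \<omega>"
    using M f YV by auto
  then obtain h' where h': "arr h'" "dm h' = W" "cd h' = ob X 0" "S1 h' = f (Suc n)"
    using S1_surj[OF h(1-3)] W(1) D(2) by blast
  have "S1 (df X 0 \<bullet> h') = S1 g"
  proof -
    have eq: "signed (odd n) (S1 (df X 0)) \<bullet> S1 h' = S1 g \<bullet> signed (odd n) (Id C (S0 W))"
      using h(4) by (simp only: YV h'(4))
    have ty: "arr (S1 g)" "dm (S1 g) = S0 W" "arr (S1 h')" "cd (S1 h') = S0 (ob X 0)"
      "S1 (df X 0 \<bullet> h') = S1 (df X 0) \<bullet> S1 h'"
      using g(1) h'(1-3) by simp_all
    show ?thesis
    proof (cases "odd n")
      case True
      then have "ng (S1 (df X 0) \<bullet> S1 h') = ng (S1 g)"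
        using eq ty by (simp add: signed_def)
      then show ?thesis using ng_eq_iff ty by simp
    next
      case False
      then show ?thesis using eq ty by (simp add: signed_def)
    qed
  qed
  then have "df X 0 \<bullet> h' = g" using h' g by - (rule S1_inj, simp_all)
  then show ?thesis using h' by auto
qed

lemma window_pair:
  assumes X: "(X, \<delta>) \<in> \<Theta>" and k: "k \<le> n + 2"
  shows "(\<lparr>ob = \<lambda>i. ext_ob (X, \<delta>) (i + k), df = \<lambda>i. ext_df (X, \<delta>) (i + k)\<rparr>, ext_df (X, \<delta>) (n + 1 + k)) \<in> \<Theta>"
  using window_angle[OF angle_seq[OF X] k] X by (simp add: window_def)

text \<open>
  The statements at the remaining places follow from those at the first place by rotation.
\<close>

lemma angle_zero:
  assumes "(X, \<delta>) \<in> \<Theta>"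
  shows "i < n \<Longrightarrow> df X (Suc i) \<bullet> df X i = zmor C (ob X i) (ob X (Suc (Suc i)))"
    and "\<delta> \<bullet> df X n = zmor C (ob X n) (S0 (ob X 0))"
    and "S1 (df X 0) \<bullet> \<delta> = zmor C (ob X (Suc n)) (S0 (ob X 1))"
proof -
  note D [simp] = angleD[OF assms]
  have *: "i \<le> n + 2 \<Longrightarrow> ext_df (X, \<delta>) (Suc i) \<bullet> ext_df (X, \<delta>) i
      = zmor C (ext_ob (X, \<delta>) i) (ext_ob (X, \<delta>) (Suc (Suc i)))" for i
    using angle_zero_0[OF window_pair[OF assms, of i]] by simp
  show "i < n \<Longrightarrow> df X (Suc i) \<bullet> df X i = zmor C (ob X i) (ob X (Suc (Suc i)))"
    using *[of i] by (simp add: ext_ob_simps ext_df_simps)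
  show "\<delta> \<bullet> df X n = zmor C (ob X n) (S0 (ob X 0))"
    using *[of n] ext_ob_simps(2)[of X \<delta> 0] ext_df_simps(2)[of X \<delta>]
    by (simp add: ext_ob_simps(1) ext_df_simps(1))
  have 1: "ob X 1 \<in> Ob C" by simp
  show "S1 (df X 0) \<bullet> \<delta> = zmor C (ob X (Suc n)) (S0 (ob X 1))"
    using *[of "Suc n"] ext_ob_simps(2)[of X \<delta> 1] ext_df_simps(2)[of X \<delta>] ext_df_simps(3)[of 0 X \<delta>] 1
      ng_eq_iff[of "S1 (df X 0) \<bullet> \<delta>" "zmor C (ob X (Suc n)) (S0 (ob X 1))"]
    by (simp add: ext_ob_simps(1) signed_def split: if_splits)
qed

lemma angle_right_exact:
  assumes X: "(X, \<delta>) \<in> \<Theta>" and g: "arr g"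
  shows "\<lbrakk>i < n; dm g = ob X (Suc i); g \<bullet> df X i = zmor C (ob X i) (cd g)\<rbrakk>
      \<Longrightarrow> \<exists>h. arr h \<and> dm h = ob X (Suc (Suc i)) \<and> cd h = cd g \<and> g = h \<bullet> df X (Suc i)"
    and "\<lbrakk>dm g = ob X (Suc n); g \<bullet> df X n = zmor C (ob X n) (cd g)\<rbrakk>
      \<Longrightarrow> \<exists>h. arr h \<and> dm h = S0 (ob X 0) \<and> cd h = cd g \<and> g = h \<bullet> \<delta>"
    and "\<lbrakk>dm g = ob X 0; S1 g \<bullet> \<delta> = zmor C (ob X (Suc n)) (S0 (cd g))\<rbrakk>
      \<Longrightarrow> \<exists>h. arr h \<and> dm h = ob X 1 \<and> cd h = cd g \<and> g = h \<bullet> df X 0"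
proof -
  note D [simp] = angleD[OF X]
  have *: "\<exists>h. arr h \<and> dm h = ext_ob (X, \<delta>) (Suc (Suc i)) \<and> cd h = cd g \<and> g = h \<bullet> ext_df (X, \<delta>) (Suc i)"
    if "i \<le> n + 2" "arr g" "dm g = ext_ob (X, \<delta>) (Suc i)"
      "g \<bullet> ext_df (X, \<delta>) i = zmor C (ext_ob (X, \<delta>) i) (cd g)" for i g
    using right_exact_0[OF window_pair[OF X, of i], of g] that by simp
  show "\<exists>h. arr h \<and> dm h = ob X (Suc (Suc i)) \<and> cd h = cd g \<and> g = h \<bullet> df X (Suc i)"
    if "i < n" "dm g = ob X (Suc i)" "g \<bullet> df X i = zmor C (ob X i) (cd g)"
    using *[of i g] that g by (simp add: ext_ob_simps ext_df_simps)
  show "\<exists>h. arr h \<and> dm h = S0 (ob X 0) \<and> cd h = cd g \<and> g = h \<bullet> \<delta>"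
    if "dm g = ob X (Suc n)" "g \<bullet> df X n = zmor C (ob X n) (cd g)"
    using *[of n g] that g ext_ob_simps(2)[of X \<delta> 0] ext_df_simps(2)[of X \<delta>]
    by (simp add: ext_ob_simps(1) ext_df_simps(1))
  show "\<exists>h. arr h \<and> dm h = ob X 1 \<and> cd h = cd g \<and> g = h \<bullet> df X 0"
    if "dm g = ob X 0" "S1 g \<bullet> \<delta> = zmor C (ob X (Suc n)) (S0 (cd g))"
  proof -
    have "\<exists>h. arr h \<and> dm h = S0 (ob X 1) \<and> cd h = S0 (cd g) \<and>
        S1 g = h \<bullet> signed (odd n) (S1 (df X 0))"
      using *[of "Suc n" "S1 g"] that g ext_ob_simps(2)[of X \<delta> 0] ext_ob_simps(2)[of X \<delta> 1]
        ext_df_simps(2)[of X \<delta>] ext_df_simps(3)[of 0 X \<delta>]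
      by (simp add: ext_ob_simps(1))
    then obtain h where h: "arr h" "dm h = S0 (ob X 1)" "cd h = S0 (cd g)"
        "S1 g = h \<bullet> signed (odd n) (S1 (df X 0))" by blast
    have 1: "ob X 1 \<in> Ob C" by simp
    obtain k where k: "arr k" "dm k = ob X 1" "cd k = cd g" "S1 k = h"
      using S1_surj[OF h(1-3)] g 1 by auto
    have "S1 g = S1 (signed (odd n) k \<bullet> df X 0)" using k(1,2) h by (simp add: signed_def k(4))
    then have "g = signed (odd n) k \<bullet> df X 0" using k that g by - (rule S1_inj, simp_all)
    then show ?thesis using k by (intro exI[of _ "signed (odd n) k"]) simp
  qed
qed

lemma angle_left_exact:
  assumes X: "(X, \<delta>) \<in> \<Theta>" and g: "arr g"
  shows "\<lbrakk>i < n; cd g = ob X (Suc i); df X (Suc i) \<bullet> g = zmor C (dm g) (ob X (Suc (Suc i)))\<rbrakk>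
      \<Longrightarrow> \<exists>h. arr h \<and> cd h = ob X i \<and> dm h = dm g \<and> g = df X i \<bullet> h"
    and "\<lbrakk>cd g = ob X (Suc n); \<delta> \<bullet> g = zmor C (dm g) (S0 (ob X 0))\<rbrakk>
      \<Longrightarrow> \<exists>h. arr h \<and> cd h = ob X n \<and> dm h = dm g \<and> g = df X n \<bullet> h"
proof -
  note D [simp] = angleD[OF X]
  have *: "\<exists>h. arr h \<and> cd h = ext_ob (X, \<delta>) i \<and> dm h = dm g \<and> g = ext_df (X, \<delta>) i \<bullet> h"
    if "i \<le> n + 2" "cd g = ext_ob (X, \<delta>) (Suc i)"
      "ext_df (X, \<delta>) (Suc i) \<bullet> g = zmor C (dm g) (ext_ob (X, \<delta>) (Suc (Suc i)))" for i
    using left_exact_0[OF window_pair[OF X, of i], of g] that g by simp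
  show "\<exists>h. arr h \<and> cd h = ob X i \<and> dm h = dm g \<and> g = df X i \<bullet> h"
    if "i < n" "cd g = ob X (Suc i)" "df X (Suc i) \<bullet> g = zmor C (dm g) (ob X (Suc (Suc i)))"
    using *[of i] that by (simp add: ext_ob_simps ext_df_simps)
  show "\<exists>h. arr h \<and> cd h = ob X n \<and> dm h = dm g \<and> g = df X n \<bullet> h"
    if "cd g = ob X (Suc n)" "\<delta> \<bullet> g = zmor C (dm g) (S0 (ob X 0))"
    using *[of n] that ext_ob_simps(2)[of X \<delta> 0] ext_df_simps(2)[of X \<delta>]
    by (simp add: ext_ob_simps(1) ext_df_simps(1))
qed

section \<open>Desuspension and lifting of end morphisms\<close>

definition S0inv :: "'o \<Rightarrow> 'o" where "S0inv = inv_into (Ob C) S0"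

lemma S0inv [simp]: "A \<in> Ob C \<Longrightarrow> S0inv A \<in> Ob C" "A \<in> Ob C \<Longrightarrow> S0 (S0inv A) = A"
    "A \<in> Ob C \<Longrightarrow> S0inv (S0 A) = A"
proof -
  have im: "S0 ` Ob C = Ob C" and inj: "inj_on S0 (Ob C)"
    using S0_bij by (simp_all add: bij_betw_def)
  show "A \<in> Ob C \<Longrightarrow> S0inv A \<in> Ob C" unfolding S0inv_def by (rule inv_into_into) (simp add: im)
  show "A \<in> Ob C \<Longrightarrow> S0 (S0inv A) = A" unfolding S0inv_def by (rule f_inv_into_f) (simp add: im)
  show "A \<in> Ob C \<Longrightarrow> S0inv (S0 A) = A" unfolding S0inv_def by (rule inv_into_f_f[OF inj])
qed

definition S1inv :: "'m \<Rightarrow> 'm" where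
  "S1inv g = (SOME f. arr f \<and> dm f = S0inv (dm g) \<and> cd f = S0inv (cd g) \<and> S1 f = g)"

lemma S1inv [simp]:
  assumes "arr g"
  shows "arr (S1inv g)" "dm (S1inv g) = S0inv (dm g)" "cd (S1inv g) = S0inv (cd g)" "S1 (S1inv g) = g"
proof -
  have "\<exists>f. arr f \<and> dm f = S0inv (dm g) \<and> cd f = S0inv (cd g) \<and> S1 f = g"
    by (rule S1_surj) (simp_all add: assms)
  from someI_ex[OF this] show "arr (S1inv g)" "dm (S1inv g) = S0inv (dm g)"
    "cd (S1inv g) = S0inv (cd g)" "S1 (S1inv g) = g"
    unfolding S1inv_def by blast+
qed

text \<open>
  Every angle is isomorphic to a shifted one, because \<open>\<Sigma>\<close> is invertible: objects and maps are
  desuspended one by one.  Thus a given morphism can be made the last morphism of an angle, and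
  also its \<open>n\<close>-th differential.
\<close>

lemma unshift:
  assumes Y: "(Y, \<epsilon>) \<in> \<Theta>"
  shows "\<exists>X. (X, df Y 0) \<in> \<Theta> \<and> ob X 0 = S0inv (ob Y 1) \<and> ob X (Suc n) = ob Y 0 \<and> df X n = S1inv \<epsilon>"
proof -
  note D [simp] = angleD[OF Y]
  have O1: "ob Y (Suc 0) \<in> Ob C" by simp
  define X where "X = \<lparr>ob = (\<lambda>i. if i \<le> n then S0inv (ob Y (Suc i)) else ob Y 0),
    df = (\<lambda>i. if i < n then S1inv (df Y (Suc i)) else S1inv \<epsilon>)\<rparr>"
  have X0: "ob X 0 = S0inv (ob Y 1)" "ob X (Suc n) = ob Y 0" "df X n = S1inv \<epsilon>"
    by (simp_all add: X_def)
  have s: "sigma_seq C n S (X, df Y 0)"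
    unfolding sigma_seq_iff
  proof (intro conjI allI impI)
    fix i assume i: "i \<le> n"
    then consider "i < n" | "i = n" by linarith
    then show "dm (df X i) = ob X i" "cd (df X i) = ob X (Suc i)"
      by cases (simp_all add: X_def)
  qed (use O1 in \<open>simp_all add: X_def\<close>)
  obtain Z \<rho> where Z: "shift (X, df Y 0) = (Z, \<rho>)" by (cases "shift (X, df Y 0)")
  have \<rho>: "\<rho> = \<epsilon>" using Z by (auto simp: shift_def X_def)
  have "ob Z i = ob Y i" if "i \<le> Suc n" for i
    using that Z by (cases i) (auto simp: shift_def X_def)
  moreover have "df Z i = df Y i" if "i \<le> n" for i
    using that Z by (cases i) (auto simp: shift_def X_def)
  ultimately have "(Z, \<epsilon>) \<in> \<Theta>" using angle_cong[OF angle_seq[OF Y], of Z] Y by blast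
  then have "(X, df Y 0) \<in> \<Theta>" using shift_angle_iff[OF s] by (simp add: Z \<rho>)
  then show ?thesis using X0 by blast
qed

text \<open>
  Every extension is realized: complete \<open>\<delta>\<close> as a first morphism to an angle and desuspend.
\<close>

lemma angle_with_last:
  assumes \<delta>: "arr \<delta>" "cd \<delta> = S0 A" "A \<in> Ob C"
  shows "\<exists>X. (X, \<delta>) \<in> \<Theta> \<and> ob X 0 = A \<and> ob X (Suc n) = dm \<delta>"
proof -
  obtain Y \<epsilon> where Y: "(Y, \<epsilon>) \<in> \<Theta>" "ob Y 0 = dm \<delta>" "ob Y 1 = S0 A" "df Y 0 = \<delta>"
    using F1_first[of "dm \<delta>" "S0 A" \<delta>] \<delta> by auto
  with unshift[OF Y(1)] \<delta>(3) show ?thesis by auto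
qed

text \<open>
  The mapping cone of a morphism between shifted sequences, written out in terms of the original
  ones.  Its objects are \<open>\<Sigma>X\<^sup>0 \<oplus> Y\<^sup>n\<^sup>+\<^sup>1\<close> and \<open>\<Sigma>X\<^sup>i \<oplus> \<Sigma>Y\<^sup>i\<^sup>-\<^sup>1\<close> for \<open>1 \<le> i \<le> n + 1\<close>.
\<close>

definition lift_cone :: "('o, 'm) seq \<Rightarrow> 'm \<Rightarrow> ('o, 'm) seq \<Rightarrow> 'm \<Rightarrow> (nat \<Rightarrow> 'm) \<Rightarrow> ('o, 'm) seq \<times> 'm" where
  "lift_cone X \<delta> Y \<rho> f =
    (\<lparr>ob = (\<lambda>i. bsum C (S0 (ob X i)) (if i = 0 then ob Y (Suc n) else S0 (ob Y (i - 1)))),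
      df = (\<lambda>i. if i = 0
        then mat C (S0 (ob X 0)) (ob Y (Suc n)) (S0 (ob X 1)) (S0 (ob Y 0))
          (ng (S1 (df X 0))) (zmor C (ob Y (Suc n)) (S0 (ob X 1))) (S1 (f 0)) \<rho>
        else mat C (S0 (ob X i)) (S0 (ob Y (i - 1))) (S0 (ob X (Suc i))) (S0 (ob Y i))
          (ng (S1 (df X i))) (zmor C (S0 (ob Y (i - 1))) (S0 (ob X (Suc i))))
          (S1 (f i)) (S1 (df Y (i - 1))))\<rparr>,
      S1 (in1 C (S0 (ob X 0)) (ob Y (Suc n))) \<bullet> ng (S1 \<delta>) \<bullet> pr1 C (S0 (ob X (Suc n))) (S0 (ob Y n)) \<oplus>
      S1 (in2 C (S0 (ob X 0)) (ob Y (Suc n))) \<bullet>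
        (S1 (f (Suc n)) \<bullet> pr1 C (S0 (ob X (Suc n))) (S0 (ob Y n)) \<oplus>
         S1 (df Y n) \<bullet> pr2 C (S0 (ob X (Suc n))) (S0 (ob Y n))))"

text \<open>
  A morphism of extensions \<open>(a, c)\<close> is a commutative square on the first maps \<open>\<delta>\<close> and \<open>\<rho>\<close> of the
  shifted angles.  Applying (F4) to it and desuspending gives a lift with prescribed components
  at both ends whose cone is still an angle.
\<close>

lemma lift_ends_with_cone:
  assumes X: "(X, \<delta>) \<in> \<Theta>" and Y: "(Y, \<rho>) \<in> \<Theta>"
    and a: "arr a" "dm a = ob X 0" "cd a = ob Y 0"
    and c: "arr c" "dm c = ob X (Suc n)" "cd c = ob Y (Suc n)"
    and ac: "S1 a \<bullet> \<delta> = \<rho> \<bullet> c"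
  shows "\<exists>f. sigma_map C n S (X, \<delta>) (Y, \<rho>) f \<and> f 0 = a \<and> f (Suc n) = c \<and> lift_cone X \<delta> Y \<rho> f \<in> \<Theta>"
proof -
  note DX [simp] = angleD[OF X] and DY [simp] = angleD[OF Y]
  note sX = angle_seq[OF X] and sY = angle_seq[OF Y]
  obtain X' \<delta>' where X': "shift (X, \<delta>) = (X', \<delta>')" by (cases "shift (X, \<delta>)")
  obtain Y' \<rho>' where Y': "shift (Y, \<rho>) = (Y', \<rho>')" by (cases "shift (Y, \<rho>)")
  have X'\<Theta>: "(X', \<delta>') \<in> \<Theta>" and Y'\<Theta>: "(Y', \<rho>') \<in> \<Theta>"
    using shift_angle_iff[OF sX] shift_angle_iff[OF sY] X Y by (simp_all add: X' Y')
  have eX: "ob X' 0 = ob X (Suc n)" "df X' 0 = \<delta>" "\<delta>' = S1 (df X n)"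
      "ob X' (Suc i) = S0 (ob X i)" "df X' (Suc i) = S1 (df X i)" for i
    using X' by (auto simp: shift_def)
  have eY: "ob Y' 0 = ob Y (Suc n)" "df Y' 0 = \<rho>" "\<rho>' = S1 (df Y n)"
      "ob Y' (Suc i) = S0 (ob Y i)" "df Y' (Suc i) = S1 (df Y i)" for i
    using Y' by (auto simp: shift_def)
  obtain f' where f': "sigma_map C n S (X', \<delta>') (Y', \<rho>') f'" "f' 0 = c" "f' 1 = S1 a"
      "sigma_cone C n S (X', \<delta>') (Y', \<rho>') f' \<in> \<Theta>"
    using F4[OF X'\<Theta> Y'\<Theta>, of c "S1 a"] a c ac by (auto simp: eX eY)
  note M = f'(1)[unfolded sigma_map_iff[OF angle_seq[OF X'\<Theta>] angle_seq[OF Y'\<Theta>]]]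
  have M1: "arr (f' (Suc i))" "dm (f' (Suc i)) = S0 (ob X i)" "cd (f' (Suc i)) = S0 (ob Y i)"
    if "i \<le> n" for i using M that by (simp_all add: eX eY)
  define f where "f = (\<lambda>i. if i \<le> n then S1inv (f' (Suc i)) else c)"
  have f: "arr (f i)" "dm (f i) = ob X i" "cd (f i) = ob Y i" "S1 (f i) = f' (Suc i)"
    if "i \<le> n" for i using that M1[OF that] by (simp_all add: f_def)
  have fS: "f (Suc n) = c" by (simp add: f_def)
  have f0: "f 0 = a" using f[of 0] f'(3) a by - (rule S1_inj, simp_all)
  have comm: "df Y i \<bullet> f i = f (Suc i) \<bullet> df X i" if i: "i \<le> n" for i
  proof (cases "i = n")
    case True
    have "S1 (df Y n \<bullet> f n) = S1 (f (Suc n) \<bullet> df X n)"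
      using M f[of n] c f'(2) by (simp add: eX eY fS)
    then show ?thesis using True f[of n] c fS by - (rule S1_inj, simp_all)
  next
    case False
    then have i: "i < n" "i \<le> n" "Suc i \<le> n" using i by simp_all
    have "df Y' (Suc i) \<bullet> f' (Suc i) = f' (Suc (Suc i)) \<bullet> df X' (Suc i)" using M i by blast
    then have "S1 (df Y i \<bullet> f i) = S1 (f (Suc i) \<bullet> df X i)"
      using f[of i] f[of "Suc i"] i by (simp add: eX eY)
    then show ?thesis using f[of i] f[of "Suc i"] i by - (rule S1_inj, simp_all)
  qed
  have fm: "sigma_map C n S (X, \<delta>) (Y, \<rho>) f"
    unfolding sigma_map_iff[OF sX sY]
    using f f0 fS comm c ac by (auto simp: le_Suc_eq)
  obtain K \<kappa> where K: "sigma_cone C n S (X', \<delta>') (Y', \<rho>') f' = (K, \<kappa>)" by force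
  obtain L \<mu> where L: "lift_cone X \<delta> Y \<rho> f = (L, \<mu>)" by force
  have K\<Theta>: "(K, \<kappa>) \<in> \<Theta>" using f'(4) K by simp
  have obs: "ob L i = ob K i" if "i \<le> Suc n" for i
    using that K L by (cases i; cases "i = Suc n") (auto simp: lift_cone_def sigma_cone_def Let_def eX eY)
  have LS: "df L (Suc j) = mat C (S0 (ob X (Suc j))) (S0 (ob Y j)) (S0 (ob X (Suc (Suc j)))) (S0 (ob Y (Suc j)))
      (ng (S1 (df X (Suc j)))) (zmor C (S0 (ob Y j)) (S0 (ob X (Suc (Suc j)))))
      (S1 (f (Suc j))) (S1 (df Y j))" for j
    using L by (auto simp: lift_cone_def)
  have dfs: "df L i = df K i" if "i \<le> n" for i
  proof (cases i)
    case 0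
    then show ?thesis using K L f[of 0] n_ge_1
      by (auto simp: lift_cone_def sigma_cone_def Let_def eX eY f'(2) inv_ng)
  next
    case (Suc j)
    then show ?thesis using that K LS[of j] f[of i]
      by (cases "i = n") (auto simp: sigma_cone_def Let_def eX eY inv_ng)
  qed
  have ob1: "ob X 0 \<in> Ob C" "ob X (Suc n) \<in> Ob C" "ob Y n \<in> Ob C" "ob Y (Suc n) \<in> Ob C" by simp_all
  have last: "\<mu> = \<kappa>"
  proof -
    have "\<kappa> = sigma_sum_iso C S (S0 (ob X 0)) (ob Y (Suc n)) \<bullet>
       mat C (S0 (ob X (Suc n))) (S0 (ob Y n)) (S0 (S0 (ob X 0))) (S0 (ob Y (Suc n)))
         (neg C (S0 (ob X (Suc n))) (S0 (S0 (ob X 0))) (S1 \<delta>))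
         (zmor C (S0 (ob Y n)) (S0 (S0 (ob X 0))))
         (S1 c) (S1 (df Y n))"
      using K by (simp add: sigma_cone_def Let_def eX eY f'(2))
    then show ?thesis using L c ob1 unfolding sigma_sum_iso_def
      by (simp add: lift_cone_def fS inv_ng mats)
  qed
  have "(L, \<mu>) \<in> \<Theta>" using angle_cong[OF angle_seq[OF K\<Theta>], of L] obs dfs K\<Theta> last by blast
  then show ?thesis using fm f0 fS L by auto
qed


section \<open>Homotopy classes of angles\<close>

definition typed_seq :: "('o, 'm) seq \<Rightarrow> bool" where
  "typed_seq X \<longleftrightarrow> (\<forall>i\<le>Suc n. ob X i \<in> Ob C) \<and>
    (\<forall>i\<le>n. arr (df X i) \<and> dm (df X i) = ob X i \<and> cd (df X i) = ob X (Suc i))"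

definition typed_map :: "('o, 'm) seq \<Rightarrow> ('o, 'm) seq \<Rightarrow> (nat \<Rightarrow> 'm) \<Rightarrow> bool" where
  "typed_map X Y f \<longleftrightarrow> (\<forall>i\<le>Suc n. arr (f i) \<and> dm (f i) = ob X i \<and> cd (f i) = ob Y i)"

lemma typed_seqD:
  assumes "typed_seq X"
  shows "i \<le> Suc n \<Longrightarrow> ob X i \<in> Ob C" "ob X 0 \<in> Ob C"
    "i \<le> n \<Longrightarrow> arr (df X i)" "i \<le> n \<Longrightarrow> dm (df X i) = ob X i"
    "i \<le> n \<Longrightarrow> cd (df X i) = ob X (Suc i)"
  using assms by (simp_all add: typed_seq_def)

lemma typed_mapD:
  assumes "typed_map X Y f"
  shows "i \<le> Suc n \<Longrightarrow> arr (f i)" "i \<le> Suc n \<Longrightarrow> dm (f i) = ob X i" "i \<le> Suc n \<Longrightarrow> cd (f i) = ob Y i"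
  using assms by (simp_all add: typed_map_def)

lemma angle_typed_seq: "(X, \<delta>) \<in> \<Theta> \<Longrightarrow> typed_seq X"
  using angleD by (simp add: typed_seq_def)

lemma cplx_iff:
  "cplx C (Suc n) X \<longleftrightarrow> typed_seq X \<and> (\<forall>i<n. df X (Suc i) \<bullet> df X i = zmor C (ob X i) (ob X (Suc (Suc i))))"
  by (auto simp: cplx_def typed_seq_def less_Suc_eq_le)

lemma angle_cplx: "(X, \<delta>) \<in> \<Theta> \<Longrightarrow> cplx C (Suc n) X"
  using angle_typed_seq angle_zero(1) by (simp add: cplx_iff)

lemma chain_map_iff:
  assumes "typed_seq X" "typed_seq Y"
  shows "chain_map C (Suc n) X Y f \<longleftrightarrow> typed_map X Y f \<and> (\<forall>i\<le>n. df Y i \<bullet> f i = f (Suc i) \<bullet> df X i)"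
  using assms by (auto simp: chain_map_def typed_map_def typed_seq_def less_Suc_eq_le)

lemma homotopic_iff:
  assumes X: "typed_seq X" and Y: "typed_seq Y" and f: "typed_map X Y f"
  shows "homotopic C (Suc n) X Y f g \<longleftrightarrow>
    (\<exists>h. (\<forall>i\<le>n. arr (h (Suc i)) \<and> dm (h (Suc i)) = ob X (Suc i) \<and> cd (h (Suc i)) = ob Y i) \<and>
      g 0 = f 0 \<oplus> h (Suc 0) \<bullet> df X 0 \<and>
      (\<forall>i<n. g (Suc i) = f (Suc i) \<oplus> (df Y i \<bullet> h (Suc i) \<oplus> h (Suc (Suc i)) \<bullet> df X (Suc i))) \<and>
      g (Suc n) = f (Suc n) \<oplus> df Y n \<bullet> h (Suc n))"
proof -
  note D [simp] = typed_seqD[OF X] typed_seqD[OF Y] typed_mapD[OF f]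
  have *: "((\<forall>i. 0 < i \<and> i \<le> Suc n \<longrightarrow> h i \<in> mor C (ob X i) (ob Y (i - 1))) \<and>
      g 0 = f 0 \<otimes>\<^bsub>Hom C (ob X 0) (ob Y 0)\<^esub> (h 1 \<bullet> df X 0) \<and>
      (\<forall>i. 0 < i \<and> i < Suc n \<longrightarrow>
        g i = f i \<otimes>\<^bsub>Hom C (ob X i) (ob Y i)\<^esub>
          ((df Y (i - 1) \<bullet> h i) \<otimes>\<^bsub>Hom C (ob X i) (ob Y i)\<^esub> (h (i + 1) \<bullet> df X i))) \<and>
      g (Suc n) = f (Suc n) \<otimes>\<^bsub>Hom C (ob X (Suc n)) (ob Y (Suc n))\<^esub> (df Y (Suc n - 1) \<bullet> h (Suc n))) \<longleftrightarrow>
    ((\<forall>i\<le>n. arr (h (Suc i)) \<and> dm (h (Suc i)) = ob X (Suc i) \<and> cd (h (Suc i)) = ob Y i) \<and>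
      g 0 = f 0 \<oplus> h (Suc 0) \<bullet> df X 0 \<and>
      (\<forall>i<n. g (Suc i) = f (Suc i) \<oplus> (df Y i \<bullet> h (Suc i) \<oplus> h (Suc (Suc i)) \<bullet> df X (Suc i))) \<and>
      g (Suc n) = f (Suc n) \<oplus> df Y n \<bullet> h (Suc n))" for h
  proof -
    have 1: "(\<forall>i. 0 < i \<and> i \<le> Suc n \<longrightarrow> P i) \<longleftrightarrow> (\<forall>i\<le>n. P (Suc i))" for P
      by (metis Suc_le_mono gr0_conv_Suc zero_less_Suc)
    have 2: "(\<forall>i. 0 < i \<and> i < Suc n \<longrightarrow> P i) \<longleftrightarrow> (\<forall>i<n. P (Suc i))" for P
      by (metis Suc_less_eq gr0_conv_Suc zero_less_Suc)
    show ?thesis unfolding 1 2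
      by (intro conj_cong) (simp_all add: mult_pls)
  qed
  show ?thesis unfolding homotopic_def * ..
qed

text \<open>
  A chain endomorphism that vanishes in degree \<open>0\<close> is contracted step by step from the left, using
  exactness of the contravariant Hom-functors along the angle.  The construction gives no control in degree
  \<open>n + 1\<close>: there \<open>d\<^sup>n h\<^sup>n\<^sup>+\<^sup>1\<close> need not equal the given component.
\<close>

lemma null_homotopy:
  assumes X: "(X, \<delta>) \<in> \<Theta>" and f: "typed_map X X f"
    and comm: "\<And>i. i \<le> n \<Longrightarrow> df X i \<bullet> f i = f (Suc i) \<bullet> df X i"
    and f0: "f 0 = zmor C (ob X 0) (ob X 0)"
  shows "k \<le> n \<Longrightarrow> \<exists>h. h (Suc 0) = zmor C (ob X 1) (ob X 0) \<and>
    (\<forall>i\<le>k. arr (h (Suc i)) \<and> dm (h (Suc i)) = ob X (Suc i) \<and> cd (h (Suc i)) = ob X i) \<and>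
    (\<forall>i<k. f (Suc i) = df X i \<bullet> h (Suc i) \<oplus> h (Suc (Suc i)) \<bullet> df X (Suc i))"
proof (induction k)
  case 0
  then show ?case using angleD[OF X] by (intro exI[of _ "\<lambda>_. zmor C (ob X 1) (ob X 0)"]) simp
next
  case (Suc k)
  note D [simp] = angleD[OF X] and F [simp] = typed_mapD[OF f]
  from Suc obtain h where h0: "h (Suc 0) = zmor C (ob X 1) (ob X 0)"
    and h [simp]: "\<And>i. i \<le> k \<Longrightarrow> arr (h (Suc i))" "\<And>i. i \<le> k \<Longrightarrow> dm (h (Suc i)) = ob X (Suc i)"
      "\<And>i. i \<le> k \<Longrightarrow> cd (h (Suc i)) = ob X i"
    and hf: "\<And>i. i < k \<Longrightarrow> f (Suc i) = df X i \<bullet> h (Suc i) \<oplus> h (Suc (Suc i)) \<bullet> df X (Suc i)"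
    by (metis Suc_leD)
  have k: "k < n" "k \<le> n" using Suc.prems by simp_all
  \<comment> \<open>What remains of f in degree k + 1 after the part of the homotopy found so far; it kills the
    incoming differential and hence factors through the outgoing one.\<close>
  define u where "u = f (Suc k) \<oplus> ng (df X k \<bullet> h (Suc k))"
  have u: "arr u" "dm u = ob X (Suc k)" "cd u = ob X (Suc k)" using k by (simp_all add: u_def)
  have ud: "u \<bullet> df X k = df X k \<bullet> f k \<oplus> ng (df X k \<bullet> h (Suc k) \<bullet> df X k)"
    using k by (simp add: u_def comm)
  have "df X k \<bullet> h (Suc k) \<bullet> df X k = df X k \<bullet> f k"
  proof (cases k)
    case 0
    then show ?thesis using k by (simp add: f0 h0)
  next
    case (Suc j)
    have "df X k \<bullet> df X j \<bullet> h k = zmor C (ob X k) (ob X (Suc k))"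
      using Suc k angle_zero(1)[OF X, of j] h[of j]
      by (simp add: cmp_assoc[symmetric] del: cmp_assoc)
    then show ?thesis using Suc k hf[of j] h[of j] by simp
  qed
  then have "u \<bullet> df X k = zmor C (ob X k) (cd u)" using k u by (simp add: ud)
  with angle_right_exact(1)[OF X u(1) k(1) u(2)] u
  obtain v where v: "arr v" "dm v = ob X (Suc (Suc k))" "cd v = ob X (Suc k)" "u = v \<bullet> df X (Suc k)"
    by auto
  have fv: "f (Suc k) = df X k \<bullet> h (Suc k) \<oplus> v \<bullet> df X (Suc k)"
    using k Suc.prems v(1-3) u_def by (simp flip: v(4) add: pls_left_comm[of _ "f (Suc k)"])
  define h' where "h' = h(Suc (Suc k) := v)"
  have "h' (Suc i) = h (Suc i)" if "i \<le> k" for i using that by (simp add: h'_def)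
  moreover have "h' (Suc (Suc k)) = v" by (simp add: h'_def)
  ultimately show ?case using h0 hf fv v
    by (intro exI[of _ h']) (auto simp: le_Suc_eq less_Suc_eq)
qed

text \<open>
  Let \<open>\<phi> = 1 - e\<close>, which vanishes at both ends, and let \<open>h\<close> be a contraction of \<open>\<phi>\<close> that may be
  wrong in the last degree.  Then \<open>\<phi>h\<close> contracts \<open>\<phi>\<^sup>2\<close> in every degree, since
  \<open>d\<phi>h = \<phi>dh\<close> vanishes where \<open>\<phi>\<close> does.  The statement follows because \<open>e + \<phi>e = 1 - \<phi>\<^sup>2\<close>.
\<close>

lemma square_null_homotopic:
  assumes X: "(X, \<delta>) \<in> \<Theta>" and e: "typed_map X X e"
    and comm: "\<And>i. i \<le> n \<Longrightarrow> df X i \<bullet> e i = e (Suc i) \<bullet> df X i"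
    and e0: "e 0 = Id C (ob X 0)" and eS: "e (Suc n) = Id C (ob X (Suc n))"
  shows "homotopic C (Suc n) X X (\<lambda>i. e i \<oplus> (Id C (ob X i) \<oplus> ng (e i)) \<bullet> e i) (\<lambda>i. Id C (ob X i))"
proof -
  note D [simp] = angleD[OF X] and F [simp] = typed_mapD[OF e]
  define f where "f = (\<lambda>i. Id C (ob X i) \<oplus> ng (e i))"
  have f: "typed_map X X f" by (simp add: typed_map_def f_def)
  note Ff [simp] = typed_mapD[OF f]
  have fcomm: "df X i \<bullet> f i = f (Suc i) \<bullet> df X i" if "i \<le> n" for i
    using that comm by (simp add: f_def)
  have f0: "f 0 = zmor C (ob X 0) (ob X 0)" using pls_ng(1)[of "Id C (ob X 0)"] by (simp add: f_def e0)
  have fS: "f (Suc n) = zmor C (ob X (Suc n)) (ob X (Suc n))"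
    using pls_ng(1)[of "Id C (ob X (Suc n))"] by (simp add: f_def eS)
  obtain h where h0: "h (Suc 0) = zmor C (ob X 1) (ob X 0)"
    and h [simp]: "\<And>i. i \<le> n \<Longrightarrow> arr (h (Suc i))" "\<And>i. i \<le> n \<Longrightarrow> dm (h (Suc i)) = ob X (Suc i)"
      "\<And>i. i \<le> n \<Longrightarrow> cd (h (Suc i)) = ob X i"
    and hf: "\<And>i. i < n \<Longrightarrow> f (Suc i) = df X i \<bullet> h (Suc i) \<oplus> h (Suc (Suc i)) \<bullet> df X (Suc i)"
    using null_homotopy[OF X f fcomm f0, of n] by blast
  have sum: "e i \<oplus> f i = Id C (ob X i)" if "i \<le> Suc n" for i
    using that by (simp add: f_def pls_left_comm[of "e i"])
  have G: "typed_map X X (\<lambda>i. e i \<oplus> f i \<bullet> e i)" by (simp add: typed_map_def)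
  have all: "(e i \<oplus> f i \<bullet> e i) \<oplus> f i \<bullet> f i = Id C (ob X i)" if "i \<le> Suc n" for i
  proof -
    have "(e i \<oplus> f i \<bullet> e i) \<oplus> f i \<bullet> f i = e i \<oplus> f i \<bullet> (e i \<oplus> f i)" using that by simp
    also have "\<dots> = Id C (ob X i)" using that unfolding sum[OF that] by (simp add: sum)
    finally show ?thesis .
  qed
  show ?thesis
    unfolding f_def[symmetric] fun_cong[OF f_def, symmetric]
    unfolding homotopic_iff[OF angle_typed_seq[OF X] angle_typed_seq[OF X] G]
  proof (intro exI[of _ "\<lambda>i. f (i - 1) \<bullet> h i"] conjI allI impI)
    fix i assume i: "i < n"
    have "df X i \<bullet> f i \<bullet> h (Suc i) = f (Suc i) \<bullet> df X i \<bullet> h (Suc i)"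
      using i by (simp add: fcomm cmp_assoc[symmetric] del: cmp_assoc)
    then have "df X i \<bullet> f i \<bullet> h (Suc i) \<oplus> f (Suc i) \<bullet> h (Suc (Suc i)) \<bullet> df X (Suc i) = f (Suc i) \<bullet> f (Suc i)"
      using i by (subst (3) hf) simp_all
    then show "Id C (ob X (Suc i)) = e (Suc i) \<oplus> f (Suc i) \<bullet> e (Suc i) \<oplus>
        (df X i \<bullet> f (Suc i - 1) \<bullet> h (Suc i) \<oplus> (f (Suc (Suc i) - 1) \<bullet> h (Suc (Suc i))) \<bullet> df X (Suc i))"
      using i all[of "Suc i"] by simp
  next
    have "df X n \<bullet> f n \<bullet> h (Suc n) = zmor C (ob X (Suc n)) (ob X (Suc n))"
      by (simp add: fcomm fS cmp_assoc[symmetric] del: cmp_assoc)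
    then show "Id C (ob X (Suc n)) = e (Suc n) \<oplus> f (Suc n) \<bullet> e (Suc n) \<oplus> df X n \<bullet> f (Suc n - 1) \<bullet> h (Suc n)"
      by (simp add: fS eS)
  qed (simp_all add: f0 h0 e0)
qed

lemma homotopic_cong:
  assumes "\<And>i. i \<le> m \<Longrightarrow> f i = f' i"
  shows "homotopic C m X Y f g \<longleftrightarrow> homotopic C m X Y f' g"
  unfolding homotopic_def using assms by simp

text \<open>
  Lifting the identities of the ends in both directions gives \<open>f\<close> and \<open>g\<close>, but \<open>gf\<close> is in general
  not homotopic to the identity relative to the ends.  Replacing \<open>g\<close> by \<open>(1 + \<phi>)g\<close> with
  \<open>\<phi> = 1 - gf\<close> repairs both composites at once: they become \<open>1 - \<phi>\<^sup>2\<close> and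
  \<open>1 - \<psi>\<^sup>2\<close> with \<open>\<psi> = 1 - fg\<close>.
\<close>

lemma angles_homotopy_equivalent:
  assumes X: "(X, \<delta>) \<in> \<Theta>" and Y: "(Y, \<delta>) \<in> \<Theta>"
    and ends: "ob X 0 = ob Y 0" "ob X (Suc n) = ob Y (Suc n)"
  shows "homotopy_equivalent C (Suc n) X Y"
proof -
  note DX [simp] = angleD[OF X] and DY [simp] = angleD[OF Y]
  note tX = angle_typed_seq[OF X] and tY = angle_typed_seq[OF Y]
  have O0: "ob Y 0 \<in> Ob C" "ob Y (Suc n) \<in> Ob C" by simp_all
  obtain f where "sigma_map C n S (X, \<delta>) (Y, \<delta>) f" and f0: "f 0 = Id C (ob X 0)"
      and fS: "f (Suc n) = Id C (ob X (Suc n))"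
    using lift_ends_with_cone[OF X Y, of "Id C (ob X 0)" "Id C (ob X (Suc n))"] ends by auto
  then have f: "typed_map X Y f" and fc: "\<And>i. i \<le> n \<Longrightarrow> df Y i \<bullet> f i = f (Suc i) \<bullet> df X i"
    by (simp_all add: sigma_map_iff[OF angle_seq[OF X] angle_seq[OF Y]] typed_map_def)
  obtain g where "sigma_map C n S (Y, \<delta>) (X, \<delta>) g" and g0: "g 0 = Id C (ob X 0)"
      and gS: "g (Suc n) = Id C (ob X (Suc n))"
    using lift_ends_with_cone[OF Y X, of "Id C (ob X 0)" "Id C (ob X (Suc n))"] ends by auto
  then have g: "typed_map Y X g" and gc: "\<And>i. i \<le> n \<Longrightarrow> df X i \<bullet> g i = g (Suc i) \<bullet> df Y i"
    by (simp_all add: sigma_map_iff[OF angle_seq[OF Y] angle_seq[OF X]] typed_map_def)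
  note F [simp] = typed_mapD[OF f] and G [simp] = typed_mapD[OF g]
  define g' where "g' = (\<lambda>i. g i \<oplus> (Id C (ob X i) \<oplus> ng (g i \<bullet> f i)) \<bullet> g i)"
  have g': "typed_map Y X g'" by (simp add: typed_map_def g'_def)
  have gfc: "df X i \<bullet> g i \<bullet> f i = g (Suc i) \<bullet> f (Suc i) \<bullet> df X i" if "i \<le> n" for i
  proof -
    have "df X i \<bullet> g i \<bullet> f i = (df X i \<bullet> g i) \<bullet> f i" using that by simp
    also have "\<dots> = g (Suc i) \<bullet> df Y i \<bullet> f i" using that by (simp add: gc)
    finally show ?thesis using that by (simp add: fc)
  qed
  have fgc: "df Y i \<bullet> f i \<bullet> g i = f (Suc i) \<bullet> g (Suc i) \<bullet> df Y i" if "i \<le> n" for i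
  proof -
    have "df Y i \<bullet> f i \<bullet> g i = (df Y i \<bullet> f i) \<bullet> g i" using that by simp
    also have "\<dots> = f (Suc i) \<bullet> df X i \<bullet> g i" using that by (simp add: fc)
    finally show ?thesis using that by (simp add: gc)
  qed
  have g'c: "df X i \<bullet> g' i = g' (Suc i) \<bullet> df Y i" if "i \<le> n" for i
  proof -
    have "df X i \<bullet> g i \<bullet> f i \<bullet> g i = (df X i \<bullet> g i \<bullet> f i) \<bullet> g i" using that by simp
    also have "\<dots> = g (Suc i) \<bullet> f (Suc i) \<bullet> df X i \<bullet> g i" using that by (simp add: gfc)
    also have "\<dots> = g (Suc i) \<bullet> f (Suc i) \<bullet> g (Suc i) \<bullet> df Y i" using that by (simp add: gc)
    finally show ?thesis using that by (simp add: g'_def gc)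
  qed
  have z: "Id C (ob Y 0) \<oplus> ng (Id C (ob Y 0)) = zmor C (ob Y 0) (ob Y 0)"
    "Id C (ob Y (Suc n)) \<oplus> ng (Id C (ob Y (Suc n))) = zmor C (ob Y (Suc n)) (ob Y (Suc n))"
    using pls_ng(1)[of "Id C (ob Y 0)"] pls_ng(1)[of "Id C (ob Y (Suc n))"] O0 by simp_all
  have g'0: "g' 0 = Id C (ob Y 0)" and g'S: "g' (Suc n) = Id C (ob Y (Suc n))"
    using O0 by (simp_all add: g'_def g0 gS f0 fS ends z)
  have 1: "homotopic C (Suc n) X X (\<lambda>i. g' i \<bullet> f i) (\<lambda>i. Id C (ob X i))"
  proof -
    have "homotopic C (Suc n) X X
      (\<lambda>i. (g i \<bullet> f i) \<oplus> (Id C (ob X i) \<oplus> ng (g i \<bullet> f i)) \<bullet> (g i \<bullet> f i)) (\<lambda>i. Id C (ob X i))"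
      by (rule square_null_homotopic[OF X])
        (use O0 in \<open>simp_all add: typed_map_def gfc f0 g0 fS gS ends\<close>)
    then show ?thesis
      by (subst homotopic_cong[of "Suc n" _ "\<lambda>i. (g i \<bullet> f i) \<oplus> (Id C (ob X i) \<oplus> ng (g i \<bullet> f i)) \<bullet> (g i \<bullet> f i)"])
        (simp_all add: g'_def)
  qed
  have 2: "homotopic C (Suc n) Y Y (\<lambda>i. f i \<bullet> g' i) (\<lambda>i. Id C (ob Y i))"
  proof -
    have "homotopic C (Suc n) Y Y
      (\<lambda>i. (f i \<bullet> g i) \<oplus> (Id C (ob Y i) \<oplus> ng (f i \<bullet> g i)) \<bullet> (f i \<bullet> g i)) (\<lambda>i. Id C (ob Y i))"
      by (rule square_null_homotopic[OF Y])
        (use O0 in \<open>simp_all add: typed_map_def fgc f0 g0 fS gS ends\<close>)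
    then show ?thesis
      by (subst homotopic_cong[of "Suc n" _ "\<lambda>i. (f i \<bullet> g i) \<oplus> (Id C (ob Y i) \<oplus> ng (f i \<bullet> g i)) \<bullet> (f i \<bullet> g i)"])
        (simp_all add: g'_def)
  qed
  have "end_fixing_map C (Suc n) X Y f"
    using f fc f0 fS ends by (simp add: end_fixing_map_def chain_map_iff[OF tX tY])
  moreover have "end_fixing_map C (Suc n) Y X g'"
    using g' g'c g'0 g'S ends by (simp add: end_fixing_map_def chain_map_iff[OF tY tX])
  ultimately show ?thesis using 1 2 unfolding homotopy_equivalent_def by blast
qed

text \<open>
  The endomorphisms of a sequence that factor through an angle are closed under sums; as \<open>\<Theta>\<close> is
  closed under direct summands, a sequence is an angle once its identity is such a sum.
\<close>

definition factors_through_angle :: "('o, 'm) seq \<Rightarrow> 'm \<Rightarrow> (nat \<Rightarrow> 'm) \<Rightarrow> bool" where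
  "factors_through_angle Y \<delta> \<phi> \<longleftrightarrow> (\<exists>U \<epsilon> p q. (U, \<epsilon>) \<in> \<Theta> \<and> sigma_map C n S (Y, \<delta>) (U, \<epsilon>) p \<and>
    sigma_map C n S (U, \<epsilon>) (Y, \<delta>) q \<and> (\<forall>i\<le>Suc n. q i \<bullet> p i = \<phi> i))"

lemma factors_sum:
  assumes Y: "sigma_seq C n S (Y, \<delta>)" and "factors_through_angle Y \<delta> \<phi>" "factors_through_angle Y \<delta> \<psi>"
  shows "factors_through_angle Y \<delta> (\<lambda>i. \<phi> i \<oplus> \<psi> i)"
proof -
  note DY [simp] = sigma_seqD[OF Y]
  obtain U \<epsilon> p q where U: "(U, \<epsilon>) \<in> \<Theta>" and p: "sigma_map C n S (Y, \<delta>) (U, \<epsilon>) p"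
    and q: "sigma_map C n S (U, \<epsilon>) (Y, \<delta>) q" and qp: "\<And>i. i \<le> Suc n \<Longrightarrow> q i \<bullet> p i = \<phi> i"
    using assms unfolding factors_through_angle_def by blast
  obtain U' \<epsilon>' p' q' where U': "(U', \<epsilon>') \<in> \<Theta>" and p': "sigma_map C n S (Y, \<delta>) (U', \<epsilon>') p'"
    and q': "sigma_map C n S (U', \<epsilon>') (Y, \<delta>) q'" and qp': "\<And>i. i \<le> Suc n \<Longrightarrow> q' i \<bullet> p' i = \<psi> i"
    using assms unfolding factors_through_angle_def by blast
  note DU [simp] = angleD[OF U] and DU' [simp] = angleD[OF U']
  note sU = angle_seq[OF U] and sU' = angle_seq[OF U']
  note P = p[unfolded sigma_map_iff[OF Y sU]] and Q = q[unfolded sigma_map_iff[OF sU Y]]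
  note P' = p'[unfolded sigma_map_iff[OF Y sU']] and Q' = q'[unfolded sigma_map_iff[OF sU' Y]]
  have typs [simp]: "i \<le> Suc n \<Longrightarrow> arr (p i)" "i \<le> Suc n \<Longrightarrow> dm (p i) = ob Y i" "i \<le> Suc n \<Longrightarrow> cd (p i) = ob U i"
    "i \<le> Suc n \<Longrightarrow> arr (q i)" "i \<le> Suc n \<Longrightarrow> dm (q i) = ob U i" "i \<le> Suc n \<Longrightarrow> cd (q i) = ob Y i"
    "i \<le> Suc n \<Longrightarrow> arr (p' i)" "i \<le> Suc n \<Longrightarrow> dm (p' i) = ob Y i" "i \<le> Suc n \<Longrightarrow> cd (p' i) = ob U' i"
    "i \<le> Suc n \<Longrightarrow> arr (q' i)" "i \<le> Suc n \<Longrightarrow> dm (q' i) = ob U' i" "i \<le> Suc n \<Longrightarrow> cd (q' i) = ob Y i" for i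
    using P Q P' Q' by simp_all
  define V \<omega> where "V = seq_sum C U U'" and
    "\<omega> = sigma_sum_iso C S (ob U 0) (ob U' 0) \<bullet> mat C (ob U (Suc n)) (ob U' (Suc n)) (S0 (ob U 0)) (S0 (ob U' 0))
      \<epsilon> (zmor C (ob U' (Suc n)) (S0 (ob U 0))) (zmor C (ob U (Suc n)) (S0 (ob U' 0))) \<epsilon>'"
  have V: "(V, \<omega>) \<in> \<Theta>" using F1_sum[OF U U'] by (simp add: sigma_sum_def V_def \<omega>_def)
  have \<omega>: "\<omega> = S1 (in1 C (ob U 0) (ob U' 0)) \<bullet> \<epsilon> \<bullet> pr1 C (ob U (Suc n)) (ob U' (Suc n)) \<oplus>
      S1 (in2 C (ob U 0) (ob U' 0)) \<bullet> \<epsilon>' \<bullet> pr2 C (ob U (Suc n)) (ob U' (Suc n))"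
    by (simp add: \<omega>_def sigma_sum_iso_def mats)
  have obV: "ob V i = bsum C (ob U i) (ob U' i)" for i by (simp add: V_def seq_sum_def)
  have dfV: "df V i = in1 C (ob U (Suc i)) (ob U' (Suc i)) \<bullet> df U i \<bullet> pr1 C (ob U i) (ob U' i) \<oplus>
      in2 C (ob U (Suc i)) (ob U' (Suc i)) \<bullet> df U' i \<bullet> pr2 C (ob U i) (ob U' i)" if "i \<le> n" for i
    using that by (simp add: V_def seq_sum_def mats)
  note sV = angle_seq[OF V]
  have "sigma_map C n S (Y, \<delta>) (V, \<omega>)
      (\<lambda>i. in1 C (ob U i) (ob U' i) \<bullet> p i \<oplus> in2 C (ob U i) (ob U' i) \<bullet> p' i)"
    unfolding sigma_map_iff[OF Y sV] using P P' by (simp add: obV dfV \<omega>)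
  moreover have "sigma_map C n S (V, \<omega>) (Y, \<delta>)
      (\<lambda>i. q i \<bullet> pr1 C (ob U i) (ob U' i) \<oplus> q' i \<bullet> pr2 C (ob U i) (ob U' i))"
  proof -
    have a1: "df Y i \<bullet> q i \<bullet> u = q (Suc i) \<bullet> df U i \<bullet> u" if "i \<le> n" "arr u" "cd u = ob U i" for i u
      using that Q by (simp add: cmp_assoc[symmetric] del: cmp_assoc)
    have a2: "df Y i \<bullet> q' i \<bullet> u = q' (Suc i) \<bullet> df U' i \<bullet> u" if "i \<le> n" "arr u" "cd u = ob U' i" for i u
      using that Q' by (simp add: cmp_assoc[symmetric] del: cmp_assoc)
    have b1: "\<delta> \<bullet> q (Suc n) \<bullet> u = S1 (q 0) \<bullet> \<epsilon> \<bullet> u" if "arr u" "cd u = ob U (Suc n)" for u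
      using that Q by (simp add: cmp_assoc[symmetric] del: cmp_assoc)
    have b2: "\<delta> \<bullet> q' (Suc n) \<bullet> u = S1 (q' 0) \<bullet> \<epsilon>' \<bullet> u" if "arr u" "cd u = ob U' (Suc n)" for u
      using that Q' by (simp add: cmp_assoc[symmetric] del: cmp_assoc)
    show ?thesis unfolding sigma_map_iff[OF sV Y] by (simp add: obV dfV \<omega> a1 a2 b1 b2)
  qed
  moreover have "(q i \<bullet> pr1 C (ob U i) (ob U' i) \<oplus> q' i \<bullet> pr2 C (ob U i) (ob U' i)) \<bullet>
      (in1 C (ob U i) (ob U' i) \<bullet> p i \<oplus> in2 C (ob U i) (ob U' i) \<bullet> p' i) = \<phi> i \<oplus> \<psi> i" if "i \<le> Suc n" for i
  proof -
    have "arr (\<phi> i)" "dm (\<phi> i) = ob Y i" "cd (\<phi> i) = ob Y i"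
      "arr (\<psi> i)" "dm (\<psi> i) = ob Y i" "cd (\<psi> i) = ob Y i"
      using that by (simp_all flip: qp qp')
    then show ?thesis using that by (simp add: qp[OF that] qp'[OF that])
  qed
  ultimately show ?thesis unfolding factors_through_angle_def using V by blast
qed

text \<open>
  The two terms that one homotopy component \<open>h : Y\<^sup>j\<^sup>+\<^sup>1 \<rightarrow> Y\<^sup>j\<close> contributes to \<open>dh + hd\<close> factor
  through the trivial angle on \<open>Y\<^sup>j\<^sup>+\<^sup>1\<close> in degrees \<open>j\<close> and \<open>j + 1\<close>.
\<close>

lemma factors_contractible:
  assumes Y: "sigma_seq C n S (Y, \<delta>)" and j: "j \<le> n"
    and cx: "\<And>i. i < n \<Longrightarrow> df Y (Suc i) \<bullet> df Y i = zmor C (ob Y i) (ob Y (Suc (Suc i)))"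
    and z: "\<delta> \<bullet> df Y n = zmor C (ob Y n) (S0 (ob Y 0))"
      "S1 (df Y 0) \<bullet> \<delta> = zmor C (ob Y (Suc n)) (S0 (ob Y 1))"
    and h: "arr h" "dm h = ob Y (Suc j)" "cd h = ob Y j"
  shows "factors_through_angle Y \<delta> (\<lambda>i. if i = j then h \<bullet> df Y j else if i = Suc j then df Y j \<bullet> h
    else zmor C (ob Y i) (ob Y i))"
proof -
  note DY [simp] = sigma_seqD[OF Y]
  define A where "A = ob Y (Suc j)"
  have A [simp]: "A \<in> Ob C" "ob Y (Suc j) = A" using j by (simp_all add: A_def)
  have T: "(trivial_seq j A, trivial_last j A) \<in> \<Theta>" using trivial_seq_angle j by simp
  note sT = angle_seq[OF T]
  have cx': "df Y (Suc i) \<bullet> df Y i \<bullet> u = zmor C (dm u) (ob Y (Suc (Suc i)))"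
    if "i < n" "arr u" "cd u = ob Y i" for i u
    using that cx[of i] by (simp add: cmp_assoc[symmetric] del: cmp_assoc)
  have z': "\<delta> \<bullet> df Y n \<bullet> u = zmor C (dm u) (S0 (ob Y 0))" if "arr u" "cd u = ob Y n" for u
    using that z(1) by (simp add: cmp_assoc[symmetric] del: cmp_assoc)
  define p where "p = (\<lambda>i. if i = j then df Y j else if i = Suc j then Id C A else zmor C (ob Y i) zero_obj)"
  define q where "q = (\<lambda>i. if i = j then h else if i = Suc j then df Y j \<bullet> h else zmor C zero_obj (ob Y i))"
  have tT: "ob (trivial_seq j A) i = (if i = j \<or> i = Suc j then A else zero_obj)" for i by (simp add: trivial_seq_def)
  have p: "sigma_map C n S (Y, \<delta>) (trivial_seq j A, trivial_last j A) p"
    unfolding sigma_map_iff[OF Y sT]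
  proof (intro conjI allI impI)
    show "df (trivial_seq j A) i \<bullet> p i = p (Suc i) \<bullet> df Y i" if "i \<le> n" for i
    proof -
      consider "i = j" | "i = Suc j" | "Suc i = j" | "i \<noteq> j" "i \<noteq> Suc j" "Suc i \<noteq> j" by blast
      then show ?thesis using that j h cx[of i] by cases (auto simp: p_def trivial_seq_def)
    qed
    show "trivial_last j A \<bullet> p (Suc n) = S1 (p 0) \<bullet> \<delta>"
      using j z(2) n_ge_1 A(2) by (cases "j = 0"; cases "j = n") (auto simp: p_def trivial_last_def)
  qed (use j in \<open>auto simp: p_def tT\<close>)
  have q: "sigma_map C n S (trivial_seq j A, trivial_last j A) (Y, \<delta>) q"
    unfolding sigma_map_iff[OF sT Y]
  proof (intro conjI allI impI)
    show "df Y i \<bullet> q i = q (Suc i) \<bullet> df (trivial_seq j A) i" if "i \<le> n" for i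
    proof -
      consider "i = j" | "i = Suc j" | "Suc i = j" | "i \<noteq> j" "i \<noteq> Suc j" "Suc i \<noteq> j" by blast
      then show ?thesis using that j h cx'[of j h] by cases (auto simp: q_def trivial_seq_def)
    qed
    show "\<delta> \<bullet> q (Suc n) = S1 (q 0) \<bullet> trivial_last j A"
      using j h z'[of h] n_ge_1 A(2) by (cases "j = 0"; cases "j = n") (auto simp: q_def trivial_last_def)
  qed (use j h in \<open>auto simp: q_def tT\<close>)
  have "q i \<bullet> p i = (if i = j then h \<bullet> df Y j else if i = Suc j then df Y j \<bullet> h
    else zmor C (ob Y i) (ob Y i))" if "i \<le> Suc n" for i
    using that j h by (auto simp: p_def q_def)
  then show ?thesis unfolding factors_through_angle_def using T p q by blast
qed

text \<open>
  A homotopy inverse writes the identity of \<open>Y\<close> as \<open>fg + dh + hd\<close>.  The first summand factors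
  through the given angle and the others through trivial angles.
\<close>

lemma homotopy_equivalent_angle:
  assumes X: "(X, \<delta>) \<in> \<Theta>" and Y: "cplx C (Suc n) Y" and eq: "homotopy_equivalent C (Suc n) X Y"
  shows "(Y, \<delta>) \<in> \<Theta>"
proof -
  note DX [simp] = angleD[OF X]
  note tX = angle_typed_seq[OF X]
  have tY: "typed_seq Y" and cx: "\<And>i. i < n \<Longrightarrow> df Y (Suc i) \<bullet> df Y i = zmor C (ob Y i) (ob Y (Suc (Suc i)))"
    using Y by (simp_all add: cplx_iff)
  note DY [simp] = typed_seqD[OF tY]
  obtain f g where fg: "end_fixing_map C (Suc n) X Y f" "end_fixing_map C (Suc n) Y X g"
      "homotopic C (Suc n) Y Y (\<lambda>i. f i \<bullet> g i) (\<lambda>i. Id C (ob Y i))"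
    using eq unfolding homotopy_equivalent_def by blast
  then have f: "typed_map X Y f" and fc: "\<And>i. i \<le> n \<Longrightarrow> df Y i \<bullet> f i = f (Suc i) \<bullet> df X i"
    and f0: "f 0 = Id C (ob X 0)" and fS: "f (Suc n) = Id C (ob X (Suc n))"
    and g: "typed_map Y X g" and gc: "\<And>i. i \<le> n \<Longrightarrow> df X i \<bullet> g i = g (Suc i) \<bullet> df Y i"
    and g0: "g 0 = Id C (ob X 0)" and gS: "g (Suc n) = Id C (ob X (Suc n))"
    and ends: "ob Y 0 = ob X 0" "ob Y (Suc n) = ob X (Suc n)"
    by (auto simp: end_fixing_map_def chain_map_iff[OF tX tY] chain_map_iff[OF tY tX])
  note F [simp] = typed_mapD[OF f] and G [simp] = typed_mapD[OF g]
  have sY: "sigma_seq C n S (Y, \<delta>)" by (simp add: sigma_seq_iff ends)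
  have e: "typed_map Y Y (\<lambda>i. f i \<bullet> g i)" by (simp add: typed_map_def)
  from fg(3)[unfolded homotopic_iff[OF tY tY e]]
  obtain h where h [simp]: "\<And>i. i \<le> n \<Longrightarrow> arr (h (Suc i))" "\<And>i. i \<le> n \<Longrightarrow> dm (h (Suc i)) = ob Y (Suc i)"
      "\<And>i. i \<le> n \<Longrightarrow> cd (h (Suc i)) = ob Y i"
    and h0: "Id C (ob Y 0) = f 0 \<bullet> g 0 \<oplus> h (Suc 0) \<bullet> df Y 0"
    and hi: "\<And>i. i < n \<Longrightarrow> Id C (ob Y (Suc i)) =
      f (Suc i) \<bullet> g (Suc i) \<oplus> (df Y i \<bullet> h (Suc i) \<oplus> h (Suc (Suc i)) \<bullet> df Y (Suc i))"
    and hS: "Id C (ob Y (Suc n)) = f (Suc n) \<bullet> g (Suc n) \<oplus> df Y n \<bullet> h (Suc n)"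
    by blast
  have z1: "\<delta> \<bullet> df Y n = zmor C (ob Y n) (S0 (ob Y 0))"
  proof -
    have "df Y n = df X n \<bullet> g n" using gc[of n] ends by (simp add: gS)
    moreover have "\<delta> \<bullet> df X n \<bullet> g n = zmor C (ob Y n) (S0 (ob Y 0))"
      using angle_zero(2)[OF X] ends by (simp add: cmp_assoc[symmetric] del: cmp_assoc)
    ultimately show ?thesis by simp
  qed
  have z2: "S1 (df Y 0) \<bullet> \<delta> = zmor C (ob Y (Suc n)) (S0 (ob Y 1))"
  proof -
    have "df Y 0 = f 1 \<bullet> df X 0" using fc[of 0] ends cmp_Id[of "df Y 0" "ob X 0"] by (simp add: f0 del: cmp_Id)
    then show ?thesis using angle_zero(3)[OF X] n_ge_1 ends by simp
  qed
  \<comment> \<open>The partial sums of the decomposition that use the homotopy components up to degree k.\<close>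
  define P where "P = (\<lambda>k i. f i \<bullet> g i \<oplus> ((if i \<noteq> 0 \<and> i \<le> k then df Y (i - 1) \<bullet> h i else zmor C (ob Y i) (ob Y i)) \<oplus>
    (if i < k then h (Suc i) \<bullet> df Y i else zmor C (ob Y i) (ob Y i))))"
  have cong: "factors_through_angle Y \<delta> \<phi> \<Longrightarrow> (\<And>i. i \<le> Suc n \<Longrightarrow> \<phi> i = \<psi> i) \<Longrightarrow> factors_through_angle Y \<delta> \<psi>" for \<phi> \<psi>
    unfolding factors_through_angle_def by (metis (no_types, lifting))
  have "k \<le> Suc n \<Longrightarrow> factors_through_angle Y \<delta> (P k)" for k
  proof (induction k)
    case 0
    have "sigma_map C n S (Y, \<delta>) (X, \<delta>) g"
      unfolding sigma_map_iff[OF sY angle_seq[OF X]] using gc ends by (simp add: g0 gS)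
    moreover have "sigma_map C n S (X, \<delta>) (Y, \<delta>) f"
      unfolding sigma_map_iff[OF angle_seq[OF X] sY] using fc ends by (simp add: f0 fS)
    moreover have "f i \<bullet> g i = P 0 i" if "i \<le> Suc n" for i
      using that by (cases i) (simp_all add: P_def)
    ultimately show ?case unfolding factors_through_angle_def using X by blast
  next
    case (Suc k)
    define e where "e = (\<lambda>i. if i = k then h (Suc k) \<bullet> df Y k else if i = Suc k then df Y k \<bullet> h (Suc k)
      else zmor C (ob Y i) (ob Y i))"
    have "factors_through_angle Y \<delta> (\<lambda>i. P k i \<oplus> e i)" unfolding e_def
      by (rule factors_sum[OF sY])
        (use Suc in \<open>auto intro!: factors_contractible[OF sY] simp: cx z1 z2 simp flip: One_nat_def\<close>)
    moreover have "P k i \<oplus> e i = P (Suc k) i" if "i \<le> Suc n" for i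
    proof -
      consider "i = k" | "i = Suc k" | "i < k" | "Suc k < i" by linarith
      then show ?thesis using that Suc.prems
        by cases (cases i; auto simp: P_def e_def)+
    qed
    ultimately show ?case using cong by blast
  qed
  then have "factors_through_angle Y \<delta> (P (Suc n))" by simp
  moreover have "P (Suc n) i = Id C (ob Y i)" if i: "i \<le> Suc n" for i
  proof (cases i)
    case 0
    then show ?thesis using h0 by (simp add: P_def)
  next
    case (Suc j)
    show ?thesis
    proof (cases "j = n")
      case True
      then show ?thesis using hS Suc by (simp add: P_def)
    next
      case False
      then show ?thesis using hi[of j] Suc i by (simp add: P_def)
    qed
  qed
  ultimately obtain U \<epsilon> p q where "(U, \<epsilon>) \<in> \<Theta>" "sigma_map C n S (Y, \<delta>) (U, \<epsilon>) p"
    "sigma_map C n S (U, \<epsilon>) (Y, \<delta>) q" "\<And>i. i \<le> Suc n \<Longrightarrow> q i \<bullet> p i = Id C (ob Y i)"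
    unfolding factors_through_angle_def by auto
  then show ?thesis using F1_summand[OF _ sY, of "(U, \<epsilon>)"] unfolding sigma_summand_def by auto
qed

lemma homotopy_equivalent_refl:
  assumes "cplx C (Suc n) X"
  shows "homotopy_equivalent C (Suc n) X X"
proof -
  have t: "typed_seq X" using assms by (simp add: cplx_iff)
  note D [simp] = typed_seqD[OF t]
  have "end_fixing_map C (Suc n) X X (\<lambda>i. Id C (ob X i))"
    by (simp add: end_fixing_map_def chain_map_iff[OF t t] typed_map_def)
  moreover have "homotopic C (Suc n) X X (\<lambda>i. Id C (ob X i) \<bullet> Id C (ob X i)) (\<lambda>i. Id C (ob X i))"
  proof -
    have "typed_map X X (\<lambda>i. Id C (ob X i) \<bullet> Id C (ob X i))" by (simp add: typed_map_def)
    then show ?thesis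
      by (subst homotopic_iff[OF t t])
        (auto intro!: exI[of _ "\<lambda>i. zmor C (ob X i) (ob X (i - 1))"])
  qed
  ultimately show ?thesis unfolding homotopy_equivalent_def by blast
qed

text \<open>
  This description makes the choice in the realization harmless and replaces any
  appeal to transitivity of homotopy equivalence.
\<close>

lemma hclass_angle:
  assumes X: "(X, \<delta>) \<in> \<Theta>"
  shows "hclass C (Suc n) X = {Y. (Y, \<delta>) \<in> \<Theta> \<and> ob Y 0 = ob X 0 \<and> ob Y (Suc n) = ob X (Suc n)}"
proof (intro Set.set_eqI iffI)
  fix Y assume "Y \<in> hclass C (Suc n) X"
  then have "cplx C (Suc n) Y" and eq: "homotopy_equivalent C (Suc n) X Y" by (simp_all add: hclass_def)
  then have "(Y, \<delta>) \<in> \<Theta>" using homotopy_equivalent_angle[OF X] by blast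
  moreover have "ob X 0 = ob Y 0" "ob X (Suc n) = ob Y (Suc n)"
    using eq by (auto simp: homotopy_equivalent_def end_fixing_map_def)
  ultimately show "Y \<in> {Y. (Y, \<delta>) \<in> \<Theta> \<and> ob Y 0 = ob X 0 \<and> ob Y (Suc n) = ob X (Suc n)}" by simp
next
  fix Y assume "Y \<in> {Y. (Y, \<delta>) \<in> \<Theta> \<and> ob Y 0 = ob X 0 \<and> ob Y (Suc n) = ob X (Suc n)}"
  then show "Y \<in> hclass C (Suc n) X"
    using angles_homotopy_equivalent[OF X, of Y] angle_cplx[of Y \<delta>] by (simp add: hclass_def)
qed

lemma angulated_realization_eq:
  assumes X: "(X, \<delta>) \<in> \<Theta>"
  shows "angulated_realization C n \<Theta> (ob X (Suc n)) (ob X 0) \<delta> = hclass C (Suc n) X"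
proof -
  let ?P = "\<lambda>Y. (Y, \<delta>) \<in> \<Theta> \<and> ob Y 0 = ob X 0 \<and> ob Y (n + 1) = ob X (Suc n)"
  have "?P (SOME Y. ?P Y)" by (rule someI[of ?P X]) (simp add: X)
  then show ?thesis using hclass_angle[OF X] hclass_angle[of "SOME Y. ?P Y" \<delta>]
    by (simp add: angulated_realization_def)
qed

text \<open>
  A distinguished pair lies in the class of some angle with the same \<open>\<delta>\<close>, and such classes consist
  of angles.
\<close>

lemma distinguished_iff:
  "distinguished C n (angulated_bifunctor C S) (angulated_realization C n \<Theta>) (X, \<delta>) \<longleftrightarrow> (X, \<delta>) \<in> \<Theta>"
proof
  assume X: "(X, \<delta>) \<in> \<Theta>"
  note D [simp] = angleD[OF X]
  show "distinguished C n (angulated_bifunctor C S) (angulated_realization C n \<Theta>) (X, \<delta>)"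
    using angle_cplx[OF X] angulated_realization_eq[OF X]
    by (simp add: distinguished_def angulated_bifunctor_def)
next
  assume dX: "distinguished C n (angulated_bifunctor C S) (angulated_realization C n \<Theta>) (X, \<delta>)"
  then have cX: "cplx C (Suc n) X" and tX: "typed_seq X" by (simp_all add: distinguished_def cplx_iff)
  note D [simp] = typed_seqD[OF tX]
  have \<delta>: "arr \<delta>" "dm \<delta> = ob X (Suc n)" "cd \<delta> = S0 (ob X 0)"
    and s: "angulated_realization C n \<Theta> (ob X (Suc n)) (ob X 0) \<delta> = hclass C (Suc n) X"
    using dX by (simp_all add: distinguished_def angulated_bifunctor_def)
  obtain Y where Y: "(Y, \<delta>) \<in> \<Theta>" "ob Y 0 = ob X 0" "ob Y (Suc n) = ob X (Suc n)"
    using angle_with_last[OF \<delta>(1,3)] \<delta> by auto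
  have "X \<in> hclass C (Suc n) X" using cX homotopy_equivalent_refl by (simp add: hclass_def)
  then have "X \<in> hclass C (Suc n) Y" using angulated_realization_eq[OF Y(1)] s Y by simp
  then show "(X, \<delta>) \<in> \<Theta>" using hclass_angle[OF Y(1)] by simp
qed

section \<open>Mapping cones with fixed end terms\<close>

text \<open>
  The inclusion and projection in the proof below are chain maps in the middle degrees, where
  both complexes have the same maps up to the identification of \<open>\<Sigma>(A \<oplus> B)\<close> with
  \<open>\<Sigma>A \<oplus> \<Sigma>B\<close>.
\<close>

lemma cone_square:
  assumes [simp]: "arr x" "dm x = X1" "cd x = X2" "arr y" "dm y = Y0" "cd y = Y1"
    "arr f" "dm f = X1" "cd f = Y1" "X1 \<in> Ob C" "X2 \<in> Ob C" "Y0 \<in> Ob C" "Y1 \<in> Ob C"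
  shows "(in1 C (S0 X2) (S0 Y1) \<bullet> ng (S1 x) \<bullet> pr1 C (S0 X1) (S0 Y0) \<oplus>
      in2 C (S0 X2) (S0 Y1) \<bullet> (S1 f \<bullet> pr1 C (S0 X1) (S0 Y0) \<oplus> S1 y \<bullet> pr2 C (S0 X1) (S0 Y0))) \<bullet>
    (in1 C (S0 X1) (S0 Y0) \<bullet> S1 (pr1 C X1 Y0) \<oplus> in2 C (S0 X1) (S0 Y0) \<bullet> S1 (pr2 C X1 Y0)) =
    (in1 C (S0 X2) (S0 Y1) \<bullet> S1 (pr1 C X2 Y1) \<oplus> in2 C (S0 X2) (S0 Y1) \<bullet> S1 (pr2 C X2 Y1)) \<bullet>
    S1 (in1 C X2 Y1 \<bullet> ng x \<bullet> pr1 C X1 Y0 \<oplus> in2 C X2 Y1 \<bullet> (f \<bullet> pr1 C X1 Y0 \<oplus> y \<bullet> pr2 C X1 Y0))"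
  and "S1 (in1 C X2 Y1 \<bullet> ng x \<bullet> pr1 C X1 Y0 \<oplus> in2 C X2 Y1 \<bullet> (f \<bullet> pr1 C X1 Y0 \<oplus> y \<bullet> pr2 C X1 Y0)) \<bullet>
    (S1 (in1 C X1 Y0) \<bullet> pr1 C (S0 X1) (S0 Y0) \<oplus> S1 (in2 C X1 Y0) \<bullet> pr2 C (S0 X1) (S0 Y0)) =
    (S1 (in1 C X2 Y1) \<bullet> pr1 C (S0 X2) (S0 Y1) \<oplus> S1 (in2 C X2 Y1) \<bullet> pr2 C (S0 X2) (S0 Y1)) \<bullet>
    (in1 C (S0 X2) (S0 Y1) \<bullet> ng (S1 x) \<bullet> pr1 C (S0 X1) (S0 Y0) \<oplus>
      in2 C (S0 X2) (S0 Y1) \<bullet> (S1 f \<bullet> pr1 C (S0 X1) (S0 Y0) \<oplus> S1 y \<bullet> pr2 C (S0 X1) (S0 Y0)))"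
  by ((simp; simp add: pls_ac), (simp; simp add: pls_ac))

text \<open>
  The heart of (EA2).  For a lift \<open>f\<close> of \<open>(1, c)\<close> the full cone of (F4) has the two extra
  summands \<open>\<Sigma>X\<^sup>0\<close> in degree \<open>0\<close> and \<open>\<Sigma>Y\<^sup>0\<close> in degree \<open>1\<close>, which are identified by \<open>f\<^sup>0 = 1\<close>.
  The shifted complex of (EA2) is the retract that is left when they are cancelled.
\<close>

lemma cone_angle:
  assumes Y: "(Y, \<rho>) \<in> \<Theta>" and c: "arr c" "cd c = ob Y (Suc n)"
    and X: "(X, \<rho> \<bullet> c) \<in> \<Theta>" and ends: "ob X 0 = ob Y 0" "ob X (Suc n) = dm c"
  shows "\<exists>f. sigma_map C n S (X, \<rho> \<bullet> c) (Y, \<rho>) f \<and> f 0 = Id C (ob X 0) \<and> f (Suc n) = c \<and>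
    (mcone C n (tail_seq X) (tail_seq Y) (\<lambda>i. f (i + 1)), S1 (df X 0) \<bullet> \<rho>) \<in> \<Theta>"
proof -
  note DX [simp] = angleD(1,3-5)[OF X] and DY [simp] = angleD[OF Y]
  note sX = angle_seq[OF X] and sY = angle_seq[OF Y]
  have O [simp]: "ob Y 0 \<in> Ob C" "dm c \<in> Ob C" "ob X (Suc 0) \<in> Ob C" using c n_ge_1 by simp_all
  obtain f where sf: "sigma_map C n S (X, \<rho> \<bullet> c) (Y, \<rho>) f" and f0: "f 0 = Id C (ob Y 0)" and fS: "f (Suc n) = c"
    and K: "lift_cone X (\<rho> \<bullet> c) Y \<rho> f \<in> \<Theta>"
    using lift_ends_with_cone[OF X Y, of "Id C (ob Y 0)" c] c ends by auto
  note M = sf[unfolded sigma_map_iff[OF sX sY]]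
  have F [simp]: "i \<le> Suc n \<Longrightarrow> arr (f i)" "i \<le> Suc n \<Longrightarrow> dm (f i) = ob X i" "i \<le> Suc n \<Longrightarrow> cd (f i) = ob Y i" for i
    using M by simp_all
  define N where "N = mcone C n (tail_seq X) (tail_seq Y) (\<lambda>i. f (i + 1))"
  have N0: "ob N 0 = ob X (Suc 0)" and Ni: "\<And>i. Suc i \<le> n \<Longrightarrow> ob N (Suc i) = bsum C (ob X (Suc (Suc i))) (ob Y (Suc i))"
    and NS: "ob N (Suc n) = ob Y (Suc n)"
    by (simp_all add: N_def mcone_def tail_seq_def)
  have dN0: "df N 0 = in1 C (ob X (Suc (Suc 0))) (ob Y (Suc 0)) \<bullet> ng (df X (Suc 0)) \<oplus>
      in2 C (ob X (Suc (Suc 0))) (ob Y (Suc 0)) \<bullet> f (Suc 0)"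
    using n_ge_1 by (simp add: N_def mcone_def tail_seq_def inv_ng mats)
  have dNi: "df N (Suc i) = in1 C (ob X (Suc (Suc (Suc i)))) (ob Y (Suc (Suc i))) \<bullet>
        ng (df X (Suc (Suc i))) \<bullet> pr1 C (ob X (Suc (Suc i))) (ob Y (Suc i)) \<oplus>
      in2 C (ob X (Suc (Suc (Suc i)))) (ob Y (Suc (Suc i))) \<bullet>
       (f (Suc (Suc i)) \<bullet> pr1 C (ob X (Suc (Suc i))) (ob Y (Suc i)) \<oplus> df Y (Suc i) \<bullet> pr2 C (ob X (Suc (Suc i))) (ob Y (Suc i)))"
    if "Suc i < n" for i
    using that by (simp add: N_def mcone_def tail_seq_def inv_ng mats)
  have dNn: "df N n = c \<bullet> pr1 C (dm c) (ob Y n) \<oplus> df Y n \<bullet> pr2 C (dm c) (ob Y n)"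
    using n_ge_1 c ends by (simp add: N_def mcone_def tail_seq_def mats fS)
  define \<mu> where "\<mu> = S1 (df X 0) \<bullet> \<rho>"
  have \<mu>: "arr \<mu>" "dm \<mu> = ob Y (Suc n)" "cd \<mu> = S0 (ob X (Suc 0))" using ends by (simp_all add: \<mu>_def)
  have obN: "ob N i \<in> Ob C" if "i \<le> Suc n" for i
    using that N0 NS Ni[of "i - 1"] by (cases "i = 0"; cases "i = Suc n") auto
  have sN: "sigma_seq C n S (N, \<mu>)"
    unfolding sigma_seq_iff
  proof (intro conjI allI impI)
    fix i assume i: "i \<le> n"
    then consider "i = 0" | j where "i = Suc j" "Suc j < n" | j where "i = n" "n = Suc j" by (cases i) fastforce+
    then have "arr (df N i) \<and> dm (df N i) = ob N i \<and> cd (df N i) = ob N (Suc i)"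
    proof cases
      case 1
      then show ?thesis using n_ge_1 Ni[of 0] by (simp add: dN0 N0)
    next
      case (2 j)
      then show ?thesis using Ni[of j] Ni[of "Suc j"] by (simp add: dNi)
    next
      case (3 j)
      then show ?thesis using Ni[of j] c ends by (simp add: dNn[unfolded 3(2)] NS[unfolded 3(2)])
    qed
    then show "arr (df N i)" "dm (df N i) = ob N i" "cd (df N i) = ob N (Suc i)" by simp_all
  qed (simp_all add: obN \<mu> NS N0)
  obtain N' \<mu>' where N': "shift (N, \<mu>) = (N', \<mu>')" by force
  have N'0: "ob N' 0 = ob Y (Suc n)" and N'S: "\<And>i. ob N' (Suc i) = S0 (ob N i)"
    and dN'0: "df N' 0 = \<mu>" and dN'S: "\<And>i. df N' (Suc i) = S1 (df N i)" and \<mu>': "\<mu>' = S1 (df N n)"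
    using N' by (auto simp: shift_def NS)
  obtain L \<kappa> where L: "lift_cone X (\<rho> \<bullet> c) Y \<rho> f = (L, \<kappa>)" by force
  have L\<Theta>: "(L, \<kappa>) \<in> \<Theta>" using K L by simp
  have L0: "ob L 0 = bsum C (S0 (ob Y 0)) (ob Y (Suc n))"
    and LS: "\<And>i. ob L (Suc i) = bsum C (S0 (ob X (Suc i))) (S0 (ob Y i))"
    using L ends by (auto simp: lift_cone_def)
  have dL0: "df L 0 = in1 C (S0 (ob X (Suc 0))) (S0 (ob Y 0)) \<bullet> ng (S1 (df X 0)) \<bullet> pr1 C (S0 (ob Y 0)) (ob Y (Suc n)) \<oplus>
      in2 C (S0 (ob X (Suc 0))) (S0 (ob Y 0)) \<bullet> (pr1 C (S0 (ob Y 0)) (ob Y (Suc n)) \<oplus> \<rho> \<bullet> pr2 C (S0 (ob Y 0)) (ob Y (Suc n)))"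
    using L ends by (auto simp: lift_cone_def mats f0)
  have dLS: "df L (Suc i) = in1 C (S0 (ob X (Suc (Suc i)))) (S0 (ob Y (Suc i))) \<bullet>
        ng (S1 (df X (Suc i))) \<bullet> pr1 C (S0 (ob X (Suc i))) (S0 (ob Y i)) \<oplus>
      in2 C (S0 (ob X (Suc (Suc i)))) (S0 (ob Y (Suc i))) \<bullet>
       (S1 (f (Suc i)) \<bullet> pr1 C (S0 (ob X (Suc i))) (S0 (ob Y i)) \<oplus> S1 (df Y i) \<bullet> pr2 C (S0 (ob X (Suc i))) (S0 (ob Y i)))"
    if "Suc i \<le> n" for i
    using that L by (auto simp: lift_cone_def mats)
  have \<kappa>: "\<kappa> = S1 (in1 C (S0 (ob Y 0)) (ob Y (Suc n))) \<bullet> ng (S1 \<rho> \<bullet> S1 c) \<bullet> pr1 C (S0 (dm c)) (S0 (ob Y n)) \<oplus>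
      S1 (in2 C (S0 (ob Y 0)) (ob Y (Suc n))) \<bullet>
        (S1 c \<bullet> pr1 C (S0 (dm c)) (S0 (ob Y n)) \<oplus> S1 (df Y n) \<bullet> pr2 C (S0 (dm c)) (S0 (ob Y n)))"
    using L ends c by (auto simp: lift_cone_def fS)
  have XX: "S1 (df X (Suc 0)) \<bullet> S1 (df X 0) \<bullet> u = zmor C (dm u) (S0 (ob X (Suc (Suc 0))))"
    if "arr u" "cd u = S0 (ob Y 0)" for u
    using that n_ge_1 angle_zero(1)[OF X, of 0] ends
    by (simp add: cmp_assoc[symmetric] S1_cmp[symmetric] del: cmp_assoc S1_cmp)
  have fX: "S1 (f (Suc 0)) \<bullet> S1 (df X 0) \<bullet> u = S1 (df Y 0) \<bullet> u"
    if "arr u" "cd u = S0 (ob Y 0)" for u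
  proof -
    have "df Y 0 \<bullet> f 0 = f (Suc 0) \<bullet> df X 0" using M by blast
    then have "S1 (f (Suc 0) \<bullet> df X 0) = S1 (df Y 0)" by (simp add: f0)
    then show ?thesis using that n_ge_1 ends
      by (simp add: cmp_assoc[symmetric] del: cmp_assoc)
  qed
  have rY: "S1 \<rho> \<bullet> S1 (df Y n) \<bullet> u = zmor C (dm u) (S0 (S0 (ob Y 0)))"
    if "arr u" "cd u = S0 (ob Y n)" for u
    using that angle_zero(2)[OF Y]
    by (simp add: cmp_assoc[symmetric] S1_cmp[symmetric] del: cmp_assoc S1_cmp)
  \<comment> \<open>The columns \<open>(-\<rho>, 1)\<close> and \<open>(1, 0)\<close> in degrees 0 and 1; in the higher degrees the canonical
    identification.\<close>
  define p where "p = (\<lambda>i. if i = 0 then in1 C (S0 (ob Y 0)) (ob Y (Suc n)) \<bullet> ng \<rho> \<oplus> in2 C (S0 (ob Y 0)) (ob Y (Suc n))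
    else if i = Suc 0 then in1 C (S0 (ob X (Suc 0))) (S0 (ob Y 0))
    else in1 C (S0 (ob X i)) (S0 (ob Y (i - 1))) \<bullet> S1 (pr1 C (ob X i) (ob Y (i - 1))) \<oplus>
      in2 C (S0 (ob X i)) (S0 (ob Y (i - 1))) \<bullet> S1 (pr2 C (ob X i) (ob Y (i - 1))))"
  \<comment> \<open>The rows \<open>(0, 1)\<close> and \<open>(1, \<Sigma>d\<^sup>0)\<close> in degrees 0 and 1.  The entry \<open>\<Sigma>d\<^sup>0\<close> is forced by
    \<open>f\<^sup>1 d\<^sup>0 = d\<^sup>0\<close>.\<close>
  define q where "q = (\<lambda>i. if i = 0 then pr2 C (S0 (ob Y 0)) (ob Y (Suc n))
    else if i = Suc 0 then pr1 C (S0 (ob X (Suc 0))) (S0 (ob Y 0)) \<oplus> S1 (df X 0) \<bullet> pr2 C (S0 (ob X (Suc 0))) (S0 (ob Y 0))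
    else S1 (in1 C (ob X i) (ob Y (i - 1))) \<bullet> pr1 C (S0 (ob X i)) (S0 (ob Y (i - 1))) \<oplus>
      S1 (in2 C (ob X i) (ob Y (i - 1))) \<bullet> pr2 C (S0 (ob X i)) (S0 (ob Y (i - 1))))"
  have pS: "p (Suc n) = in1 C (S0 (dm c)) (S0 (ob Y n)) \<bullet> S1 (pr1 C (dm c) (ob Y n)) \<oplus>
      in2 C (S0 (dm c)) (S0 (ob Y n)) \<bullet> S1 (pr2 C (dm c) (ob Y n))"
    and qS: "q (Suc n) = S1 (in1 C (dm c) (ob Y n)) \<bullet> pr1 C (S0 (dm c)) (S0 (ob Y n)) \<oplus>
      S1 (in2 C (dm c) (ob Y n)) \<bullet> pr2 C (S0 (dm c)) (S0 (ob Y n))"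
    using n_ge_1 ends by (simp_all add: p_def q_def)
  have sN': "sigma_seq C n S (N', \<mu>')" using shift_seq[OF sN] N' by simp
  note sL = angle_seq[OF L\<Theta>]
  have pq_typ: "arr (p i) \<and> dm (p i) = ob N' i \<and> cd (p i) = ob L i \<and> arr (q i) \<and> dm (q i) = ob L i \<and> cd (q i) = ob N' i \<and>
      q i \<bullet> p i = Id C (ob N' i)" if "i \<le> Suc n" for i
  proof -
    consider "i = 0" | "i = Suc 0" | j where "i = Suc (Suc j)" by (metis not0_implies_Suc)
    then show ?thesis
    proof cases
      case 1
      then show ?thesis by (simp add: p_def q_def N'0 L0)
    next
      case 2
      then show ?thesis using ends by (simp add: p_def q_def N'S LS N0)
    next
      case 3
      then show ?thesis using that Ni[of j] by (simp add: p_def q_def N'S LS S_bip_Id)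
    qed
  qed
  have chain: "df L i \<bullet> p i = p (Suc i) \<bullet> df N' i \<and> df N' i \<bullet> q i = q (Suc i) \<bullet> df L i" if "i \<le> n" for i
  proof -
    consider "i = 0" | "i = Suc 0" | j where "i = Suc (Suc j)" by (metis not0_implies_Suc)
    then show ?thesis
    proof cases
      case 1
      then show ?thesis using ends by (simp add: p_def q_def dL0 dN'0 \<mu>_def)
    next
      case 2
      have "df L (Suc 0) \<bullet> p (Suc 0) = p (Suc (Suc 0)) \<bullet> df N' (Suc 0)"
        using ends n_ge_1 by (simp add: p_def dLS dN'S dN0)
      moreover have "df N' (Suc 0) \<bullet> q (Suc 0) = q (Suc (Suc 0)) \<bullet> df L (Suc 0)"
        using ends n_ge_1 by (simp add: q_def dLS dN'S dN0; simp add: XX; simp add: fX)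
      ultimately show ?thesis using 2 by simp
    next
      case (3 j)
      then have j: "Suc j < n" "Suc (Suc j) \<le> n" using that by simp_all
      have pj: "p (Suc (Suc k)) = in1 C (S0 (ob X (Suc (Suc k)))) (S0 (ob Y (Suc k))) \<bullet>
            S1 (pr1 C (ob X (Suc (Suc k))) (ob Y (Suc k))) \<oplus>
          in2 C (S0 (ob X (Suc (Suc k)))) (S0 (ob Y (Suc k))) \<bullet> S1 (pr2 C (ob X (Suc (Suc k))) (ob Y (Suc k)))"
        and qj: "q (Suc (Suc k)) = S1 (in1 C (ob X (Suc (Suc k))) (ob Y (Suc k))) \<bullet>
            pr1 C (S0 (ob X (Suc (Suc k)))) (S0 (ob Y (Suc k))) \<oplus>
          S1 (in2 C (ob X (Suc (Suc k))) (ob Y (Suc k))) \<bullet> pr2 C (S0 (ob X (Suc (Suc k)))) (S0 (ob Y (Suc k)))" for k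
        by (simp_all add: p_def q_def)
      show ?thesis
        unfolding 3 pj qj dLS[OF j(2)] dN'S dNi[OF j(1)]
        by (intro conjI cone_square) (use j in simp_all)
    qed
  qed
  have "sigma_map C n S (N', \<mu>') (L, \<kappa>) p"
    unfolding sigma_map_iff[OF sN' sL] using pq_typ chain
    by (simp add: pS \<mu>' dNn \<kappa> c rY) (simp add: p_def c rY pls_ac)
  moreover have "sigma_map C n S (L, \<kappa>) (N', \<mu>') q"
    unfolding sigma_map_iff[OF sL sN'] using pq_typ chain
    by (simp add: qS \<mu>' dNn \<kappa> c) (simp add: q_def c)
  ultimately have "sigma_summand C n S (N', \<mu>') (L, \<kappa>)"
    unfolding sigma_summand_def using pq_typ by auto
  then have "(N', \<mu>') \<in> \<Theta>" using F1_summand[OF L\<Theta> sN'] by blast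
  then have "(N, \<mu>) \<in> \<Theta>" using shift_angle_iff[OF sN] N' by simp
  then show ?thesis using sf f0 fS ends by (auto simp: N_def \<mu>_def)
qed

text \<open>
  The middle degrees for the dual complex.  Exchanging the summands and negating one of them
  turns the negated suspension of the dual complex into the cone.
\<close>

lemma cocone_square:
  assumes [simp]: "arr x" "dm x = X1" "cd x = X2" "arr y" "dm y = Y0" "cd y = Y1"
    "arr f" "dm f = X1" "cd f = Y1" "X1 \<in> Ob C" "X2 \<in> Ob C" "Y0 \<in> Ob C" "Y1 \<in> Ob C"
  shows "(in1 C (S0 X2) (S0 Y1) \<bullet> ng (S1 x) \<bullet> pr1 C (S0 X1) (S0 Y0) \<oplus>
      in2 C (S0 X2) (S0 Y1) \<bullet> (S1 f \<bullet> pr1 C (S0 X1) (S0 Y0) \<oplus> S1 y \<bullet> pr2 C (S0 X1) (S0 Y0))) \<bullet>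
    (in1 C (S0 X1) (S0 Y0) \<bullet> S1 (pr2 C Y0 X1) \<oplus> ng (in2 C (S0 X1) (S0 Y0) \<bullet> S1 (pr1 C Y0 X1))) =
    (in1 C (S0 X2) (S0 Y1) \<bullet> S1 (pr2 C Y1 X2) \<oplus> ng (in2 C (S0 X2) (S0 Y1) \<bullet> S1 (pr1 C Y1 X2))) \<bullet>
    ng (S1 (in1 C Y1 X2 \<bullet> (ng y \<bullet> pr1 C Y0 X1 \<oplus> f \<bullet> pr2 C Y0 X1) \<oplus> in2 C Y1 X2 \<bullet> x \<bullet> pr2 C Y0 X1))"
  and "ng (S1 (in1 C Y1 X2 \<bullet> (ng y \<bullet> pr1 C Y0 X1 \<oplus> f \<bullet> pr2 C Y0 X1) \<oplus> in2 C Y1 X2 \<bullet> x \<bullet> pr2 C Y0 X1)) \<bullet>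
    (S1 (in2 C Y0 X1) \<bullet> pr1 C (S0 X1) (S0 Y0) \<oplus> ng (S1 (in1 C Y0 X1) \<bullet> pr2 C (S0 X1) (S0 Y0))) =
    (S1 (in2 C Y1 X2) \<bullet> pr1 C (S0 X2) (S0 Y1) \<oplus> ng (S1 (in1 C Y1 X2) \<bullet> pr2 C (S0 X2) (S0 Y1))) \<bullet>
    (in1 C (S0 X2) (S0 Y1) \<bullet> ng (S1 x) \<bullet> pr1 C (S0 X1) (S0 Y0) \<oplus>
      in2 C (S0 X2) (S0 Y1) \<bullet> (S1 f \<bullet> pr1 C (S0 X1) (S0 Y0) \<oplus> S1 y \<bullet> pr2 C (S0 X1) (S0 Y0)))"
  by ((simp; simp add: pls_ac), (simp; simp add: pls_ac))

text \<open>
  The heart of the dual of (EA2).  For a lift of \<open>(a, 1)\<close> it is now the summands \<open>Y\<^sup>n\<^sup>+\<^sup>1\<close> in degree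
  \<open>0\<close> and \<open>\<Sigma>X\<^sup>n\<^sup>+\<^sup>1\<close> in degree \<open>n + 1\<close> that cancel.  The comparison is made after a full turn
  rather than after a shift, because the dual complex begins with \<open>X\<^sup>0\<close>; using the
  negated suspension avoids case distinctions on the parity of \<open>n\<close>.
\<close>

lemma cocone_angle:
  assumes X: "(X, \<delta>) \<in> \<Theta>" and a: "arr a" "dm a = ob X 0"
    and Y: "(Y, S1 a \<bullet> \<delta>) \<in> \<Theta>" and ends: "ob Y 0 = cd a" "ob Y (Suc n) = ob X (Suc n)"
  shows "\<exists>f. sigma_map C n S (X, \<delta>) (Y, S1 a \<bullet> \<delta>) f \<and> f 0 = a \<and> f (Suc n) = Id C (ob X (Suc n)) \<and>
    (mcocone C n X Y f, \<delta> \<bullet> df Y n) \<in> \<Theta>"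
proof -
  note DX [simp] = angleD[OF X] and DY [simp] = angleD(1,3-5)[OF Y]
  note sX = angle_seq[OF X] and sY = angle_seq[OF Y]
  have O [simp]: "ob X (Suc n) \<in> Ob C" "cd a \<in> Ob C" "ob X (Suc 0) \<in> Ob C" "ob Y n \<in> Ob C"
    using a n_ge_1 by simp_all
  obtain f where sf: "sigma_map C n S (X, \<delta>) (Y, S1 a \<bullet> \<delta>) f" and f0: "f 0 = a"
    and fS: "f (Suc n) = Id C (ob X (Suc n))" and K: "lift_cone X \<delta> Y (S1 a \<bullet> \<delta>) f \<in> \<Theta>"
    using lift_ends_with_cone[OF X Y, of a "Id C (ob X (Suc n))"] a ends by auto
  note M = sf[unfolded sigma_map_iff[OF sX sY]]
  have F [simp]: "i \<le> Suc n \<Longrightarrow> arr (f i)" "i \<le> Suc n \<Longrightarrow> dm (f i) = ob X i" "i \<le> Suc n \<Longrightarrow> cd (f i) = ob Y i" for i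
    using M by simp_all
  define N where "N = mcocone C n X Y f"
  have N0: "ob N 0 = ob X 0" and Ni: "\<And>i. Suc i \<le> n \<Longrightarrow> ob N (Suc i) = bsum C (ob Y i) (ob X (Suc i))"
    and NS: "ob N (Suc n) = ob Y n"
    by (simp_all add: N_def mcocone_def)
  have dN0: "df N 0 = in1 C (cd a) (ob X (Suc 0)) \<bullet> a \<oplus> in2 C (cd a) (ob X (Suc 0)) \<bullet> df X 0"
    using a ends by (simp add: N_def mcocone_def f0 mats)
  have dNi: "df N (Suc i) = in1 C (ob Y (Suc i)) (ob X (Suc (Suc i))) \<bullet>
        (ng (df Y i) \<bullet> pr1 C (ob Y i) (ob X (Suc i)) \<oplus> f (Suc i) \<bullet> pr2 C (ob Y i) (ob X (Suc i))) \<oplus>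
      in2 C (ob Y (Suc i)) (ob X (Suc (Suc i))) \<bullet> df X (Suc i) \<bullet> pr2 C (ob Y i) (ob X (Suc i))"
    if "Suc i < n" for i
    using that by (simp add: N_def mcocone_def inv_ng mats)
  have dNn: "df N n = ng (df Y i) \<bullet> pr1 C (ob Y i) (ob X (Suc i)) \<oplus> f (Suc i) \<bullet> pr2 C (ob Y i) (ob X (Suc i))"
    if "n = Suc i" for i
  proof -
    have i: "i \<le> n" "Suc i \<le> n" using that by simp_all
    have "df N n = mrow C (ob Y i) (ob X (Suc i)) (ob Y (Suc i)) (ng (df Y i)) (f (Suc i))"
      using i by (simp add: N_def mcocone_def inv_ng that[symmetric])
        (simp add: that inv_ng)
    then show ?thesis using i by (simp add: mats)
  qed
  define \<mu> where "\<mu> = \<delta> \<bullet> df Y n"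
  have \<mu>: "arr \<mu>" "dm \<mu> = ob Y n" "cd \<mu> = S0 (ob X 0)" using ends by (simp_all add: \<mu>_def)
  have obN: "ob N i \<in> Ob C" if "i \<le> Suc n" for i
    using that N0 NS Ni[of "i - 1"] by (cases "i = 0"; cases "i = Suc n") auto
  have sN: "sigma_seq C n S (N, \<mu>)"
    unfolding sigma_seq_iff
  proof (intro conjI allI impI)
    fix i assume i: "i \<le> n"
    then consider "i = 0" | j where "i = Suc j" "Suc j < n" | j where "i = n" "n = Suc j" by (cases i) fastforce+
    then have "arr (df N i) \<and> dm (df N i) = ob N i \<and> cd (df N i) = ob N (Suc i)"
    proof cases
      case 1
      then show ?thesis using a ends n_ge_1 Ni[of 0] by (simp add: dN0 N0)
    next
      case (2 j)
      then show ?thesis using Ni[of j] Ni[of "Suc j"] by (simp add: dNi)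
    next
      case (3 j)
      then have j: "j \<le> n" "Suc j \<le> n" by simp_all
      have "arr (df N n) \<and> dm (df N n) = ob N n \<and> cd (df N n) = ob N (Suc n)"
        unfolding dNn[OF 3(2)] NS using Ni[of j] j 3(2)[symmetric] by simp
      then show ?thesis using 3 by simp
    qed
    then show "arr (df N i)" "dm (df N i) = ob N i" "cd (df N i) = ob N (Suc i)" by simp_all
  qed (simp_all add: obN \<mu> NS N0)
  obtain N' \<mu>' where N': "susp_neg (N, \<mu>) = (N', \<mu>')" by force
  have obN': "ob N' i = S0 (ob N i)" and dN': "df N' i = ng (S1 (df N i))" and \<mu>': "\<mu>' = ng (S1 \<mu>)" for i
    using N' by (auto simp: susp_neg_def)
  obtain L \<kappa> where L: "lift_cone X \<delta> Y (S1 a \<bullet> \<delta>) f = (L, \<kappa>)" by force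
  have L\<Theta>: "(L, \<kappa>) \<in> \<Theta>" using K L by simp
  define E where "E = ob X (Suc n)"
  have E [simp]: "E \<in> Ob C" "ob X (Suc n) = E" by (simp_all add: E_def)
  note ends' = ends[unfolded E(2)] and fS' = fS[unfolded E(2)]
  have L0: "ob L 0 = bsum C (S0 (ob X 0)) E"
    and LS: "\<And>i. ob L (Suc i) = bsum C (S0 (ob X (Suc i))) (S0 (ob Y i))"
    using L ends' by (auto simp: lift_cone_def)
  have dL0: "df L 0 = in1 C (S0 (ob X (Suc 0))) (S0 (cd a)) \<bullet> ng (S1 (df X 0)) \<bullet> pr1 C (S0 (ob X 0)) E \<oplus>
      in2 C (S0 (ob X (Suc 0))) (S0 (cd a)) \<bullet>
        (S1 a \<bullet> pr1 C (S0 (ob X 0)) E \<oplus> S1 a \<bullet> \<delta> \<bullet> pr2 C (S0 (ob X 0)) E)"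
    using L ends' a by (auto simp: lift_cone_def mats f0)
  have dLS: "df L (Suc i) = in1 C (S0 (ob X (Suc (Suc i)))) (S0 (ob Y (Suc i))) \<bullet>
        ng (S1 (df X (Suc i))) \<bullet> pr1 C (S0 (ob X (Suc i))) (S0 (ob Y i)) \<oplus>
      in2 C (S0 (ob X (Suc (Suc i)))) (S0 (ob Y (Suc i))) \<bullet>
       (S1 (f (Suc i)) \<bullet> pr1 C (S0 (ob X (Suc i))) (S0 (ob Y i)) \<oplus> S1 (df Y i) \<bullet> pr2 C (S0 (ob X (Suc i))) (S0 (ob Y i)))"
    if "Suc i \<le> n" for i
    using that L by (auto simp: lift_cone_def mats)
  have \<kappa>: "\<kappa> = S1 (in1 C (S0 (ob X 0)) E) \<bullet> ng (S1 \<delta>) \<bullet> pr1 C (S0 E) (S0 (ob Y n)) \<oplus>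
      S1 (in2 C (S0 (ob X 0)) E) \<bullet>
        (pr1 C (S0 E) (S0 (ob Y n)) \<oplus> S1 (df Y n) \<bullet> pr2 C (S0 E) (S0 (ob Y n)))"
    using L ends' by (auto simp: lift_cone_def fS')
  have fX: "S1 (df Y n) \<bullet> S1 (f n) \<bullet> u = S1 (df X n) \<bullet> u" if "arr u" "cd u = S0 (ob X n)" for u
  proof -
    have "df Y n \<bullet> f n = f (Suc n) \<bullet> df X n" using M by blast
    then have "S1 (df Y n \<bullet> f n) = S1 (df X n)" by (simp add: fS')
    then show ?thesis using that by (simp add: cmp_assoc[symmetric] del: cmp_assoc)
  qed
  have Xd: "S1 (df X 0) \<bullet> \<delta> \<bullet> u = zmor C (dm u) (S0 (ob X (Suc 0)))" if "arr u" "cd u = E" for u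
    using that angle_zero(3)[OF X]
    by (simp add: cmp_assoc[symmetric] del: cmp_assoc)
  have YY: "S1 (df Y (Suc i)) \<bullet> S1 (df Y i) \<bullet> u = zmor C (dm u) (S0 (ob Y (Suc (Suc i))))"
    if "i < n" "arr u" "cd u = S0 (ob Y i)" for i u
    using that angle_zero(1)[OF Y, of i]
    by (simp add: cmp_assoc[symmetric] S1_cmp[symmetric] del: cmp_assoc S1_cmp)
  \<comment> \<open>In degree i a pair (y, x) goes to (x, -y); in degree n + 1 an element y goes to \<open>(\<Sigma>d\<^sup>n y, -y)\<close>.\<close>
  define p where "p = (\<lambda>i. if i = 0 then in1 C (S0 (ob X 0)) E
    else if i = Suc n then in1 C (S0 E) (S0 (ob Y n)) \<bullet> S1 (df Y n) \<oplus> ng (in2 C (S0 E) (S0 (ob Y n)))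
    else in1 C (S0 (ob X i)) (S0 (ob Y (i - 1))) \<bullet> S1 (pr2 C (ob Y (i - 1)) (ob X i)) \<oplus>
      ng (in2 C (S0 (ob X i)) (S0 (ob Y (i - 1))) \<bullet> S1 (pr1 C (ob Y (i - 1)) (ob X i))))"
  \<comment> \<open>The row \<open>(1, \<delta>)\<close> in degree 0 works because \<open>\<Sigma>a \<delta>\<close> is the last map of Y and \<open>\<Sigma>d\<^sup>0 \<delta> = 0\<close>.\<close>
  define q where "q = (\<lambda>i. if i = 0 then pr1 C (S0 (ob X 0)) E \<oplus> \<delta> \<bullet> pr2 C (S0 (ob X 0)) E
    else if i = Suc n then ng (pr2 C (S0 E) (S0 (ob Y n)))
    else S1 (in2 C (ob Y (i - 1)) (ob X i)) \<bullet> pr1 C (S0 (ob X i)) (S0 (ob Y (i - 1))) \<oplus>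
      ng (S1 (in1 C (ob Y (i - 1)) (ob X i)) \<bullet> pr2 C (S0 (ob X i)) (S0 (ob Y (i - 1)))))"
  have p0: "p 0 = in1 C (S0 (ob X 0)) E"
    and q0: "q 0 = pr1 C (S0 (ob X 0)) E \<oplus> \<delta> \<bullet> pr2 C (S0 (ob X 0)) E"
    and pN: "p (Suc n) = in1 C (S0 E) (S0 (ob Y n)) \<bullet> S1 (df Y n) \<oplus> ng (in2 C (S0 E) (S0 (ob Y n)))"
    and qN: "q (Suc n) = ng (pr2 C (S0 E) (S0 (ob Y n)))"
    by (simp_all add: p_def q_def)
  have pS: "p (Suc i) = in1 C (S0 (ob X (Suc i))) (S0 (ob Y i)) \<bullet> S1 (pr2 C (ob Y i) (ob X (Suc i))) \<oplus>
      ng (in2 C (S0 (ob X (Suc i))) (S0 (ob Y i)) \<bullet> S1 (pr1 C (ob Y i) (ob X (Suc i))))"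
    and qS: "q (Suc i) = S1 (in2 C (ob Y i) (ob X (Suc i))) \<bullet> pr1 C (S0 (ob X (Suc i))) (S0 (ob Y i)) \<oplus>
      ng (S1 (in1 C (ob Y i) (ob X (Suc i))) \<bullet> pr2 C (S0 (ob X (Suc i))) (S0 (ob Y i)))"
    if "i < n" for i using that by (simp_all add: p_def q_def)
  have sN': "sigma_seq C n S (N', \<mu>')"
    using sigma_seqD[OF sN] by (simp add: sigma_seq_iff obN' dN' \<mu>')
  note sL = angle_seq[OF L\<Theta>]
  have pq_typ: "arr (p i) \<and> dm (p i) = ob N' i \<and> cd (p i) = ob L i \<and> arr (q i) \<and> dm (q i) = ob L i \<and> cd (q i) = ob N' i \<and>
      q i \<bullet> p i = Id C (ob N' i)" if "i \<le> Suc n" for i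
  proof -
    consider "i = 0" | "i = Suc n" | j where "i = Suc j" "j < n"
    proof (cases i)
      case (Suc k)
      then have "k = n \<or> k < n" using \<open>i \<le> Suc n\<close> by auto
      then show ?thesis using Suc that by blast
    qed (use that in blast)
    then show ?thesis
    proof cases
      case 1
      then show ?thesis by (simp add: p0 q0 obN' L0 N0)
    next
      case 2
      have "ob L (Suc n) = bsum C (S0 E) (S0 (ob Y n))" by (simp add: LS)
      then show ?thesis using 2 ends' by (simp add: pN qN obN' NS)
    next
      case 3
      have "S1 (in2 C A B) \<bullet> S1 (pr2 C A B) \<oplus> S1 (in1 C A B) \<bullet> S1 (pr1 C A B) = Id C (S0 (bsum C A B))"
        if "A \<in> Ob C" "B \<in> Ob C" for A B
        using S_bip_Id[OF that] that by (subst pls_comm) simp_all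
      then show ?thesis using 3 Ni[of j] by (simp add: pS qS obN' LS)
    qed
  qed
  have chain: "df L i \<bullet> p i = p (Suc i) \<bullet> df N' i \<and> df N' i \<bullet> q i = q (Suc i) \<bullet> df L i" if "i \<le> n" for i
  proof -
    consider "i = 0" | j where "i = Suc j" "Suc j < n" | j where "i = n" "n = Suc j"
    proof (cases i)
      case (Suc k)
      then have "Suc k = n \<or> Suc k < n" using \<open>i \<le> n\<close> by auto
      then show ?thesis using Suc that by blast
    qed (use that in blast)
    then show ?thesis
    proof cases
      case 1
      have n0: "0 < n" using n_ge_1 by simp
      have "df L 0 \<bullet> p 0 = p (Suc 0) \<bullet> df N' 0"
        using a ends' n0 by (simp add: p0 pS dL0 dN' dN0; simp add: pls_ac)
      moreover have "df N' 0 \<bullet> q 0 = q (Suc 0) \<bullet> df L 0"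
        using a ends' n0
        by (simp add: q0 qS dL0 dN' dN0; simp add: Xd; simp add: pls_ac)
      ultimately show ?thesis using 1 by simp
    next
      case (2 j)
      then have j: "j < n" "Suc j \<le> n" "j \<le> n" by simp_all
      have "df L (Suc j) \<bullet> p (Suc j) = p (Suc (Suc j)) \<bullet> df N' (Suc j)"
        unfolding pS[OF j(1)] pS[OF 2(2)] dLS[OF j(2)] dN' dNi[OF 2(2)]
        by (rule cocone_square) (use j in simp_all)
      moreover have "df N' (Suc j) \<bullet> q (Suc j) = q (Suc (Suc j)) \<bullet> df L (Suc j)"
        unfolding qS[OF j(1)] qS[OF 2(2)] dLS[OF j(2)] dN' dNi[OF 2(2)]
        by (rule cocone_square) (use j in simp_all)
      ultimately show ?thesis using 2 by simp
    next
      case (3 j)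
      then have j: "j < n" "Suc j \<le> n" "j \<le> n" by simp_all
      have En: "ob X (Suc (Suc j)) = E" "ob Y (Suc j) = ob Y n" "df Y (Suc j) = df Y n"
         "f (Suc j) = f n" "df X (Suc j) = df X n" "ob X (Suc j) = ob X n"
        by (simp_all add: 3(2)[symmetric])
      have tj: "cd (df Y j) = ob Y n" using j by (simp add: 3(2)[symmetric])
      have YYj: "S1 (df Y n) \<bullet> S1 (df Y j) \<bullet> u = zmor C (dm u) (S0 E)"
        if "arr u" "cd u = S0 (ob Y j)" for u
        using YY[of j u] that j ends' by (simp add: 3(2)[symmetric])
      have dLn: "df L n = in1 C (S0 E) (S0 (ob Y n)) \<bullet> ng (S1 (df X n)) \<bullet> pr1 C (S0 (ob X n)) (S0 (ob Y j)) \<oplus>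
          in2 C (S0 E) (S0 (ob Y n)) \<bullet>
           (S1 (f n) \<bullet> pr1 C (S0 (ob X n)) (S0 (ob Y j)) \<oplus> S1 (df Y j) \<bullet> pr2 C (S0 (ob X n)) (S0 (ob Y j)))"
        using dLS[OF j(2)] unfolding En by (simp only: 3(2)[symmetric])
      have dNn': "df N n = ng (df Y j) \<bullet> pr1 C (ob Y j) (ob X n) \<oplus> f n \<bullet> pr2 C (ob Y j) (ob X n)"
        using dNn[OF 3(2)] unfolding En .
      have pn: "p n = in1 C (S0 (ob X n)) (S0 (ob Y j)) \<bullet> S1 (pr2 C (ob Y j) (ob X n)) \<oplus>
          ng (in2 C (S0 (ob X n)) (S0 (ob Y j)) \<bullet> S1 (pr1 C (ob Y j) (ob X n)))"
        and qn: "q n = S1 (in2 C (ob Y j) (ob X n)) \<bullet> pr1 C (S0 (ob X n)) (S0 (ob Y j)) \<oplus>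
          ng (S1 (in1 C (ob Y j) (ob X n)) \<bullet> pr2 C (S0 (ob X n)) (S0 (ob Y j)))"
        using pS[OF j(1)] qS[OF j(1)] unfolding En by (simp_all only: 3(2)[symmetric])
      have tf: "arr (df Y j)" "dm (df Y j) = ob Y j" "ob Y j \<in> Ob C" "ob X n \<in> Ob C"
        "ob Y (Suc n) = E" using j ends' by simp_all
      have "df L n \<bullet> p n = p (Suc n) \<bullet> df N' n"
        using tf tj
        by (simp add: pn pN dLn dN' dNn'; simp add: fX YYj; simp add: pls_ac)
      moreover have "df N' n \<bullet> q n = q (Suc n) \<bullet> df L n"
        using tf tj
        by (simp add: qn qN dLn dN' dNn'; simp add: pls_ac)
      ultimately show ?thesis using 3 by simp
    qed
  qed
  have tn: "ob Y (Suc n) = E" using ends' by simp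
  have kp: "\<kappa> \<bullet> p (Suc n) = S1 (p 0) \<bullet> \<mu>'"
    using tn by (simp add: \<kappa> pN p0 \<mu>' \<mu>_def; simp add: pls_ac)
  have kq: "\<mu>' \<bullet> q (Suc n) = S1 (q 0) \<bullet> \<kappa>"
    using tn by (simp add: \<kappa> qN q0 \<mu>' \<mu>_def; simp add: pls_ac)
  have "sigma_map C n S (N', \<mu>') (L, \<kappa>) p"
    unfolding sigma_map_iff[OF sN' sL] using pq_typ chain kp by simp
  moreover have "sigma_map C n S (L, \<kappa>) (N', \<mu>') q"
    unfolding sigma_map_iff[OF sL sN'] using pq_typ chain kq by simp
  ultimately have "sigma_summand C n S (N', \<mu>') (L, \<kappa>)"
    unfolding sigma_summand_def using pq_typ by auto
  then have "(N', \<mu>') \<in> \<Theta>" using F1_summand[OF L\<Theta> sN'] by blast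
  then have "(N, \<mu>) \<in> \<Theta>" using susp_neg_angle_iff[OF sN] N' by simp
  then show ?thesis using sf f0 fS by (auto simp: N_def \<mu>_def)
qed

section \<open>Ghost extensions\<close>

lemma angle_with_deflation:
  assumes f: "arr f"
  shows "\<exists>X \<delta>. (X, \<delta>) \<in> \<Theta> \<and> df X n = f"
proof -
  obtain Y where Y: "(Y, S1 f) \<in> \<Theta>"
    using angle_with_last[of "S1 f" "cd f"] f by auto
  have "S1inv (S1 f) = f" using f by - (rule S1_inj, simp_all)
  then show ?thesis using unshift[OF Y] by auto
qed

text \<open>
  In terms of extensions, \<open>\<Sigma>g \<delta>\<close> is the pushout \<open>g\<^sub>* \<delta>\<close>.
\<close>

definition ghost :: "'o set \<Rightarrow> 'o \<Rightarrow> 'm \<Rightarrow> bool" where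
  "ghost H A \<delta> \<longleftrightarrow> (\<forall>g. arr g \<and> dm g = A \<and> cd g \<in> H \<longrightarrow> S1 g \<bullet> \<delta> = zmor C (dm \<delta>) (S0 (cd g)))"

lemma ghostD: "\<lbrakk>ghost H A \<delta>; arr g; dm g = A; cd g \<in> H\<rbrakk> \<Longrightarrow> S1 g \<bullet> \<delta> = zmor C (dm \<delta>) (S0 (cd g))"
  by (simp add: ghost_def)

lemma ghost_zmor [simp]: "\<lbrakk>A \<in> Ob C; D \<in> Ob C\<rbrakk> \<Longrightarrow> ghost H A (zmor C D (S0 A))"
  by (auto simp: ghost_def)

lemma ghost_pls:
  assumes "ghost H A \<delta>" "ghost H A \<epsilon>" "arr \<delta>" "arr \<epsilon>" "dm \<delta> = dm \<epsilon>" "cd \<delta> = S0 A" "cd \<epsilon> = S0 A"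
  shows "ghost H A (\<delta> \<oplus> \<epsilon>)"
  using assms by (auto simp: ghost_def)

lemma ghost_ng:
  assumes "ghost H A \<delta>" "arr \<delta>" "cd \<delta> = S0 A"
  shows "ghost H A (ng \<delta>)"
  using assms by (auto simp: ghost_def)

lemma ghost_pull:
  assumes "ghost H A \<delta>" "arr \<delta>" "cd \<delta> = S0 A" "arr c" "cd c = dm \<delta>"
  shows "ghost H A (\<delta> \<bullet> c)"
  unfolding ghost_def
proof (intro allI impI, elim conjE)
  fix g assume g: "arr g" "dm g = A" "cd g \<in> H"
  have "S1 g \<bullet> \<delta> \<bullet> c = (S1 g \<bullet> \<delta>) \<bullet> c" using assms g by simp
  also have "\<dots> = zmor C (dm (\<delta> \<bullet> c)) (S0 (cd g))" using ghostD[OF assms(1) g] assms g by simp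
  finally show "S1 g \<bullet> \<delta> \<bullet> c = zmor C (dm (\<delta> \<bullet> c)) (S0 (cd g))" .
qed

lemma ghost_push:
  assumes "ghost H A \<delta>" "arr \<delta>" "cd \<delta> = S0 A" "arr a" "dm a = A"
  shows "ghost H (cd a) (S1 a \<bullet> \<delta>)"
  unfolding ghost_def
proof (intro allI impI, elim conjE)
  fix g assume g: "arr g" "dm g = cd a" "cd g \<in> H"
  have "S1 g \<bullet> S1 a \<bullet> \<delta> = S1 (g \<bullet> a) \<bullet> \<delta>" using assms g by simp
  also have "\<dots> = zmor C (dm (S1 a \<bullet> \<delta>)) (S0 (cd g))" using ghostD[OF assms(1), of "g \<bullet> a"] assms g by simp
  finally show "S1 g \<bullet> S1 a \<bullet> \<delta> = zmor C (dm (S1 a \<bullet> \<delta>)) (S0 (cd g))" .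
qed

lemma hom_epi_iff:
  assumes H: "H \<subseteq> Ob C" and f: "arr f" "dm f = A" "cd f = B"
  shows "hom_epi C H A B f \<longleftrightarrow> (\<forall>g. arr g \<and> dm g = A \<and> cd g \<in> H \<longrightarrow>
    (\<exists>h. arr h \<and> dm h = B \<and> cd h = cd g \<and> g = h \<bullet> f))"
proof -
  have AB [simp]: "A \<in> Ob C" "B \<in> Ob C" using f by auto
  have "(\<lambda>h. h \<bullet> f) ` mor C B K = mor C A K \<longleftrightarrow>
      (\<forall>g. arr g \<and> dm g = A \<and> cd g = K \<longrightarrow> (\<exists>h. arr h \<and> dm h = B \<and> cd h = K \<and> g = h \<bullet> f))"
    if K: "K \<in> H" for K
  proof -
    have KO [simp]: "K \<in> Ob C" using H K by blast
    have mB: "h \<in> mor C B K \<longleftrightarrow> arr h \<and> dm h = B \<and> cd h = K"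
      and mA: "h \<in> mor C A K \<longleftrightarrow> arr h \<and> dm h = A \<and> cd h = K" for h
      by simp_all
    have "(\<lambda>h. h \<bullet> f) ` mor C B K \<subseteq> mor C A K" using f by (simp add: image_subset_iff)
    then have "(\<lambda>h. h \<bullet> f) ` mor C B K = mor C A K \<longleftrightarrow> (\<forall>g\<in>mor C A K. \<exists>h\<in>mor C B K. g = h \<bullet> f)"
      by (simp only: set_eq_subset image_iff subset_iff) blast
    then show ?thesis unfolding Ball_def Bex_def mA mB by metis
  qed
  then have "hom_epi C H A B f \<longleftrightarrow> (\<forall>K\<in>H. \<forall>g. arr g \<and> dm g = A \<and> cd g = K \<longrightarrow>
      (\<exists>h. arr h \<and> dm h = B \<and> cd h = K \<and> g = h \<bullet> f))"
    unfolding hom_epi_def by (rule ball_cong[OF refl])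
  then show ?thesis by blast
qed

text \<open>
  Exactness at \<open>X\<^sup>0\<close>: a morphism \<open>g\<close> from \<open>X\<^sup>0\<close> factors through \<open>d\<^sup>0\<close> if and only if \<open>\<Sigma>g \<delta> = 0\<close>.
  So membership in \<open>\<xi>\<close> depends on the extension alone.
\<close>

lemma hom_epi_ghost:
  assumes X: "(X, \<delta>) \<in> \<Theta>" and H: "H \<subseteq> Ob C"
  shows "hom_epi C H (ob X 0) (ob X 1) (df X 0) \<longleftrightarrow> ghost H (ob X 0) \<delta>"
proof -
  note D [simp] = angleD[OF X]
  have O1: "ob X (Suc 0) \<in> Ob C" by simp
  have "(\<exists>h. arr h \<and> dm h = ob X 1 \<and> cd h = cd g \<and> g = h \<bullet> df X 0) \<longleftrightarrow>
      S1 g \<bullet> \<delta> = zmor C (dm \<delta>) (S0 (cd g))" if g: "arr g" "dm g = ob X 0" for g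
  proof
    assume "\<exists>h. arr h \<and> dm h = ob X 1 \<and> cd h = cd g \<and> g = h \<bullet> df X 0"
    then obtain h where h: "arr h" "dm h = ob X (Suc 0)" "g = h \<bullet> df X 0" by auto
    show "S1 g \<bullet> \<delta> = zmor C (dm \<delta>) (S0 (cd g))"
      unfolding h(3) using h(1,2) O1 angle_zero(3)[OF X] by simp
  next
    assume "S1 g \<bullet> \<delta> = zmor C (dm \<delta>) (S0 (cd g))"
    then show "\<exists>h. arr h \<and> dm h = ob X 1 \<and> cd h = cd g \<and> g = h \<bullet> df X 0"
      using angle_right_exact(3)[OF X g] by simp
  qed
  note * = this
  have D0: "arr (df X 0)" "dm (df X 0) = ob X 0" "cd (df X 0) = ob X 1" by simp_all
  show ?thesis unfolding hom_epi_iff[OF H D0] ghost_def using * by blast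
qed

abbreviation "Xi H \<equiv> hom_epi_class C \<Theta> H"
abbreviation "E_ang \<equiv> angulated_bifunctor C S"
abbreviation "s_ang \<equiv> angulated_realization C n \<Theta>"
abbreviation "E_rel H \<equiv> sub_bifunctor n E_ang s_ang C (Xi H)"
abbreviation "s_rel H \<equiv> sub_realization n E_ang s_ang C (Xi H)"

lemma Xi_iff_ghost:
  "H \<subseteq> Ob C \<Longrightarrow> (X, \<delta>) \<in> Xi H \<longleftrightarrow> (X, \<delta>) \<in> \<Theta> \<and> ghost H (ob X 0) \<delta>"
  using hom_epi_ghost by (auto simp: hom_epi_class_def)

lemma E_ang_simps [simp]:
  "Ext E_ang D A = Hom C D (S0 A)" "push E_ang D a \<delta> = S1 a \<bullet> \<delta>" "pull E_ang A c \<delta> = \<delta> \<bullet> c"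
  by (simp_all add: angulated_bifunctor_def)

lemma E_rel_simps [simp]:
  "push (E_rel H) D a \<delta> = S1 a \<bullet> \<delta>" "pull (E_rel H) A c \<delta> = \<delta> \<bullet> c"
  "one (Ext (E_rel H) D A) = zmor C D (S0 A)" "mult (Ext (E_rel H) D A) = mult (Hom C D (S0 A))"
  by (simp_all add: sub_bifunctor_def)

lemma E_rel_carrier:
  assumes H: "H \<subseteq> Ob C" and [simp]: "D \<in> Ob C" "A \<in> Ob C"
  shows "\<delta> \<in> carrier (Ext (E_rel H) D A) \<longleftrightarrow> arr \<delta> \<and> dm \<delta> = D \<and> cd \<delta> = S0 A \<and> ghost H A \<delta>"
proof -
  have "\<exists>X. (X, \<delta>) \<in> \<Theta> \<and> ob X 0 = A \<and> ob X (Suc n) = D" if "arr \<delta>" "dm \<delta> = D" "cd \<delta> = S0 A"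
    using angle_with_last[OF that(1,3)] that by simp
  then show ?thesis
    using Xi_iff_ghost[OF H] by (auto simp: sub_bifunctor_def distinguished_iff)
qed

text \<open>
  Restricting the extensions to ghosts restricts the distinguished \<open>n\<close>-exangles to \<open>\<xi>\<close>, so each
  axiom for the relative structure is the one for angles plus closure of ghosts under an operation.
\<close>

lemma distinguished_Xi:
  assumes H: "H \<subseteq> Ob C"
  shows "distinguished C n (E_rel H) (s_rel H) (X, \<delta>) \<longleftrightarrow> (X, \<delta>) \<in> Xi H"
proof -
  have "\<delta> \<in> carrier (Ext (E_rel H) (ob X (Suc n)) (ob X 0)) \<longleftrightarrow>
      arr \<delta> \<and> dm \<delta> = ob X (Suc n) \<and> cd \<delta> = S0 (ob X 0) \<and> ghost H (ob X 0) \<delta>"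
    if "cplx C (Suc n) X"
    using E_rel_carrier[OF H, of "ob X (Suc n)" "ob X 0" \<delta>] that by (simp add: cplx_iff typed_seq_def)
  moreover have "cplx C (Suc n) X \<Longrightarrow> ob X (Suc n) \<in> Ob C \<and> ob X 0 \<in> Ob C" by (simp add: cplx_iff typed_seq_def)
  ultimately show ?thesis
    using distinguished_iff[of X \<delta>] Xi_iff_ghost[OF H, of X \<delta>]
    by (auto simp: distinguished_def sub_realization_def)
qed

text \<open>
  A morphism into \<open>\<Sigma>K\<close> that vanishes on \<open>d\<^sup>n\<close> factors through \<open>\<delta>\<close> by exactness, and the other
  factor is \<open>\<Sigma>k\<close> with \<open>k : X\<^sup>0 \<rightarrow> K\<close>, which kills the ghost \<open>\<delta>\<close>.  In other words, relative
  deflations are epimorphic for morphisms into \<open>\<Sigma>H\<close>.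
\<close>

lemma ghost_descends:
  assumes X: "(X, \<delta>) \<in> \<Theta>" "ghost H (ob X 0) \<delta>" and H: "H \<subseteq> Ob C"
    and u: "arr u" "dm u = ob X (Suc n)" "cd u = S0 K" "K \<in> H"
    and 0: "u \<bullet> df X n = zmor C (ob X n) (S0 K)"
  shows "u = zmor C (dm u) (S0 K)"
proof -
  note D [simp] = angleD[OF X(1)]
  have K: "K \<in> Ob C" using H u by blast
  obtain h where h: "arr h" "dm h = S0 (ob X 0)" "cd h = S0 K" "u = h \<bullet> \<delta>"
    using angle_right_exact(2)[OF X(1) u(1,2)] u 0 by auto
  obtain k where "arr k" "dm k = ob X 0" "cd k = K" "S1 k = h"
    using S1_surj[OF h(1-3)] K D(2) by blast
  then show ?thesis using ghostD[OF X(2), of k] h u by simp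
qed

text \<open>
  For \<open>g : Z\<^sup>0 \<rightarrow> K\<close> with \<open>K\<close> in \<open>H\<close>, the morphism \<open>\<Sigma>g \<sigma>\<close> vanishes on \<open>d\<^sub>Z\<^sup>n c = d\<^sub>Y\<^sup>n d\<^sub>X\<^sup>n\<close>, and
  the two relative deflations can be cancelled one after the other.  With \<open>c = 1\<close> this also
  shows that relative deflations compose.
\<close>

lemma deflation_saturated:
  assumes H: "H \<subseteq> Ob C" and X: "(X, \<delta>) \<in> Xi H" and Y: "(Y, \<rho>) \<in> Xi H" and Z: "(Z, \<sigma>) \<in> \<Theta>"
    and XY: "ob X (Suc n) = ob Y n" and YZ: "ob Y (Suc n) = ob Z (Suc n)"
    and c: "arr c" "dm c = ob X n" "cd c = ob Z n" and eq: "df Y n \<bullet> df X n = df Z n \<bullet> c"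
  shows "(Z, \<sigma>) \<in> Xi H"
proof -
  have X': "(X, \<delta>) \<in> \<Theta>" "ghost H (ob X 0) \<delta>" and Y': "(Y, \<rho>) \<in> \<Theta>" "ghost H (ob Y 0) \<rho>"
    using X Y Xi_iff_ghost[OF H] by auto
  note DX [simp] = angleD[OF X'(1)] and DY [simp] = angleD[OF Y'(1)] and DZ [simp] = angleD[OF Z]
  have "S1 g \<bullet> \<sigma> = zmor C (dm \<sigma>) (S0 (cd g))" if g: "arr g" "dm g = ob Z 0" "cd g \<in> H" for g
  proof -
    define u where "u = S1 g \<bullet> \<sigma>"
    have u: "arr u" "dm u = ob Y (Suc n)" "cd u = S0 (cd g)" using g YZ by (simp_all add: u_def)
    have K: "cd g \<in> Ob C" using g by simp
    have "u \<bullet> df Y n \<bullet> df X n = (S1 g \<bullet> \<sigma>) \<bullet> df Z n \<bullet> c" by (simp add: u_def eq)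
    also have "\<dots> = S1 g \<bullet> (\<sigma> \<bullet> df Z n) \<bullet> c" using g c by simp
    also have "\<dots> = zmor C (ob X n) (S0 (cd g))"
      unfolding angle_zero(2)[OF Z] using g c by simp
    finally have 0: "(u \<bullet> df Y n) \<bullet> df X n = zmor C (ob X n) (S0 (cd g))"
      using u XY by simp
    have "u \<bullet> df Y n = zmor C (dm (u \<bullet> df Y n)) (S0 (cd g))"
      by (rule ghost_descends[OF X' H]) (use u XY g 0 in simp_all)
    then have "u = zmor C (dm u) (S0 (cd g))"
      by (intro ghost_descends[OF Y' H]) (use u g in simp_all)
    then show ?thesis using u YZ by (simp add: u_def)
  qed
  then have "ghost H (ob Z 0) \<sigma>" by (simp add: ghost_def)
  then show ?thesis using Z Xi_iff_ghost[OF H] by simp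
qed

lemma inflation_Xi:
  assumes H: "H \<subseteq> Ob C" and f: "arr f"
  shows "inflation C n (E_rel H) (s_rel H) f \<longleftrightarrow> hom_epi C H (dm f) (cd f) f"
proof
  assume "inflation C n (E_rel H) (s_rel H) f"
  then obtain X \<delta> where X: "(X, \<delta>) \<in> Xi H" "f = df X 0"
    unfolding inflation_def distinguished_Xi[OF H] by blast
  then have "(X, \<delta>) \<in> \<Theta>" "hom_epi C H (ob X 0) (ob X 1) (df X 0)" by (auto simp: hom_epi_class_def)
  with angleD[OF this(1)] X(2) show "hom_epi C H (dm f) (cd f) f" by simp
next
  assume he: "hom_epi C H (dm f) (cd f) f"
  obtain X \<delta> where "(X, \<delta>) \<in> \<Theta>" "ob X 0 = dm f" "ob X 1 = cd f" "df X 0 = f"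
    using F1_first[of "dm f" "cd f" f] f by auto
  then have "(X, \<delta>) \<in> Xi H" using he by (simp add: hom_epi_class_def)
  then show "inflation C n (E_rel H) (s_rel H) f"
    unfolding inflation_def distinguished_Xi[OF H] using \<open>df X 0 = f\<close> by blast
qed

lemma hom_epi_comp:
  assumes H: "H \<subseteq> Ob C" and fg: "arr f" "arr g" "cd f = dm g"
    and f: "hom_epi C H (dm f) (cd f) f" and g: "hom_epi C H (dm g) (cd g) g"
  shows "hom_epi C H (dm f) (cd g) (g \<bullet> f)"
proof -
  have "\<exists>h. arr h \<and> dm h = cd g \<and> cd h = cd x \<and> x = h \<bullet> (g \<bullet> f)"
    if x: "arr x" "dm x = dm f" "cd x \<in> H" for x
  proof -
    obtain y where y: "arr y" "dm y = cd f" "cd y = cd x" "x = y \<bullet> f"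
      using f[unfolded hom_epi_iff[OF H fg(1) refl refl]] x by blast
    obtain z where z: "arr z" "dm z = cd g" "cd z = cd y" "y = z \<bullet> g"
      using g[unfolded hom_epi_iff[OF H fg(2) refl refl]] x y(1-3) fg(3) by auto
    have "x = z \<bullet> (g \<bullet> f)" unfolding y(4) z(4) using z(1,2) fg by simp
    moreover have "cd z = cd x" using z(3) y(3) by (rule trans)
    ultimately show ?thesis using z(1,2) by (intro exI[of _ z] conjI)
  qed
  then show ?thesis using fg by (simp add: hom_epi_iff[OF H])
qed

lemma additive_bifunctor_E_rel:
  assumes H: "H \<subseteq> Ob C"
  shows "additive_bifunctor C (E_rel H)"
proof -
  have group: "comm_group (Ext (E_rel H) D A)" if [simp]: "D \<in> Ob C" "A \<in> Ob C" for D A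
  proof -
    interpret G: comm_group "Hom C D (S0 A)" by (rule hom_group) simp_all
    have "subgroup (carrier (Ext (E_rel H) D A)) (Hom C D (S0 A))"
    proof
      show "carrier (Ext (E_rel H) D A) \<subseteq> mor C D (S0 A)" by (auto simp: E_rel_carrier[OF H])
      show "zmor C D (S0 A) \<in> carrier (Ext (E_rel H) D A)" by (simp add: E_rel_carrier[OF H])
      show "x \<otimes>\<^bsub>Hom C D (S0 A)\<^esub> y \<in> carrier (Ext (E_rel H) D A)"
        if "x \<in> carrier (Ext (E_rel H) D A)" "y \<in> carrier (Ext (E_rel H) D A)" for x y
        using that by (simp add: E_rel_carrier[OF H] mult_pls ghost_pls)
      show "inv\<^bsub>Hom C D (S0 A)\<^esub> x \<in> carrier (Ext (E_rel H) D A)"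
        if "x \<in> carrier (Ext (E_rel H) D A)" for x
        using that by (simp add: E_rel_carrier[OF H] inv_ng ghost_ng)
    qed
    then have "group (Ext (E_rel H) D A)"
      using G.subgroup_imp_group by (simp add: sub_bifunctor_def)
    then show ?thesis
      by (rule group.group_comm_groupI) (simp add: E_rel_carrier[OF H] mult_pls pls_comm)
  qed
  show ?thesis
    unfolding additive_bifunctor_def
  proof (intro conjI ballI)
    fix D A A' a assume "D \<in> Ob C" "A \<in> Ob C" "A' \<in> Ob C" "a \<in> mor C A A'"
    then show "push (E_rel H) D a \<in> hom (Ext (E_rel H) D A) (Ext (E_rel H) D A')"
      using ghost_push[of H A _ a] by (auto simp: hom_def E_rel_carrier[OF H] mult_pls)
  next
    fix A D D' c assume "A \<in> Ob C" "D \<in> Ob C" "D' \<in> Ob C" "c \<in> mor C D' D"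
    then show "pull (E_rel H) A c \<in> hom (Ext (E_rel H) D A) (Ext (E_rel H) D' A)"
      using ghost_pull[of H A _ c] by (auto simp: hom_def E_rel_carrier[OF H] mult_pls)
  qed (auto simp: E_rel_carrier[OF H] mult_pls group)
qed

text \<open>
  The required exactness is that of the angle: passing to a subfunctor of the extensions does not
  change which of them are zero.
\<close>

lemma exangle_Xi:
  assumes H: "H \<subseteq> Ob C" and X: "(X, \<delta>) \<in> Xi H"
  shows "exangle C n (E_rel H) (X, \<delta>)"
proof -
  have X': "(X, \<delta>) \<in> \<Theta>" and gh: "ghost H (ob X 0) \<delta>" using X Xi_iff_ghost[OF H] by auto
  note D [simp] = angleD[OF X']
  have z: "df X (Suc i) \<bullet> df X i \<bullet> u = zmor C (dm u) (ob X (Suc (Suc i)))"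
    if "i < n" "arr u" "cd u = ob X i" for i u
    using that angle_zero(1)[OF X', of i] by (simp add: cmp_assoc[symmetric] del: cmp_assoc)
  have z2: "\<delta> \<bullet> df X n \<bullet> u = zmor C (dm u) (S0 (ob X 0))" if "arr u" "cd u = ob X n" for u
    using that angle_zero(2)[OF X'] by (simp add: cmp_assoc[symmetric] del: cmp_assoc)
  show ?thesis
    unfolding exangle_def prod.case
  proof (intro conjI ballI allI impI)
    show "cplx C (n + 1) X" using angle_cplx[OF X'] by simp
    show "\<delta> \<in> carrier (Ext (E_rel H) (ob X (n + 1)) (ob X 0))" using gh by (simp add: E_rel_carrier[OF H])
  next
    fix W i g assume W: "W \<in> Ob C" and i: "1 \<le> i \<and> i \<le> n" and g: "g \<in> mor C W (ob X i)"
    obtain j where j: "i = Suc j" using i by (cases i) auto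
    have jn: "j < n" "j \<le> n" "Suc j \<le> n" "Suc j \<le> Suc n" "j \<le> Suc n" using i j by simp_all
    have gt: "arr g" "dm g = W" "cd g = ob X (Suc j)" using g W jn by (simp_all add: j)
    show "df X i \<bullet> g = zmor C W (ob X (i + 1)) \<longleftrightarrow> (\<exists>h\<in>mor C W (ob X (i - 1)). g = df X (i - 1) \<bullet> h)"
    proof
      assume "df X i \<bullet> g = zmor C W (ob X (i + 1))"
      then obtain h where "arr h" "cd h = ob X j" "dm h = dm g" "g = df X j \<bullet> h"
        using angle_left_exact(1)[OF X' gt(1) jn(1) gt(3)] gt(2) j by auto
      then show "\<exists>h\<in>mor C W (ob X (i - 1)). g = df X (i - 1) \<bullet> h"
        using W gt(2) jn j by (intro bexI[of _ h]) simp_all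
    next
      assume "\<exists>h\<in>mor C W (ob X (i - 1)). g = df X (i - 1) \<bullet> h"
      then obtain h where "arr h" "dm h = W" "cd h = ob X j" "g = df X j \<bullet> h" using W jn j by auto
      then show "df X i \<bullet> g = zmor C W (ob X (i + 1))" using z[OF jn(1), of h] j by simp
    qed
  next
    fix W g assume W: "W \<in> Ob C" and g: "g \<in> mor C W (ob X (n + 1))"
    have gt: "arr g" "dm g = W" "cd g = ob X (Suc n)" using g W by simp_all
    show "pull (E_rel H) (ob X 0) g \<delta> = \<one>\<^bsub>Ext (E_rel H) W (ob X 0)\<^esub> \<longleftrightarrow> (\<exists>h\<in>mor C W (ob X n). g = df X n \<bullet> h)"
    proof
      assume "pull (E_rel H) (ob X 0) g \<delta> = \<one>\<^bsub>Ext (E_rel H) W (ob X 0)\<^esub>"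
      then obtain h where "arr h" "cd h = ob X n" "dm h = dm g" "g = df X n \<bullet> h"
        using angle_left_exact(2)[OF X' gt(1) gt(3)] gt(2) by auto
      then show "\<exists>h\<in>mor C W (ob X n). g = df X n \<bullet> h" using W gt(2) by (intro bexI[of _ h]) simp_all
    next
      assume "\<exists>h\<in>mor C W (ob X n). g = df X n \<bullet> h"
      then obtain h where "arr h" "dm h = W" "cd h = ob X n" "g = df X n \<bullet> h" using W by auto
      then show "pull (E_rel H) (ob X 0) g \<delta> = \<one>\<^bsub>Ext (E_rel H) W (ob X 0)\<^esub>" using z2[of h] by simp
    qed
  next
    fix W i g assume W: "W \<in> Ob C" and i: "1 \<le> i \<and> i \<le> n" and g: "g \<in> mor C (ob X i) W"
    obtain j where j: "i = Suc j" using i by (cases i) auto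
    have jn: "j < n" "j \<le> n" "Suc j \<le> n" "Suc j \<le> Suc n" using i j by simp_all
    have gt: "arr g" "dm g = ob X (Suc j)" "cd g = W" using g W jn by (simp_all add: j)
    show "g \<bullet> df X (i - 1) = zmor C (ob X (i - 1)) W \<longleftrightarrow> (\<exists>h\<in>mor C (ob X (i + 1)) W. g = h \<bullet> df X i)"
    proof
      assume "g \<bullet> df X (i - 1) = zmor C (ob X (i - 1)) W"
      then obtain h where "arr h" "dm h = ob X (Suc (Suc j))" "cd h = cd g" "g = h \<bullet> df X (Suc j)"
        using angle_right_exact(1)[OF X' gt(1) jn(1) gt(2)] gt(3) j by auto
      then show "\<exists>h\<in>mor C (ob X (i + 1)) W. g = h \<bullet> df X i"
        using W gt(3) jn j by (intro bexI[of _ h]) simp_all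
    next
      assume "\<exists>h\<in>mor C (ob X (i + 1)) W. g = h \<bullet> df X i"
      then obtain h where "arr h" "dm h = ob X (Suc (Suc j))" "cd h = W" "g = h \<bullet> df X (Suc j)"
        using W jn j by auto
      then show "g \<bullet> df X (i - 1) = zmor C (ob X (i - 1)) W" using angle_zero(1)[OF X' jn(1)] j jn by simp
    qed
  next
    fix W g assume W: "W \<in> Ob C" and g: "g \<in> mor C (ob X 0) W"
    have O1: "ob X (Suc 0) \<in> Ob C" by simp
    have gt: "arr g" "dm g = ob X 0" "cd g = W" using g W by simp_all
    show "push (E_rel H) (ob X (n + 1)) g \<delta> = \<one>\<^bsub>Ext (E_rel H) (ob X (n + 1)) W\<^esub> \<longleftrightarrow>
        (\<exists>h\<in>mor C (ob X 1) W. g = h \<bullet> df X 0)"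
    proof
      assume "push (E_rel H) (ob X (n + 1)) g \<delta> = \<one>\<^bsub>Ext (E_rel H) (ob X (n + 1)) W\<^esub>"
      then obtain h where "arr h" "dm h = ob X (Suc 0)" "cd h = cd g" "g = h \<bullet> df X 0"
        using angle_right_exact(3)[OF X' gt(1,2)] gt(3) by auto
      then show "\<exists>h\<in>mor C (ob X 1) W. g = h \<bullet> df X 0"
        using W O1 gt(3) by (intro bexI[of _ h]) simp_all
    next
      assume "\<exists>h\<in>mor C (ob X 1) W. g = h \<bullet> df X 0"
      then obtain h where "arr h" "dm h = ob X (Suc 0)" "cd h = W" "g = h \<bullet> df X 0" using W O1 by auto
      then show "push (E_rel H) (ob X (n + 1)) g \<delta> = \<one>\<^bsub>Ext (E_rel H) (ob X (n + 1)) W\<^esub>"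
        using angle_zero(3)[OF X'] by simp
    qed
  qed
qed

section \<open>The relative structure is proper and exangulated\<close>

text \<open>
  Being a ghost is transported along the invertible end components, by a pushout in one
  direction and a pullback in the other.
\<close>

lemma Xi_weak_iso:
  assumes H: "H \<subseteq> Ob C" and X: "(X, \<delta>) \<in> \<Theta>" and Y: "(Y, \<rho>) \<in> \<Theta>"
    and f: "exangle_weak_iso C n E_ang (X, \<delta>) (Y, \<rho>) f"
  shows "(X, \<delta>) \<in> Xi H \<longleftrightarrow> (Y, \<rho>) \<in> Xi H"
proof -
  note DX [simp] = angleD[OF X] and DY [simp] = angleD[OF Y]
  have i0: "is_iso C (ob X 0) (ob Y 0) (f 0)" and iS: "is_iso C (ob X (Suc n)) (ob Y (Suc n)) (f (Suc n))"
    and eq: "S1 (f 0) \<bullet> \<delta> = \<rho> \<bullet> f (Suc n)"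
    using f by (simp_all add: exangle_weak_iso_def exangle_map_def)
  obtain g where f0: "arr (f 0)" "dm (f 0) = ob X 0" "cd (f 0) = ob Y 0"
    and g: "arr g" "dm g = ob Y 0" "cd g = ob X 0" "g \<bullet> f 0 = Id C (ob X 0)"
    using i0 by (auto simp: is_iso_def)
  obtain h where fS: "arr (f (Suc n))" "dm (f (Suc n)) = ob X (Suc n)" "cd (f (Suc n)) = ob Y (Suc n)"
    and h: "arr h" "dm h = ob Y (Suc n)" "cd h = ob X (Suc n)" "f (Suc n) \<bullet> h = Id C (ob Y (Suc n))"
    using iS by (auto simp: is_iso_def)
  have "ghost H (ob Y 0) \<rho>" if gh: "ghost H (ob X 0) \<delta>"
  proof -
    have "ghost H (ob Y 0) (\<rho> \<bullet> f (Suc n))"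
      using ghost_push[OF gh, of "f 0"] f0 by (simp add: eq)
    from ghost_pull[OF this, of h] have "ghost H (ob Y 0) (\<rho> \<bullet> f (Suc n) \<bullet> h)" using fS h by simp
    then show ?thesis by (simp add: h(4))
  qed
  moreover have "ghost H (ob X 0) \<delta>" if gh: "ghost H (ob Y 0) \<rho>"
  proof -
    have "ghost H (ob Y 0) (S1 (f 0) \<bullet> \<delta>)"
      unfolding eq by (rule ghost_pull[OF gh]) (simp_all add: fS)
    from ghost_push[OF this, of g] have "ghost H (ob X 0) (S1 g \<bullet> S1 (f 0) \<bullet> \<delta>)" using f0 g by simp
    moreover have "S1 g \<bullet> S1 (f 0) \<bullet> \<delta> = S1 (g \<bullet> f 0) \<bullet> \<delta>" using f0 g(1-3) by simp
    ultimately show ?thesis by (simp add: g(4))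
  qed
  ultimately show ?thesis using X Y Xi_iff_ghost[OF H] by blast
qed

lemma Xi_sum:
  assumes H: "H \<subseteq> Ob C" and X: "(X, \<delta>) \<in> Xi H" and Y: "(Y, \<rho>) \<in> Xi H"
  shows "exangle_sum C n E_ang (X, \<delta>) (Y, \<rho>) \<in> Xi H"
proof -
  have X': "(X, \<delta>) \<in> \<Theta>" "ghost H (ob X 0) \<delta>" and Y': "(Y, \<rho>) \<in> \<Theta>" "ghost H (ob Y 0) \<rho>"
    using X Y Xi_iff_ghost[OF H] by auto
  note DX [simp] = angleD[OF X'(1)] and DY [simp] = angleD[OF Y'(1)]
  define \<omega> where "\<omega> = S1 (in1 C (ob X 0) (ob Y 0)) \<bullet> (\<delta> \<bullet> pr1 C (ob X (Suc n)) (ob Y (Suc n))) \<oplus>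
      S1 (in2 C (ob X 0) (ob Y 0)) \<bullet> (\<rho> \<bullet> pr2 C (ob X (Suc n)) (ob Y (Suc n)))"
  have "exangle_sum C n E_ang (X, \<delta>) (Y, \<rho>) = (seq_sum C X Y, \<omega>)"
    by (simp add: exangle_sum_def Let_def \<omega>_def mult_pls)
  moreover have "sigma_sum C n S (X, \<delta>) (Y, \<rho>) = (seq_sum C X Y, \<omega>)"
    by (simp add: sigma_sum_def sigma_sum_iso_def mats \<omega>_def)
  moreover have "ghost H (ob (seq_sum C X Y) 0) \<omega>"
  proof -
    have "ghost H (cd (in1 C (ob X 0) (ob Y 0)))
        (S1 (in1 C (ob X 0) (ob Y 0)) \<bullet> (\<delta> \<bullet> pr1 C (ob X (Suc n)) (ob Y (Suc n))))"
      by (rule ghost_push[OF ghost_pull[OF X'(2)]]) simp_all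
    moreover have "ghost H (cd (in2 C (ob X 0) (ob Y 0)))
        (S1 (in2 C (ob X 0) (ob Y 0)) \<bullet> (\<rho> \<bullet> pr2 C (ob X (Suc n)) (ob Y (Suc n))))"
      by (rule ghost_push[OF ghost_pull[OF Y'(2)]]) simp_all
    ultimately show ?thesis unfolding \<omega>_def by (intro ghost_pls) (simp_all add: seq_sum_def)
  qed
  ultimately show ?thesis using F1_sum[OF X'(1) Y'(1)] Xi_iff_ghost[OF H] by simp
qed

lemma n_proper_Xi:
  assumes H: "H \<subseteq> Ob C"
  shows "n_proper_class C n E_ang s_ang (Xi H)"
  unfolding n_proper_class_def
proof (intro conjI allI ballI impI; (elim conjE)?)
  show "distinguished C n E_ang s_ang T" if "T \<in> Xi H" for T
    using that distinguished_iff Xi_iff_ghost[OF H] by (cases T) simp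
  show "exangle_sum C n E_ang T U \<in> Xi H" if "T \<in> Xi H" "U \<in> Xi H" for T U
    using that Xi_sum[OF H] by (cases T; cases U) simp
next
  fix X assume "distinguished C n E_ang s_ang (X, \<one>\<^bsub>Ext E_ang (ob X (n + 1)) (ob X 0)\<^esub>)"
  then have "(X, zmor C (ob X (Suc n)) (S0 (ob X 0))) \<in> \<Theta>" using distinguished_iff by simp
  with angleD[OF this] show "(X, \<one>\<^bsub>Ext E_ang (ob X (n + 1)) (ob X 0)\<^esub>) \<in> Xi H"
    using Xi_iff_ghost[OF H] by simp
next
  fix T U f assume *: "distinguished C n E_ang s_ang T" "distinguished C n E_ang s_ang U" "exangle_weak_iso C n E_ang T U f"
  obtain X \<delta> Y \<rho> where "T = (X, \<delta>)" "U = (Y, \<rho>)" by (metis surj_pair)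
  then show "T \<in> Xi H \<longleftrightarrow> U \<in> Xi H" using * Xi_weak_iso[OF H] distinguished_iff by blast
next
  fix X \<delta> B c Y
  assume X: "(X, \<delta>) \<in> Xi H" and B: "B \<in> Ob C" and c: "c \<in> mor C B (ob X (n + 1))"
    and Y: "ob Y 0 = ob X 0" "distinguished C n E_ang s_ang (Y, pull E_ang (ob X 0) c \<delta>)"
  have X': "(X, \<delta>) \<in> \<Theta>" "ghost H (ob X 0) \<delta>" using X Xi_iff_ghost[OF H] by auto
  note DX [simp] = angleD[OF X'(1)]
  have "ghost H (ob X 0) (\<delta> \<bullet> c)" by (rule ghost_pull[OF X'(2)]) (use B c in simp_all)
  then show "(Y, pull E_ang (ob X 0) c \<delta>) \<in> Xi H" using Y Xi_iff_ghost[OF H] distinguished_iff by simp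
next
  fix X \<delta> B a Y
  assume X: "(X, \<delta>) \<in> Xi H" and B: "B \<in> Ob C" and a: "a \<in> mor C (ob X 0) B"
    and Y: "ob Y 0 = B" "distinguished C n E_ang s_ang (Y, push E_ang (ob X (n + 1)) a \<delta>)"
  have X': "(X, \<delta>) \<in> \<Theta>" "ghost H (ob X 0) \<delta>" using X Xi_iff_ghost[OF H] by auto
  note DX [simp] = angleD[OF X'(1)]
  have "ghost H (cd a) (S1 a \<bullet> \<delta>)" by (rule ghost_push[OF X'(2)]) (use B a in simp_all)
  then show "(Y, push E_ang (ob X (n + 1)) a \<delta>) \<in> Xi H"
    using B a Y Xi_iff_ghost[OF H] distinguished_iff by simp
next
  fix A B D K a b c d
  assume O: "A \<in> Ob C" "B \<in> Ob C" "D \<in> Ob C" "K \<in> Ob C"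
    and m: "a \<in> mor C A B" "b \<in> mor C B D" "c \<in> mor C A K" "d \<in> mor C K D"
    and eq: "b \<bullet> a = d \<bullet> c" and d: "deflation C n E_ang s_ang d"
    and ex: "\<exists>(X, \<delta>)\<in>Xi H. a = df X n" "\<exists>(X, \<delta>)\<in>Xi H. b = df X n"
  obtain X \<delta> where X: "(X, \<delta>) \<in> Xi H" "a = df X n" using ex(1) by blast
  obtain Y \<rho> where Y: "(Y, \<rho>) \<in> Xi H" "b = df Y n" using ex(2) by blast
  obtain Z \<sigma> where Z: "(Z, \<sigma>) \<in> \<Theta>" "d = df Z n" using d distinguished_iff unfolding deflation_def by blast
  have X': "(X, \<delta>) \<in> \<Theta>" and Y': "(Y, \<rho>) \<in> \<Theta>" using X Y Xi_iff_ghost[OF H] by auto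
  have n: "n \<le> n" by simp
  have oX: "ob X n = A" "ob X (Suc n) = B" using angleD(4,5)[OF X' n] m(1) O by (simp_all add: X(2))
  have oY: "ob Y n = B" "ob Y (Suc n) = D" using angleD(4,5)[OF Y' n] m(2) O by (simp_all add: Y(2))
  have oZ: "ob Z n = K" "ob Z (Suc n) = D" using angleD(4,5)[OF Z(1) n] m(4) O by (simp_all add: Z(2))
  have "(Z, \<sigma>) \<in> Xi H"
    by (rule deflation_saturated[OF H X(1) Y(1) Z(1), where c = c])
      (use m(3) O eq in \<open>simp_all add: oX oY oZ X(2) Y(2) Z(2)\<close>)
  then show "\<exists>(X, \<delta>)\<in>Xi H. d = df X n" using Z(2) by blast
qed

lemma sigma_map_chain_map: "sigma_map C n S (X, \<delta>) (Y, \<rho>) f \<Longrightarrow> chain_map C (n + 1) X Y f"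
  by (simp add: sigma_map_def)

lemma n_exangulated_Xi:
  assumes H: "H \<subseteq> Ob C"
  shows "n_exangulated_category C n (E_rel H) (s_rel H)"
proof (intro n_exangulated_category.intro n_exangulated_category_axioms.intro)
  show "additive_category C" by (rule additive_category_axioms)
  show "1 \<le> n" by (rule n_ge_1)
  show "additive_bifunctor C (E_rel H)" by (rule additive_bifunctor_E_rel[OF H])
next
  fix A D \<delta> assume AD: "A \<in> Ob C" "D \<in> Ob C" and "\<delta> \<in> carrier (Ext (E_rel H) D A)"
  then have \<delta>: "arr \<delta>" "dm \<delta> = D" "cd \<delta> = S0 A" "ghost H A \<delta>" using E_rel_carrier[OF H AD(2,1)] by simp_all
  obtain X where X: "(X, \<delta>) \<in> \<Theta>" "ob X 0 = A" "ob X (Suc n) = D"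
    using angle_with_last[OF \<delta>(1,3) AD(1)] \<delta>(2) by auto
  then have "distinguished C n (E_rel H) (s_rel H) (X, \<delta>)"
    using distinguished_Xi[OF H] Xi_iff_ghost[OF H] \<delta>(4) by simp
  then show "\<exists>X. cplx C (n + 1) X \<and> ob X 0 = A \<and> ob X (n + 1) = D \<and> s_rel H D A \<delta> = hclass C (n + 1) X"
    using X by (intro exI[of _ X]) (simp add: distinguished_def)
next
  fix X \<delta> Y \<rho> a c
  assume d: "distinguished C n (E_rel H) (s_rel H) (X, \<delta>)" "distinguished C n (E_rel H) (s_rel H) (Y, \<rho>)"
    and m: "a \<in> mor C (ob X 0) (ob Y 0)" "c \<in> mor C (ob X (n + 1)) (ob Y (n + 1))"
    and eq: "push (E_rel H) (ob X (n + 1)) a \<delta> = pull (E_rel H) (ob Y 0) c \<rho>"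
  have X: "(X, \<delta>) \<in> \<Theta>" and Y: "(Y, \<rho>) \<in> \<Theta>" using d distinguished_Xi[OF H] Xi_iff_ghost[OF H] by auto
  note DX [simp] = angleD[OF X] and DY [simp] = angleD[OF Y]
  obtain f where "sigma_map C n S (X, \<delta>) (Y, \<rho>) f" "f 0 = a" "f (Suc n) = c"
    using lift_ends_with_cone[OF X Y, of a c] m eq by auto
  then show "\<exists>f. chain_map C (n + 1) X Y f \<and> f 0 = a \<and> f (n + 1) = c"
    using sigma_map_chain_map[of X \<delta> Y \<rho> f] by (intro exI[of _ f]) simp
next
  fix X \<delta> assume "distinguished C n (E_rel H) (s_rel H) (X, \<delta>)"
  then show "exangle C n (E_rel H) (X, \<delta>)" using exangle_Xi[OF H] distinguished_Xi[OF H] by blast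
next
  fix X assume X: "cplx C (n + 1) X" "ob X 1 = ob X 0" "df X 0 = Id C (ob X 0)"
    "\<And>i. 2 \<le> i \<Longrightarrow> i \<le> n + 1 \<Longrightarrow> is_zero C (ob X i)"
  have t: "typed_seq X" using X(1) by (simp add: cplx_iff)
  note D [simp] = typed_seqD[OF t]
  have "(X, zmor C (ob X (Suc n)) (S0 (ob X 0))) \<in> \<Theta>"
    by (rule F1_trivial[OF _ X(2-4)]) (simp_all add: sigma_seq_iff)
  then show "distinguished C n (E_rel H) (s_rel H) (X, \<one>\<^bsub>Ext (E_rel H) (ob X (n + 1)) (ob X 0)\<^esub>)"
    using distinguished_Xi[OF H] Xi_iff_ghost[OF H] by simp
next
  fix X assume X: "cplx C (n + 1) X" "ob X (n + 1) = ob X n" "df X n = Id C (ob X n)"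
    "\<And>i. i < n \<Longrightarrow> is_zero C (ob X i)"
  have t: "typed_seq X" using X(1) by (simp add: cplx_iff)
  note D [simp] = typed_seqD[OF t]
  have "(X, zmor C (ob X (Suc n)) (S0 (ob X 0))) \<in> \<Theta>"
    by (rule trivial_angle[where j = n]) (use X in \<open>simp_all add: sigma_seq_iff\<close>)
  then show "distinguished C n (E_rel H) (s_rel H) (X, \<one>\<^bsub>Ext (E_rel H) (ob X (n + 1)) (ob X 0)\<^esub>)"
    using distinguished_Xi[OF H] Xi_iff_ghost[OF H] by simp
next
  fix A B D f g
  assume O: "A \<in> Ob C" "B \<in> Ob C" "D \<in> Ob C" and m: "f \<in> mor C A B" "g \<in> mor C B D"
    and i: "inflation C n (E_rel H) (s_rel H) f" "inflation C n (E_rel H) (s_rel H) g"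
  have f: "arr f" "cd f = dm g" and g: "arr g" using O m by simp_all
  show "inflation C n (E_rel H) (s_rel H) (g \<bullet> f)"
    using i hom_epi_comp[OF H f(1) g f(2)] f g by (simp add: inflation_Xi[OF H])
next
  fix A B D f g
  assume O: "A \<in> Ob C" "B \<in> Ob C" "D \<in> Ob C" and m: "f \<in> mor C A B" "g \<in> mor C B D"
    and i: "deflation C n (E_rel H) (s_rel H) f" "deflation C n (E_rel H) (s_rel H) g"
  have f: "arr f" "cd f = dm g" and g: "arr g" using O m by simp_all
  obtain X \<delta> where X: "(X, \<delta>) \<in> Xi H" "f = df X n"
    using i(1) distinguished_Xi[OF H] unfolding deflation_def by blast
  obtain Y \<rho> where Y: "(Y, \<rho>) \<in> Xi H" "g = df Y n"
    using i(2) distinguished_Xi[OF H] unfolding deflation_def by blast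
  obtain Z \<sigma> where Z: "(Z, \<sigma>) \<in> \<Theta>" "df Z n = g \<bullet> f" using angle_with_deflation[of "g \<bullet> f"] f g by auto
  have X': "(X, \<delta>) \<in> \<Theta>" and Y': "(Y, \<rho>) \<in> \<Theta>" using X Y Xi_iff_ghost[OF H] by auto
  have n: "n \<le> n" by simp
  have oX: "ob X n = dm f" "ob X (Suc n) = cd f" using angleD(4,5)[OF X' n] by (simp_all add: X(2))
  have oY: "ob Y n = dm g" "ob Y (Suc n) = cd g" using angleD(4,5)[OF Y' n] by (simp_all add: Y(2))
  have oZ: "ob Z n = dm f" "ob Z (Suc n) = cd g" using angleD(4,5)[OF Z(1) n] f g by (simp_all add: Z(2))
  have "(Z, \<sigma>) \<in> Xi H"
    by (rule deflation_saturated[OF H X(1) Y(1) Z(1), where c = "Id C (dm f)"])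
      (use f g in \<open>simp_all add: oX oY oZ Z(2) flip: X(2) Y(2)\<close>)
  then show "deflation C n (E_rel H) (s_rel H) (g \<bullet> f)"
    using distinguished_Xi[OF H] Z(2) unfolding deflation_def by metis
next
  fix Y \<rho> B c X
  assume d: "distinguished C n (E_rel H) (s_rel H) (Y, \<rho>)" "distinguished C n (E_rel H) (s_rel H) (X, pull (E_rel H) (ob Y 0) c \<rho>)"
    and B: "B \<in> Ob C" and c: "c \<in> mor C B (ob Y (n + 1))" and ends: "ob X 0 = ob Y 0" "ob X (n + 1) = B"
  have Y: "(Y, \<rho>) \<in> \<Theta>" "ghost H (ob Y 0) \<rho>" and X: "(X, \<rho> \<bullet> c) \<in> \<Theta>"
    using d distinguished_Xi[OF H] Xi_iff_ghost[OF H] by auto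
  note DX [simp] = angleD(1,3-5)[OF X] and DY [simp] = angleD[OF Y(1)]
  have ct: "arr c" "cd c = ob Y (Suc n)" "dm c = B" using c B by simp_all
  obtain f where f: "sigma_map C n S (X, \<rho> \<bullet> c) (Y, \<rho>) f" "f 0 = Id C (ob X 0)" "f (Suc n) = c"
    and M: "(mcone C n (tail_seq X) (tail_seq Y) (\<lambda>i. f (i + 1)), S1 (df X 0) \<bullet> \<rho>) \<in> \<Theta>"
    using cone_angle[OF Y(1) ct(1,2) X ends(1)] ends(2) ct(3) by auto
  have "ghost H (cd (df X 0)) (S1 (df X 0) \<bullet> \<rho>)"
    by (rule ghost_push[OF Y(2)]) (simp_all add: ends)
  then have "(mcone C n (tail_seq X) (tail_seq Y) (\<lambda>i. f (i + 1)), S1 (df X 0) \<bullet> \<rho>) \<in> Xi H"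
    using M Xi_iff_ghost[OF H] by (simp add: mcone_def tail_seq_def)
  then show "\<exists>f. chain_map C (n + 1) X Y f \<and> f 0 = Id C (ob X 0) \<and> f (n + 1) = c \<and>
      distinguished C n (E_rel H) (s_rel H) (mcone C n (tail_seq X) (tail_seq Y) (\<lambda>i. f (i + 1)),
        push (E_rel H) (ob Y (n + 1)) (df X 0) \<rho>)"
    using f sigma_map_chain_map[OF f(1)] distinguished_Xi[OF H] by (intro exI[of _ f]) simp
next
  fix X \<delta> B a Y
  assume d: "distinguished C n (E_rel H) (s_rel H) (X, \<delta>)" "distinguished C n (E_rel H) (s_rel H) (Y, push (E_rel H) (ob X (n + 1)) a \<delta>)"
    and B: "B \<in> Ob C" and a: "a \<in> mor C (ob X 0) B" and ends: "ob Y 0 = B" "ob Y (n + 1) = ob X (n + 1)"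
  have X: "(X, \<delta>) \<in> \<Theta>" "ghost H (ob X 0) \<delta>" and Y: "(Y, S1 a \<bullet> \<delta>) \<in> \<Theta>"
    using d distinguished_Xi[OF H] Xi_iff_ghost[OF H] by auto
  note DX [simp] = angleD[OF X(1)] and DY [simp] = angleD(1,3-5)[OF Y]
  have at: "arr a" "dm a = ob X 0" "cd a = B" using a B by simp_all
  obtain f where f: "sigma_map C n S (X, \<delta>) (Y, S1 a \<bullet> \<delta>) f" "f 0 = a" "f (Suc n) = Id C (ob X (Suc n))"
    and M: "(mcocone C n X Y f, \<delta> \<bullet> df Y n) \<in> \<Theta>"
    using cocone_angle[OF X(1) at(1,2) Y] ends at(3) by auto
  have "ghost H (ob X 0) (\<delta> \<bullet> df Y n)"
    by (rule ghost_pull[OF X(2)]) (use ends in simp_all)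
  then have "(mcocone C n X Y f, \<delta> \<bullet> df Y n) \<in> Xi H"
    using M Xi_iff_ghost[OF H] by (simp add: mcocone_def)
  then show "\<exists>f. chain_map C (n + 1) X Y f \<and> f 0 = a \<and> f (n + 1) = Id C (ob X (n + 1)) \<and>
      distinguished C n (E_rel H) (s_rel H) (mcocone C n X Y f, pull (E_rel H) (ob X 0) (df Y n) \<delta>)"
    using f sigma_map_chain_map[OF f(1)] distinguished_Xi[OF H] by (intro exI[of _ f]) simp
qed

section \<open>Exact and angulated relative structures\<close>

lemma exangulated_isoD:
  assumes "exangulated_iso C E s F t"
  shows "\<exists>\<phi>. (\<forall>D\<in>Ob C. \<forall>A\<in>Ob C. \<phi> D A \<in> iso (Ext E D A) (Ext F D A)) \<and>
    (\<forall>D\<in>Ob C. \<forall>A\<in>Ob C. \<forall>\<delta>\<in>carrier (Ext E D A). t D A (\<phi> D A \<delta>) = s D A \<delta>)"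
  using assms unfolding exangulated_iso_def by (elim exE conjE, intro exI conjI)

text \<open>
  If the conflations are \<open>n\<close>-exact, then \<open>d\<^sup>0\<close> is a monomorphism for every angle in \<open>\<xi>\<close>; the
  property passes to \<open>X\<close> from any member of its homotopy class, as the comparison map is the
  identity in degree \<open>0\<close>.  Since \<open>d\<^sup>0\<close> kills the desuspension of \<open>\<delta>\<close>, it follows that \<open>\<delta> = 0\<close>.
\<close>

lemma n_exact_imp_split:
  assumes H: "H \<subseteq> Ob C" and ex: "is_n_exact C n (E_rel H) (s_rel H)"
  shows "Xi H = split_angles C n S \<Theta>"
proof
  obtain \<E> where \<E>: "n_exact_structure C n \<E>"
    and iso: "exangulated_iso C (E_rel H) (s_rel H) (n_exact_bifunctor C n \<E>) (\<lambda>D A K. K)"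
    using ex unfolding is_n_exact_def by (elim exE conjE)
  obtain \<phi> where \<phi>': "\<forall>D\<in>Ob C. \<forall>A\<in>Ob C. \<phi> D A \<in> iso (Ext (E_rel H) D A) (Ext (n_exact_bifunctor C n \<E>) D A)"
    and t': "\<forall>D\<in>Ob C. \<forall>A\<in>Ob C. \<forall>\<delta>\<in>carrier (Ext (E_rel H) D A). \<phi> D A \<delta> = s_rel H D A \<delta>"
    using exangulated_isoD[OF iso] by (elim exE conjE)
  note \<phi> = \<phi>'[rule_format] and t = t'[rule_format]
  show "Xi H \<subseteq> split_angles C n S \<Theta>"
  proof
    fix T assume "T \<in> Xi H"
    then obtain X \<delta> where T: "T = (X, \<delta>)" and X: "(X, \<delta>) \<in> Xi H" by (cases T) auto
    have X': "(X, \<delta>) \<in> \<Theta>" "ghost H (ob X 0) \<delta>" using X Xi_iff_ghost[OF H] by auto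
    note D [simp] = angleD[OF X'(1)]
    have O: "ob X (Suc n) \<in> Ob C" "ob X 0 \<in> Ob C" "ob X (Suc 0) \<in> Ob C" by simp_all
    have c: "\<delta> \<in> carrier (Ext (E_rel H) (ob X (Suc n)) (ob X 0))"
      using X'(2) by (simp add: E_rel_carrier[OF H])
    have "hclass C (Suc n) X = \<phi> (ob X (Suc n)) (ob X 0) \<delta>"
      using X distinguished_Xi[OF H, of X \<delta>] t[OF O(1,2) c] by (simp add: distinguished_def)
    also have "\<dots> \<in> carrier (Ext (n_exact_bifunctor C n \<E>) (ob X (Suc n)) (ob X 0))"
      using \<phi>[OF O(1,2)] c by (auto simp: iso_def intro: hom_in_carrier)
    finally obtain Y where Y: "Y \<in> \<E>" "hclass C (Suc n) X = hclass C (Suc n) Y"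
      by (auto simp: n_exact_bifunctor_def)
    have cY: "n_exact_seq C n Y" using \<E> Y(1) unfolding n_exact_structure_def by blast
    then have tY: "typed_seq Y" and le: "left_exact C n Y" by (simp_all add: n_exact_seq_def cplx_iff)
    note tX = angle_typed_seq[OF X'(1)]
    note DY [simp] = typed_seqD[OF tY]
    have "X \<in> hclass C (Suc n) X" using angle_cplx[OF X'(1)] homotopy_equivalent_refl by (simp add: hclass_def)
    then have "homotopy_equivalent C (Suc n) Y X" unfolding Y(2) by (simp add: hclass_def)
    then obtain g where "end_fixing_map C (Suc n) X Y g" unfolding homotopy_equivalent_def by blast
    then have g: "typed_map X Y g" and gc: "df Y 0 \<bullet> g 0 = g (Suc 0) \<bullet> df X 0" and g0: "g 0 = Id C (ob X 0)"
      and e: "ob X 0 = ob Y 0"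
      using n_ge_1 by (auto simp: end_fixing_map_def chain_map_iff[OF tX tY])
    \<comment> \<open>The desuspension of \<open>\<delta>\<close>.\<close>
    obtain k where k: "arr k" "dm k = S0inv (ob X (Suc n))" "cd k = ob X 0" "S1 k = \<delta>"
      using S1_surj[of \<delta> "S0inv (ob X (Suc n))" "ob X 0"] O by auto
    have g1: "arr (g (Suc 0))" "dm (g (Suc 0)) = ob X (Suc 0)" "cd (g (Suc 0)) = ob Y (Suc 0)"
      using typed_mapD[OF g] by simp_all
    have "S1 (df X 0 \<bullet> k) = S1 (zmor C (dm k) (ob X (Suc 0)))"
      using angle_zero(3)[OF X'(1)] k O by simp
    then have dk: "df X 0 \<bullet> k = zmor C (dm k) (ob X (Suc 0))" using k O by - (rule S1_inj, simp_all)
    have O1: "ob Y (Suc 0) \<in> Ob C" by simp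
    have "df Y 0 \<bullet> k = (df Y 0 \<bullet> g 0) \<bullet> k" using k e by (simp add: g0)
    also have "\<dots> = g (Suc 0) \<bullet> df X 0 \<bullet> k" unfolding gc using k g1 by simp
    also have "\<dots> = zmor C (dm k) (ob Y (Suc 0))" using g1 k by (simp add: dk)
    finally have "df Y 0 \<bullet> k = zmor C (dm k) (ob Y 1)" by simp
    moreover have "k \<in> mor C (dm k) (ob Y 0)" "dm k \<in> Ob C" using k e by simp_all
    ultimately have "k = zmor C (dm k) (ob Y 0)" using le unfolding left_exact_def by blast
    then have "S1 k = S1 (zmor C (dm k) (ob Y 0))" by (rule arg_cong)
    then have "\<delta> = zmor C (ob X (Suc n)) (S0 (ob X 0))" using k O e by simp
    then show "T \<in> split_angles C n S \<Theta>" using X'(1) T by (simp add: split_angles_def)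
  qed
  show "split_angles C n S \<Theta> \<subseteq> Xi H"
  proof
    fix T assume "T \<in> split_angles C n S \<Theta>"
    then obtain X where T: "T = (X, zmor C (ob X (Suc n)) (S0 (ob X 0)))" and X: "T \<in> \<Theta>"
      by (auto simp: split_angles_def)
    show "T \<in> Xi H" using X angleD[OF X[unfolded T]] Xi_iff_ghost[OF H] unfolding T by simp
  qed
qed

text \<open>
  In an angulated category every morphism is an inflation.  A natural isomorphism that respects
  the realizations preserves inflations, so every morphism of \<open>C\<close> is a relative inflation, that is,
  satisfies the surjectivity condition defining \<open>\<xi>\<close>.
\<close>

lemma angulated_imp_all:
  assumes H: "H \<subseteq> Ob C" and an: "is_angulated C n (E_rel H) (s_rel H)"
  shows "\<Theta> = Xi H"
proof -
  obtain S' \<Theta>' where A': "angulated_category C n S' \<Theta>'"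
    and iso: "exangulated_iso C (E_rel H) (s_rel H) (angulated_bifunctor C S') (angulated_realization C n \<Theta>')"
    using an unfolding is_angulated_def by (elim exE conjE)
  interpret A': angulated_category C n S' \<Theta>' by (rule A')
  obtain \<phi> where \<phi>': "\<forall>D\<in>Ob C. \<forall>A\<in>Ob C. \<phi> D A \<in> iso (Ext (E_rel H) D A) (Ext (angulated_bifunctor C S') D A)"
    and t': "\<forall>D\<in>Ob C. \<forall>A\<in>Ob C. \<forall>\<delta>\<in>carrier (Ext (E_rel H) D A).
      angulated_realization C n \<Theta>' D A (\<phi> D A \<delta>) = s_rel H D A \<delta>"
    using exangulated_isoD[OF iso] by (elim exE conjE)
  note \<phi> = \<phi>'[rule_format] and t = t'[rule_format]
  have all: "hom_epi C H (dm f) (cd f) f" if f: "arr f" for f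
  proof -
    obtain X \<rho> where X: "(X, \<rho>) \<in> \<Theta>'" "ob X 0 = dm f" "ob X 1 = cd f" "df X 0 = f"
      using A'.F1_first[of "dm f" "cd f" f] f by auto
    note D [simp] = A'.angleD[OF X(1)]
    have O: "ob X (Suc n) \<in> Ob C" "ob X 0 \<in> Ob C" by simp_all
    have "\<rho> \<in> carrier (Ext (angulated_bifunctor C S') (ob X (Suc n)) (ob X 0))"
      by (simp add: angulated_bifunctor_def)
    moreover have "\<phi> (ob X (Suc n)) (ob X 0) ` carrier (Ext (E_rel H) (ob X (Suc n)) (ob X 0)) =
        carrier (Ext (angulated_bifunctor C S') (ob X (Suc n)) (ob X 0))"
      using \<phi>[OF O] by (simp add: iso_def bij_betw_def)
    ultimately have "\<rho> \<in> \<phi> (ob X (Suc n)) (ob X 0) ` carrier (Ext (E_rel H) (ob X (Suc n)) (ob X 0))"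
      by simp
    then obtain \<delta> where \<delta>: "\<delta> \<in> carrier (Ext (E_rel H) (ob X (Suc n)) (ob X 0))"
        "\<rho> = \<phi> (ob X (Suc n)) (ob X 0) \<delta>" by (rule imageE)
    have "s_rel H (ob X (Suc n)) (ob X 0) \<delta> = hclass C (Suc n) X"
      using t[OF O \<delta>(1)] A'.angulated_realization_eq[OF X(1)] \<delta>(2) by simp
    then have "distinguished C n (E_rel H) (s_rel H) (X, \<delta>)"
      using \<delta>(1) A'.angle_cplx[OF X(1)] by (simp add: distinguished_def)
    then have "inflation C n (E_rel H) (s_rel H) f" using X(4) unfolding inflation_def by blast
    then show ?thesis using inflation_Xi[OF H f] by simp
  qed
  show ?thesis
  proof (intro subset_antisym subsetI)
    fix T assume "T \<in> \<Theta>"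
    then obtain X \<delta> where T: "T = (X, \<delta>)" and X: "(X, \<delta>) \<in> \<Theta>" by (cases T) auto
    show "T \<in> Xi H" using all[of "df X 0"] angleD[OF X] X T by (simp add: hom_epi_class_def)
  qed (auto simp: hom_epi_class_def)
qed

text \<open>
  The approximation angles lie in \<open>\<xi>\<close>.  If they split, then every object is a direct summand of an
  object of \<open>H\<close>.
\<close>

lemma strongly_covariantly_finite_split:
  assumes H: "H \<subseteq> Ob C" and scf: "strongly_covariantly_finite C n \<Theta> H" and cs: "closed_under_summands C H"
    and sp: "Xi H = split_angles C n S \<Theta>"
  shows "H = Ob C"
proof (intro subset_antisym subsetI)
  fix B assume B: "B \<in> Ob C"
  obtain X \<delta> where X: "(X, \<delta>) \<in> \<Theta>" "ob X 0 = B" "left_approximation C H B (ob X 1) (df X 0)"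
    using scf B unfolding strongly_covariantly_finite_def by blast
  note D [simp] = angleD[OF X(1)]
  have O1: "ob X (Suc 0) \<in> Ob C" by simp
  have "(X, \<delta>) \<in> Xi H" using X by (simp add: hom_epi_class_def left_approximation_def)
  then have \<delta>: "\<delta> = zmor C (ob X (Suc n)) (S0 (ob X 0))" using sp by (auto simp: split_angles_def)
  obtain h where h: "arr h" "dm h = ob X 1" "cd h = B" "Id C B = h \<bullet> df X 0"
    using angle_right_exact(3)[OF X(1), of "Id C B"] B X(2) by (auto simp: \<delta>)
  have "df X 0 \<in> mor C B (ob X 1)" "h \<in> mor C (ob X 1) B" "ob X 1 \<in> H" "h \<bullet> df X 0 = Id C B"
    using B X h O1 by (simp_all add: left_approximation_def)
  then show "B \<in> H" using cs B unfolding closed_under_summands_def by blast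
qed (use H in blast)

text \<open>
  If \<open>A \<rightarrow> 0\<close> is a relative inflation and \<open>A\<close> lies in \<open>H\<close>, then the identity of \<open>A\<close> factors
  through \<open>0\<close>.
\<close>

lemma zero_if_everything_relative:
  assumes H: "H \<subseteq> Ob C" and all: "\<Theta> = Xi H" and A: "A \<in> H"
  shows "is_zero C A"
proof -
  have AO: "A \<in> Ob C" using A H by blast
  obtain X \<delta> where X: "(X, \<delta>) \<in> \<Theta>" "ob X 0 = A" "ob X 1 = zero_obj" "df X 0 = zmor C A zero_obj"
    using F1_first[of A zero_obj "zmor C A zero_obj"] AO by auto
  have "(X, \<delta>) \<in> Xi H" by (subst all[symmetric]) (rule X(1))
  then have "hom_epi C H A zero_obj (zmor C A zero_obj)" using X(2-4) by (simp add: hom_epi_class_def)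
  then have "\<forall>g. arr g \<and> dm g = A \<and> cd g \<in> H \<longrightarrow>
      (\<exists>h. arr h \<and> dm h = zero_obj \<and> cd h = cd g \<and> g = h \<bullet> zmor C A zero_obj)"
    using hom_epi_iff[OF H, of "zmor C A zero_obj" A zero_obj] AO by simp
  from this[rule_format, of "Id C A"] have "\<exists>h. arr h \<and> dm h = zero_obj \<and> cd h = A \<and> Id C A = h \<bullet> zmor C A zero_obj"
    using A AO by simp
  then obtain h where h: "arr h" "dm h = zero_obj" "cd h = A" and id: "Id C A = h \<bullet> zmor C A zero_obj"
    by (elim exE conjE)
  have "h \<bullet> zmor C A zero_obj = zmor C A A" using h AO by simp
  then show ?thesis using AO id by (intro is_zeroI) (rule AO, rule trans)
qed

end

theorem proposition4p8:
  fixes C :: "('o, 'm) cat" and n :: nat and S :: "('o, 'm) endo"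
    and \<Theta> \<xi> :: "(('o, 'm) seq \<times> 'm) set" and H :: "'o set"
    and E E\<^sub>\<xi> :: "('o, 'm, 'm) bifunctor" and s s\<^sub>\<xi> :: "('o, 'm, 'm) realization"
  assumes angulated: "angulated_category C n S \<Theta>"
    and subcategory: "H \<subseteq> Ob C"
    and xi: "\<xi> = hom_epi_class C \<Theta> H"
    and E: "E = angulated_bifunctor C S"
    and s: "s = angulated_realization C n \<Theta>"
    and E_xi: "E\<^sub>\<xi> = sub_bifunctor n E s C \<xi>"
    and s_xi: "s\<^sub>\<xi> = sub_realization n E s C \<xi>"
  shows "(n_proper_class C n E s \<xi> \<and> n_exangulated_category C n E\<^sub>\<xi> s\<^sub>\<xi>) \<and>
    (is_n_exact C n E\<^sub>\<xi> s\<^sub>\<xi> \<longrightarrow> \<xi> = split_angles C n S \<Theta>) \<and>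
    (is_angulated C n E\<^sub>\<xi> s\<^sub>\<xi> \<longrightarrow> \<Theta> = \<xi>) \<and>
    (strongly_covariantly_finite C n \<Theta> H \<and> closed_under_summands C H \<and>
      (\<exists>A\<in>H. \<not> is_zero C A) \<and> H \<noteq> Ob C
      \<longrightarrow> \<not> is_n_exact C n E\<^sub>\<xi> s\<^sub>\<xi> \<and> \<not> is_angulated C n E\<^sub>\<xi> s\<^sub>\<xi>)"
proof -
  interpret angulated_category C n S \<Theta> by (rule angulated)
  show ?thesis
    unfolding E_xi s_xi E s xi
    using n_proper_Xi[OF subcategory] n_exangulated_Xi[OF subcategory]
      n_exact_imp_split[OF subcategory] angulated_imp_all[OF subcategory]
      strongly_covariantly_finite_split[OF subcategory] zero_if_everything_relative[OF subcategory]
    by blast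
qed

end
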